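(* Let $N\ge 1$ and let threads $1,\dots,N$ share the Dynamic Elimination-Combining Stack (DECS), i.e. the concurrent object whose operations $\mathtt{push}(d)$ and $\mathtt{pop}()$ are executed by the DECS pseudo-code given in the context, starting from the initial state given there. Then DECS is deadlock-free: in every execution in which every thread with a pending operation keeps being scheduled (takes infinitely many steps unless its operation completes), whenever some operation is pending, some operation eventually completes.
   Context: **Model.** Asynchronous shared memory; each shared read, write and compare-and-swap (CAS) is atomic. $\mathrm{CAS}(\&x,a,b)$: if $x=a$, sets $x:=b$ and returns true; otherwise returns false. Variables of type Cell and multiOp are pointers to records, compared as pointers. Every record is freshly allocated and never reused for another purpose, so there is no ABA problem on pointers. Each thread executes one operation at a time; an operation is pending if it has been invoked and has not yet returned, and completes when it returns. In a function body, parameters are local variables, so assigning to $mOp$ itself does not affect the caller, whereas assigning to fields of the record does. "id" denotes the identifier of the executing thread. **Records and shared variables.** Cell: fields data, next. multiOp: fields id, op $\in\{PUSH,POP\}$, length, cStatus $\in\{INIT,FINISHED,RETRY\}$, cell (a Cell), next, last (multiOps). EMPTY_CELL is a fixed constant Cell whose data is the "empty" indication. Globals: $CentralStack$ (Cell pointer, initially null); $collision[1..N]$ (integers, initially $EMPTY$, a value which is not a thread identifier); $location[1..N]$ (multiOp pointers, initially null). initMultiOp() (for pop), respectively initMultiOp($d$) (for push), returns a new multiOp record $r$ with $r$.id = id, $r$.op = POP (resp. PUSH), $r$.length = 1, $r$.cStatus = INIT, $r$.next = null, $r$.last = $r$, and $r$.cell empty (resp. $r$.cell a new Cell with data $d$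 and next null). randomIndex() returns an arbitrary (randomly chosen) index in $\{1,\dots,N\}$. wait() is a finite delay with no effect. await($C$) repeatedly tests $C$ until it holds. In the code, "=" in statements is assignment and "==" is an equality test. **pop()**: mOp = initMultiOp(); loop forever: { if cMultiPop(mOp) return mOp.cell.data; else if collide(mOp) return mOp.cell.data }. **push(d)**: mOp = initMultiOp(d); loop forever: { if cMultiPush(mOp) return; else if collide(mOp) return }. **boolean cMultiPop(mOp)**: 1. top = CentralStack. 2. If top == null: repeat { mOp.cell = EMPTY_CELL; mOp.cStatus = FINISHED; mOp = mOp.next } until mOp == null; return true. 3. nTop = top.next; m = 1; while (nTop $\ne$ null and m < mOp.length) { nTop = nTop.next; m = m+1 }. 4. If CAS(&CentralStack, top, nTop): { mOp.cell = top; top = top.next; while (mOp.next $\neq$ null) { if top == null then mOp.next.cell = EMPTY_CELL, else { mOp.next.cell = top; top = top.next }; mOp.next.cStatus = FINISHED; mOp.next = mOp.next.next }; return true }. Otherwise return false. **boolean cMultiPush(mOp)**: top = CentralStack; mOp.last.cell.next = top; if CAS(&CentralStack, top, mOp.cell): { while (mOp.next $\ne$ null) { mOp.next.cStatus = FINISHED; mOp.next = mOp.next.next }; return true }; else return false. **boolean collide(mOp)**: 1. location[id] = mOp; index = randomIndex(); him = collision[index]. 2. While CAS(&collision[index], him, id) == false: him = collision[index]. 3. If him $\ne$ EMPTY: { oInfo = location[him]; if (oInfo $\neq$ null and oInfo.id $\ne$ id and oInfo.id == him): { if CAS(&location[id], mOp, null) == true, return activeCollide(mOp, oInfo); else return passiveCollide(mOp)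 } }. 4. wait(); if CAS(&location[id], mOp, null) == false, return passiveCollide(mOp). 5. Return false. **boolean activeCollide(aInf, pInf)**: if CAS(&location[pInf.id], pInf, aInf): { if aInf.op == pInf.op: { combine(aInf, pInf); return false } else { multiEliminate(aInf, pInf); return true } }; else return false. **boolean passiveCollide(pInf)**: aInf = location[pInf.id]; location[pInf.id] = null; if pInf.op $\ne$ aInf.op: { if pInf.op == POP then pInf.cell = aInf.cell; return true }; else { await(pInf.cStatus $\neq$ INIT); if pInf.cStatus == FINISHED return true; else { pInf.cStatus = INIT; return false } }. **combine(aInf, pInf)**: if aInf.op == PUSH: aInf.last.cell.next = pInf.cell. Then aInf.last.next = pInf; aInf.last = pInf.last; aInf.length = aInf.length + pInf.length. **multiEliminate(aInf, pInf)**: aCurr = aInf; pCurr = pInf; repeat { if aInf.op == POP then aCurr.cell = pCurr.cell, else pCurr.cell = aCurr.cell; aCurr.cStatus = FINISHED; pCurr.cStatus = FINISHED; aInf.length = aInf.length $-1$; pInf.length = pInf.length $-1$; aCurr = aCurr.next; pCurr = pCurr.next } until (aCurr == null or pCurr == null). Then: if aCurr $\ne$ null: { aCurr.length = aInf.length; aCurr.last = aInf.last; aCurr.cStatus = RETRY }; else if pCurr $\neq$ null: { pCurr.length = pInf.length; pCurr.last = pInf.last; pCurr.cStatus = RETRY }. *)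

theory Defs
  imports Main
begin

section \<open>Records and shared memory\<close>

text \<open>A pointer is an optional address; \<^term>\<open>None\<close> is null. The two heaps are partial maps from
  addresses to records. Thread identifiers are natural numbers, and \<^term>\<open>None\<close> is the value EMPTY
  of an entry of the collision array. The data component \<^term>\<open>None\<close> of a cell is the "empty"
  indication.\<close>

datatype cref = Cref nat
datatype mref = Mref nat

datatype kind = PUSH | POP
datatype status = INIT | FINISHED | RETRY

record 'd cell =
  c_data :: "'d option"
  c_next :: "cref option"

record multiop =
  m_id :: nat
  m_op :: kind
  m_length :: int
  m_cStatus :: status
  m_cell :: "cref option"
  m_next :: "mref option"
  m_last :: "mref option"

record 'd mem =
  cells :: "cref \<Rightarrow> 'd cell option"
  mops :: "mref \<Rightarrow> multiop option"
  centralStack :: "cref option"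
  collision :: "nat \<Rightarrow> nat option"
  location :: "nat \<Rightarrow> mref option"

definition EMPTY_CELL :: cref where
  "EMPTY_CELL = Cref 0"

definition init_mem :: "'d mem" where
  "init_mem = \<lparr>cells = [EMPTY_CELL \<mapsto> \<lparr>c_data = None, c_next = None\<rparr>], mops = (\<lambda>_. None),
     centralStack = None, collision = (\<lambda>_. None), location = (\<lambda>_. None)\<rparr>"


section \<open>Threads\<close>

datatype 'd operation = Push 'd | Pop

datatype 'd response = Pushed | Popped "'d option"

datatype pop_pc =
  CPop1 | CPop2a | CPop2b | CPop2c | CPop3a | CPop3b | CPop3c | CPop4a | CPop4b | CPop4c | CPop4d |
  CPop4e | CPop4f | CPop4g | CPop4h | CPop4i | CPop4j | CPop4k | CPop4l | CPop4m

datatype push_pc =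
  CPush1 | CPush2a | CPush2b | CPush2c | CPush3a | CPush3b | CPush4a | CPush4b | CPush4c | CPush4d |
  CPush4e | CPush4f

datatype collide_pc =
  Col1a | Col1b | Col2a | Col2b | Col3a | Col3b | Col3c | Col3d | Col4a | Col4b | Col4c

datatype active_pc = Act1a | Act1b | Act2a | Act2b

datatype passive_pc =
  Pas1a | Pas1b | Pas2a | Pas2b | Pas3a | Pas3b | Pas4a | Pas4b | Pas4c | Pas5 | Pas6a | Pas6b

datatype combine_pc =
  Com1a | Com1b | Com1c | Com1d | Com1e | Com2a | Com2b | Com3a | Com3b | Com4a | Com4b | Com4c

datatype elim_pc =
  Eli1a | Eli1b | Eli1c | Eli1d | Eli1e | Eli2a | Eli2b | Eli3a | Eli3b | Eli3c | Eli3d |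
  Eli4a | Eli4b | Eli5a | Eli5b | Eli5c | Eli5d | Eli5e | Eli6a | Eli6b | Eli6c | Eli6d | Eli6e

datatype pc =
  Idle | Init | CMultiPop pop_pc | CMultiPush push_pc | Collide collide_pc |
  ActiveCollide active_pc | PassiveCollide passive_pc | Combine combine_pc |
  MultiEliminate elim_pc | PopResult1 | PopResult2 | Ret | Fault

text \<open>The variable \<open>vMOp\<close> is the \<open>mOp\<close> of push and pop, and also the parameter \<open>mOp\<close> of the
  functions that do not assign to it; \<open>vPOp\<close> is the parameter \<open>mOp\<close> of \<open>cMultiPop\<close>, which does.
  The variables \<open>tC\<close>, \<open>tC'\<close>, \<open>tM\<close>, \<open>tLen\<close>, \<open>tId\<close> and \<open>tOp\<close> hold intermediate values of
  expressions with several shared accesses.\<close>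

record 'd locals =
  invoked :: "'d operation"
  vMOp :: "mref option"
  vPOp :: "mref option"
  vTop :: "cref option"
  vNTop :: "cref option"
  vM :: int
  vIndex :: nat
  vHim :: "nat option"
  vOInfo :: "mref option"
  vDelay :: nat
  vAInf :: "mref option"
  vPInf :: "mref option"
  vACurr :: "mref option"
  vPCurr :: "mref option"
  vResp :: "'d response"
  tC :: "cref option"
  tC' :: "cref option"
  tM :: "mref option"
  tLen :: int
  tId :: nat
  tOp :: kind


section \<open>Atomic actions\<close>

text \<open>An action yields the possible outcomes of one atomic step from a given memory: the new
  program point, the new local variables and the new memory. Dereferencing a pointer that does not
  point to a record sends the thread to \<^term>\<open>Fault\<close>, where it remains forever without
  returning.\<close>

type_synonym 'd control = "pc \<times> 'd locals"
type_synonym 'd action = "'d mem \<Rightarrow> ('d control \<times> 'd mem) set"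

definition load :: "('d mem \<Rightarrow> 'v) \<Rightarrow> ('v \<Rightarrow> 'd control) \<Rightarrow> 'd action" where
  "load get k m = {(k (get m), m)}"

definition store :: "('v \<Rightarrow> 'd mem \<Rightarrow> 'd mem) \<Rightarrow> 'v \<Rightarrow> 'd control \<Rightarrow> 'd action" where
  "store put v k m = {(k, put v m)}"

definition cas ::
  "('d mem \<Rightarrow> 'v) \<Rightarrow> ('v \<Rightarrow> 'd mem \<Rightarrow> 'd mem) \<Rightarrow> 'v \<Rightarrow> 'v \<Rightarrow> (bool \<Rightarrow> 'd control) \<Rightarrow> 'd action" where
  "cas get put a b k m = {if get m = a then (k True, put b m) else (k False, m)}"

definition read_cell ::
  "'d locals \<Rightarrow> cref option \<Rightarrow> ('d cell \<Rightarrow> 'v) \<Rightarrow> ('v \<Rightarrow> 'd control) \<Rightarrow> 'd action" where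
  "read_cell l p f k m =
     {(case Option.bind p (cells m) of None \<Rightarrow> (Fault, l) | Some r \<Rightarrow> k (f r), m)}"

definition write_cell ::
  "'d locals \<Rightarrow> cref option \<Rightarrow> ('d cell \<Rightarrow> 'd cell) \<Rightarrow> 'd control \<Rightarrow> 'd action" where
  "write_cell l p u k m =
     {case Option.bind p (cells m) of None \<Rightarrow> ((Fault, l), m)
      | Some r \<Rightarrow> (k, m\<lparr>cells := (cells m)(the p \<mapsto> u r)\<rparr>)}"

definition read_mop ::
  "'d locals \<Rightarrow> mref option \<Rightarrow> (multiop \<Rightarrow> 'v) \<Rightarrow> ('v \<Rightarrow> 'd control) \<Rightarrow> 'd action" where
  "read_mop l p f k m =
     {(case Option.bind p (mops m) of None \<Rightarrow> (Fault, l) | Some r \<Rightarrow> k (f r), m)}"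

definition write_mop ::
  "'d locals \<Rightarrow> mref option \<Rightarrow> (multiop \<Rightarrow> multiop) \<Rightarrow> 'd control \<Rightarrow> 'd action" where
  "write_mop l p u k m =
     {case Option.bind p (mops m) of None \<Rightarrow> ((Fault, l), m)
      | Some r \<Rightarrow> (k, m\<lparr>mops := (mops m)(the p \<mapsto> u r)\<rparr>)}"

definition pick :: "'v set \<Rightarrow> ('v \<Rightarrow> 'd control) \<Rightarrow> 'd action" where
  "pick A k m = {(k v, m) | v. v \<in> A}"

definition put_central :: "cref option \<Rightarrow> 'd mem \<Rightarrow> 'd mem" where
  "put_central v m = m\<lparr>centralStack := v\<rparr>"

definition put_collision :: "nat \<Rightarrow> nat option \<Rightarrow> 'd mem \<Rightarrow> 'd mem" where
  "put_collision i v m = m\<lparr>collision := (collision m)(i := v)\<rparr>"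

definition put_location :: "nat \<Rightarrow> mref option \<Rightarrow> 'd mem \<Rightarrow> 'd mem" where
  "put_location i v m = m\<lparr>location := (location m)(i := v)\<rparr>"


section \<open>The code of the stack\<close>

text \<open>Every step performs at most one shared read, write or CAS. Tests and assignments on local
  variables, and calls and returns, are attached to the step that precedes them. The argument
  \<open>t\<close> is the identifier of the executing thread.\<close>

text \<open>\<open>loop_body\<close> starts an iteration of the loop of push or pop, \<open>op_return\<close> leaves that loop,
  and \<open>collide_return\<close> is the return of \<open>collide\<close>, whose last action may be a call of
  \<open>activeCollide\<close> or \<open>passiveCollide\<close>.\<close>

definition loop_body :: "'d locals \<Rightarrow> 'd control" where
  "loop_body l = (case invoked l of
      Pop \<Rightarrow> (CMultiPop CPop1, l\<lparr>vPOp := vMOp l\<rparr>)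
    | Push d \<Rightarrow> (CMultiPush CPush1, l))"

definition op_return :: "'d locals \<Rightarrow> 'd control" where
  "op_return l = (case invoked l of
      Pop \<Rightarrow> (PopResult1, l)
    | Push d \<Rightarrow> (Ret, l\<lparr>vResp := Pushed\<rparr>))"

definition collide_return :: "bool \<Rightarrow> 'd locals \<Rightarrow> 'd control" where
  "collide_return b l = (if b then op_return l else loop_body l)"

definition new_mop :: "nat \<Rightarrow> mref \<Rightarrow> kind \<Rightarrow> cref option \<Rightarrow> multiop" where
  "new_mop t r k c = \<lparr>m_id = t, m_op = k, m_length = 1, m_cStatus = INIT,
     m_cell = c, m_next = None, m_last = Some r\<rparr>"

definition init_multiop :: "nat \<Rightarrow> 'd locals \<Rightarrow> 'd action" where
  "init_multiop t l m = (case invoked l of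
      Pop \<Rightarrow>
        {(loop_body (l\<lparr>vMOp := Some r\<rparr>), m\<lparr>mops := (mops m)(r \<mapsto> new_mop t r POP None)\<rparr>)
         | r. mops m r = None}
    | Push d \<Rightarrow>
        {(loop_body (l\<lparr>vMOp := Some r\<rparr>),
          m\<lparr>mops := (mops m)(r \<mapsto> new_mop t r PUSH (Some c)),
            cells := (cells m)(c \<mapsto> \<lparr>c_data = Some d, c_next = None\<rparr>)\<rparr>)
         | r c. mops m r = None \<and> cells m c = None})"

fun pop_code :: "pop_pc \<Rightarrow> 'd locals \<Rightarrow> 'd action" where
  (* top = CentralStack; if top == null *)
  "pop_code CPop1 l = load centralStack
     (\<lambda>v. (CMultiPop (if v = None then CPop2a else CPop3a), l\<lparr>vTop := v\<rparr>))"
  (* mOp.cell = EMPTY_CELL; mOp.cStatus = FINISHED; mOp = mOp.next; until mOp == null *)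
| "pop_code CPop2a l = write_mop l (vPOp l) (\<lambda>r. r\<lparr>m_cell := Some EMPTY_CELL\<rparr>) (CMultiPop CPop2b, l)"
| "pop_code CPop2b l = write_mop l (vPOp l) (\<lambda>r. r\<lparr>m_cStatus := FINISHED\<rparr>) (CMultiPop CPop2c, l)"
| "pop_code CPop2c l = read_mop l (vPOp l) m_next
     (\<lambda>v. if v = None then op_return (l\<lparr>vPOp := v\<rparr>) else (CMultiPop CPop2a, l\<lparr>vPOp := v\<rparr>))"
  (* nTop = top.next; m = 1; while (nTop \<noteq> null and m < mOp.length) { nTop = nTop.next; m = m+1 } *)
| "pop_code CPop3a l = read_cell l (vTop l) c_next
     (\<lambda>v. (CMultiPop (if v \<noteq> None then CPop3b else CPop4a), l\<lparr>vNTop := v, vM := 1\<rparr>))"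
| "pop_code CPop3b l = read_mop l (vPOp l) m_length
     (\<lambda>n. (CMultiPop (if vM l < n then CPop3c else CPop4a), l))"
| "pop_code CPop3c l = read_cell l (vNTop l) c_next
     (\<lambda>v. (CMultiPop (if v \<noteq> None then CPop3b else CPop4a), l\<lparr>vNTop := v, vM := vM l + 1\<rparr>))"
  (* if CAS(&CentralStack, top, nTop): mOp.cell = top; top = top.next *)
| "pop_code CPop4a l = cas centralStack put_central (vTop l) (vNTop l)
     (\<lambda>b. if b then (CMultiPop CPop4b, l) else (Collide Col1a, l))"
| "pop_code CPop4b l = write_mop l (vPOp l) (\<lambda>r. r\<lparr>m_cell := vTop l\<rparr>) (CMultiPop CPop4c, l)"
| "pop_code CPop4c l = read_cell l (vTop l) c_next (\<lambda>v. (CMultiPop CPop4d, l\<lparr>vTop := v\<rparr>))"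
  (* while (mOp.next \<noteq> null) *)
| "pop_code CPop4d l = read_mop l (vPOp l) m_next
     (\<lambda>v. if v = None then op_return l else (CMultiPop CPop4e, l))"
  (* mOp.next.cell = EMPTY_CELL; or mOp.next.cell = top; top = top.next *)
| "pop_code CPop4e l = read_mop l (vPOp l) m_next
     (\<lambda>v. (CMultiPop (if vTop l = None then CPop4f else CPop4g), l\<lparr>tM := v\<rparr>))"
| "pop_code CPop4f l = write_mop l (tM l) (\<lambda>r. r\<lparr>m_cell := Some EMPTY_CELL\<rparr>) (CMultiPop CPop4i, l)"
| "pop_code CPop4g l = write_mop l (tM l) (\<lambda>r. r\<lparr>m_cell := vTop l\<rparr>) (CMultiPop CPop4h, l)"
| "pop_code CPop4h l = read_cell l (vTop l) c_next (\<lambda>v. (CMultiPop CPop4i, l\<lparr>vTop := v\<rparr>))"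
  (* mOp.next.cStatus = FINISHED *)
| "pop_code CPop4i l = read_mop l (vPOp l) m_next (\<lambda>v. (CMultiPop CPop4j, l\<lparr>tM := v\<rparr>))"
| "pop_code CPop4j l = write_mop l (tM l) (\<lambda>r. r\<lparr>m_cStatus := FINISHED\<rparr>) (CMultiPop CPop4k, l)"
  (* mOp.next = mOp.next.next *)
| "pop_code CPop4k l = read_mop l (vPOp l) m_next (\<lambda>v. (CMultiPop CPop4l, l\<lparr>tM := v\<rparr>))"
| "pop_code CPop4l l = read_mop l (tM l) m_next (\<lambda>v. (CMultiPop CPop4m, l\<lparr>tM := v\<rparr>))"
| "pop_code CPop4m l = write_mop l (vPOp l) (\<lambda>r. r\<lparr>m_next := tM l\<rparr>) (CMultiPop CPop4d, l)"

fun push_code :: "push_pc \<Rightarrow> 'd locals \<Rightarrow> 'd action" where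
  (* top = CentralStack *)
  "push_code CPush1 l = load centralStack (\<lambda>v. (CMultiPush CPush2a, l\<lparr>vTop := v\<rparr>))"
  (* mOp.last.cell.next = top *)
| "push_code CPush2a l = read_mop l (vMOp l) m_last (\<lambda>v. (CMultiPush CPush2b, l\<lparr>tM := v\<rparr>))"
| "push_code CPush2b l = read_mop l (tM l) m_cell (\<lambda>v. (CMultiPush CPush2c, l\<lparr>tC := v\<rparr>))"
| "push_code CPush2c l = write_cell l (tC l) (\<lambda>r. r\<lparr>c_next := vTop l\<rparr>) (CMultiPush CPush3a, l)"
  (* if CAS(&CentralStack, top, mOp.cell) *)
| "push_code CPush3a l = read_mop l (vMOp l) m_cell (\<lambda>v. (CMultiPush CPush3b, l\<lparr>tC := v\<rparr>))"
| "push_code CPush3b l = cas centralStack put_central (vTop l) (tC l)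
     (\<lambda>b. if b then (CMultiPush CPush4a, l) else (Collide Col1a, l))"
  (* while (mOp.next \<noteq> null) { mOp.next.cStatus = FINISHED; mOp.next = mOp.next.next } *)
| "push_code CPush4a l = read_mop l (vMOp l) m_next
     (\<lambda>v. if v = None then op_return l else (CMultiPush CPush4b, l))"
| "push_code CPush4b l = read_mop l (vMOp l) m_next (\<lambda>v. (CMultiPush CPush4c, l\<lparr>tM := v\<rparr>))"
| "push_code CPush4c l = write_mop l (tM l) (\<lambda>r. r\<lparr>m_cStatus := FINISHED\<rparr>) (CMultiPush CPush4d, l)"
| "push_code CPush4d l = read_mop l (vMOp l) m_next (\<lambda>v. (CMultiPush CPush4e, l\<lparr>tM := v\<rparr>))"
| "push_code CPush4e l = read_mop l (tM l) m_next (\<lambda>v. (CMultiPush CPush4f, l\<lparr>tM := v\<rparr>))"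
| "push_code CPush4f l = write_mop l (vMOp l) (\<lambda>r. r\<lparr>m_next := tM l\<rparr>) (CMultiPush CPush4a, l)"

definition call_active :: "'d locals \<Rightarrow> 'd control" where
  "call_active l = (ActiveCollide Act1a, l\<lparr>vAInf := vMOp l, vPInf := vOInfo l\<rparr>)"

definition call_passive :: "'d locals \<Rightarrow> 'd control" where
  "call_passive l = (PassiveCollide Pas1a, l\<lparr>vPInf := vMOp l\<rparr>)"

fun collide_code :: "nat \<Rightarrow> nat \<Rightarrow> collide_pc \<Rightarrow> 'd locals \<Rightarrow> 'd action" where
  (* location[id] = mOp; index = randomIndex(), an arbitrary index *)
  "collide_code N t Col1a l = store (put_location t) (vMOp l) (Collide Col1b, l)"
| "collide_code N t Col1b l = pick {1..N} (\<lambda>i. (Collide Col2a, l\<lparr>vIndex := i\<rparr>))"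
  (* him = collision[index]; while CAS(&collision[index], him, id) == false: him = collision[index] *)
| "collide_code N t Col2a l = load (\<lambda>m. collision m (vIndex l)) (\<lambda>v. (Collide Col2b, l\<lparr>vHim := v\<rparr>))"
| "collide_code N t Col2b l =
     cas (\<lambda>m. collision m (vIndex l)) (put_collision (vIndex l)) (vHim l) (Some t)
     (\<lambda>b. (Collide (if \<not> b then Col2a else if vHim l \<noteq> None then Col3a else Col4a), l))"
  (* oInfo = location[him]; if (oInfo \<noteq> null and oInfo.id \<noteq> id and oInfo.id == him) *)
| "collide_code N t Col3a l = load (\<lambda>m. location m (the (vHim l)))
     (\<lambda>v. (Collide (if v \<noteq> None then Col3b else Col4a), l\<lparr>vOInfo := v\<rparr>))"
| "collide_code N t Col3b l = read_mop l (vOInfo l) m_id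
     (\<lambda>i. (Collide (if i \<noteq> t then Col3c else Col4a), l))"
| "collide_code N t Col3c l = read_mop l (vOInfo l) m_id
     (\<lambda>i. (Collide (if vHim l = Some i then Col3d else Col4a), l))"
  (* if CAS(&location[id], mOp, null) == true *)
| "collide_code N t Col3d l = cas (\<lambda>m. location m t) (put_location t) (vMOp l) None
     (\<lambda>b. if b then call_active l else call_passive l)"
  (* wait(): an arbitrary finite number of steps without effect *)
| "collide_code N t Col4a l = pick UNIV (\<lambda>n. (Collide Col4b, l\<lparr>vDelay := n\<rparr>))"
| "collide_code N t Col4b l = pick {()} (\<lambda>_.
     if vDelay l = 0 then (Collide Col4c, l) else (Collide Col4b, l\<lparr>vDelay := vDelay l - 1\<rparr>))"
  (* if CAS(&location[id], mOp, null) == false, return passiveCollide(mOp); return false *)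
| "collide_code N t Col4c l = cas (\<lambda>m. location m t) (put_location t) (vMOp l) None
     (\<lambda>b. if b then collide_return False l else call_passive l)"

fun active_code :: "active_pc \<Rightarrow> 'd locals \<Rightarrow> 'd action" where
  (* if CAS(&location[pInf.id], pInf, aInf) *)
  "active_code Act1a l = read_mop l (vPInf l) m_id (\<lambda>i. (ActiveCollide Act1b, l\<lparr>tId := i\<rparr>))"
| "active_code Act1b l = cas (\<lambda>m. location m (tId l)) (put_location (tId l)) (vPInf l) (vAInf l)
     (\<lambda>b. if b then (ActiveCollide Act2a, l) else collide_return False l)"
  (* if aInf.op == pInf.op: combine(aInf, pInf); else multiEliminate(aInf, pInf) *)
| "active_code Act2a l = read_mop l (vAInf l) m_op (\<lambda>k. (ActiveCollide Act2b, l\<lparr>tOp := k\<rparr>))"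
| "active_code Act2b l = read_mop l (vPInf l) m_op
     (\<lambda>k. if tOp l = k then (Combine Com1a, l)
          else (MultiEliminate Eli1a, l\<lparr>vACurr := vAInf l, vPCurr := vPInf l\<rparr>))"

fun passive_code :: "passive_pc \<Rightarrow> 'd locals \<Rightarrow> 'd action" where
  (* aInf = location[pInf.id]; location[pInf.id] = null *)
  "passive_code Pas1a l = read_mop l (vPInf l) m_id (\<lambda>i. (PassiveCollide Pas1b, l\<lparr>tId := i\<rparr>))"
| "passive_code Pas1b l = load (\<lambda>m. location m (tId l)) (\<lambda>v. (PassiveCollide Pas2a, l\<lparr>vAInf := v\<rparr>))"
| "passive_code Pas2a l = read_mop l (vPInf l) m_id (\<lambda>i. (PassiveCollide Pas2b, l\<lparr>tId := i\<rparr>))"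
| "passive_code Pas2b l = store (put_location (tId l)) None (PassiveCollide Pas3a, l)"
  (* if pInf.op \<noteq> aInf.op *)
| "passive_code Pas3a l = read_mop l (vPInf l) m_op (\<lambda>k. (PassiveCollide Pas3b, l\<lparr>tOp := k\<rparr>))"
| "passive_code Pas3b l = read_mop l (vAInf l) m_op
     (\<lambda>k. (PassiveCollide (if tOp l \<noteq> k then Pas4a else Pas5), l))"
  (* if pInf.op == POP then pInf.cell = aInf.cell; return true *)
| "passive_code Pas4a l = read_mop l (vPInf l) m_op
     (\<lambda>k. if k = POP then (PassiveCollide Pas4b, l) else collide_return True l)"
| "passive_code Pas4b l = read_mop l (vAInf l) m_cell (\<lambda>v. (PassiveCollide Pas4c, l\<lparr>tC := v\<rparr>))"
| "passive_code Pas4c l = write_mop l (vPInf l) (\<lambda>r. r\<lparr>m_cell := tC l\<rparr>) (collide_return True l)"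
  (* await(pInf.cStatus \<noteq> INIT) *)
| "passive_code Pas5 l = read_mop l (vPInf l) m_cStatus
     (\<lambda>s. (PassiveCollide (if s \<noteq> INIT then Pas6a else Pas5), l))"
  (* if pInf.cStatus == FINISHED return true; else pInf.cStatus = INIT; return false *)
| "passive_code Pas6a l = read_mop l (vPInf l) m_cStatus
     (\<lambda>s. if s = FINISHED then collide_return True l else (PassiveCollide Pas6b, l))"
| "passive_code Pas6b l = write_mop l (vPInf l) (\<lambda>r. r\<lparr>m_cStatus := INIT\<rparr>) (collide_return False l)"

fun combine_code :: "combine_pc \<Rightarrow> 'd locals \<Rightarrow> 'd action" where
  (* if aInf.op == PUSH: aInf.last.cell.next = pInf.cell *)
  "combine_code Com1a l = read_mop l (vAInf l) m_op
     (\<lambda>k. (Combine (if k = PUSH then Com1b else Com2a), l))"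
| "combine_code Com1b l = read_mop l (vAInf l) m_last (\<lambda>v. (Combine Com1c, l\<lparr>tM := v\<rparr>))"
| "combine_code Com1c l = read_mop l (tM l) m_cell (\<lambda>v. (Combine Com1d, l\<lparr>tC := v\<rparr>))"
| "combine_code Com1d l = read_mop l (vPInf l) m_cell (\<lambda>v. (Combine Com1e, l\<lparr>tC' := v\<rparr>))"
| "combine_code Com1e l = write_cell l (tC l) (\<lambda>r. r\<lparr>c_next := tC' l\<rparr>) (Combine Com2a, l)"
  (* aInf.last.next = pInf *)
| "combine_code Com2a l = read_mop l (vAInf l) m_last (\<lambda>v. (Combine Com2b, l\<lparr>tM := v\<rparr>))"
| "combine_code Com2b l = write_mop l (tM l) (\<lambda>r. r\<lparr>m_next := vPInf l\<rparr>) (Combine Com3a, l)"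
  (* aInf.last = pInf.last *)
| "combine_code Com3a l = read_mop l (vPInf l) m_last (\<lambda>v. (Combine Com3b, l\<lparr>tM := v\<rparr>))"
| "combine_code Com3b l = write_mop l (vAInf l) (\<lambda>r. r\<lparr>m_last := tM l\<rparr>) (Combine Com4a, l)"
  (* aInf.length = aInf.length + pInf.length; then activeCollide returns false *)
| "combine_code Com4a l = read_mop l (vAInf l) m_length (\<lambda>n. (Combine Com4b, l\<lparr>tLen := n\<rparr>))"
| "combine_code Com4b l = read_mop l (vPInf l) m_length (\<lambda>n. (Combine Com4c, l\<lparr>tLen := tLen l + n\<rparr>))"
| "combine_code Com4c l = write_mop l (vAInf l) (\<lambda>r. r\<lparr>m_length := tLen l\<rparr>) (collide_return False l)"

text \<open>\<open>elim_continue\<close> evaluates the condition at the end of the repeat loop of \<open>multiEliminate\<close>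
  and the two tests that follow the loop.\<close>

definition elim_continue :: "'d locals \<Rightarrow> 'd control" where
  "elim_continue l =
     (if vACurr l = None \<or> vPCurr l = None
      then if vACurr l \<noteq> None then (MultiEliminate Eli5a, l)
           else if vPCurr l \<noteq> None then (MultiEliminate Eli6a, l)
           else collide_return True l
      else (MultiEliminate Eli1a, l))"

fun elim_code :: "elim_pc \<Rightarrow> 'd locals \<Rightarrow> 'd action" where
  (* if aInf.op == POP then aCurr.cell = pCurr.cell, else pCurr.cell = aCurr.cell *)
  "elim_code Eli1a l = read_mop l (vAInf l) m_op
     (\<lambda>k. (MultiEliminate (if k = POP then Eli1b else Eli1d), l))"
| "elim_code Eli1b l = read_mop l (vPCurr l) m_cell (\<lambda>v. (MultiEliminate Eli1c, l\<lparr>tC := v\<rparr>))"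
| "elim_code Eli1c l = write_mop l (vACurr l) (\<lambda>r. r\<lparr>m_cell := tC l\<rparr>) (MultiEliminate Eli2a, l)"
| "elim_code Eli1d l = read_mop l (vACurr l) m_cell (\<lambda>v. (MultiEliminate Eli1e, l\<lparr>tC := v\<rparr>))"
| "elim_code Eli1e l = write_mop l (vPCurr l) (\<lambda>r. r\<lparr>m_cell := tC l\<rparr>) (MultiEliminate Eli2a, l)"
  (* aCurr.cStatus = FINISHED; pCurr.cStatus = FINISHED *)
| "elim_code Eli2a l = write_mop l (vACurr l) (\<lambda>r. r\<lparr>m_cStatus := FINISHED\<rparr>) (MultiEliminate Eli2b, l)"
| "elim_code Eli2b l = write_mop l (vPCurr l) (\<lambda>r. r\<lparr>m_cStatus := FINISHED\<rparr>) (MultiEliminate Eli3a, l)"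
  (* aInf.length = aInf.length - 1; pInf.length = pInf.length - 1 *)
| "elim_code Eli3a l = read_mop l (vAInf l) m_length (\<lambda>n. (MultiEliminate Eli3b, l\<lparr>tLen := n\<rparr>))"
| "elim_code Eli3b l = write_mop l (vAInf l) (\<lambda>r. r\<lparr>m_length := tLen l - 1\<rparr>) (MultiEliminate Eli3c, l)"
| "elim_code Eli3c l = read_mop l (vPInf l) m_length (\<lambda>n. (MultiEliminate Eli3d, l\<lparr>tLen := n\<rparr>))"
| "elim_code Eli3d l = write_mop l (vPInf l) (\<lambda>r. r\<lparr>m_length := tLen l - 1\<rparr>) (MultiEliminate Eli4a, l)"
  (* aCurr = aCurr.next; pCurr = pCurr.next *)
| "elim_code Eli4a l = read_mop l (vACurr l) m_next (\<lambda>v. (MultiEliminate Eli4b, l\<lparr>vACurr := v\<rparr>))"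
| "elim_code Eli4b l = read_mop l (vPCurr l) m_next (\<lambda>v. elim_continue (l\<lparr>vPCurr := v\<rparr>))"
  (* aCurr.length = aInf.length; aCurr.last = aInf.last; aCurr.cStatus = RETRY *)
| "elim_code Eli5a l = read_mop l (vAInf l) m_length (\<lambda>n. (MultiEliminate Eli5b, l\<lparr>tLen := n\<rparr>))"
| "elim_code Eli5b l = write_mop l (vACurr l) (\<lambda>r. r\<lparr>m_length := tLen l\<rparr>) (MultiEliminate Eli5c, l)"
| "elim_code Eli5c l = read_mop l (vAInf l) m_last (\<lambda>v. (MultiEliminate Eli5d, l\<lparr>tM := v\<rparr>))"
| "elim_code Eli5d l = write_mop l (vACurr l) (\<lambda>r. r\<lparr>m_last := tM l\<rparr>) (MultiEliminate Eli5e, l)"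
| "elim_code Eli5e l = write_mop l (vACurr l) (\<lambda>r. r\<lparr>m_cStatus := RETRY\<rparr>) (collide_return True l)"
  (* pCurr.length = pInf.length; pCurr.last = pInf.last; pCurr.cStatus = RETRY *)
| "elim_code Eli6a l = read_mop l (vPInf l) m_length (\<lambda>n. (MultiEliminate Eli6b, l\<lparr>tLen := n\<rparr>))"
| "elim_code Eli6b l = write_mop l (vPCurr l) (\<lambda>r. r\<lparr>m_length := tLen l\<rparr>) (MultiEliminate Eli6c, l)"
| "elim_code Eli6c l = read_mop l (vPInf l) m_last (\<lambda>v. (MultiEliminate Eli6d, l\<lparr>tM := v\<rparr>))"
| "elim_code Eli6d l = write_mop l (vPCurr l) (\<lambda>r. r\<lparr>m_last := tM l\<rparr>) (MultiEliminate Eli6e, l)"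
| "elim_code Eli6e l = write_mop l (vPCurr l) (\<lambda>r. r\<lparr>m_cStatus := RETRY\<rparr>) (collide_return True l)"

fun code_of :: "nat \<Rightarrow> nat \<Rightarrow> pc \<Rightarrow> 'd locals \<Rightarrow> 'd action" where
  "code_of N t Init l = init_multiop t l"
| "code_of N t (CMultiPop q) l = pop_code q l"
| "code_of N t (CMultiPush q) l = push_code q l"
| "code_of N t (Collide q) l = collide_code N t q l"
| "code_of N t (ActiveCollide q) l = active_code q l"
| "code_of N t (PassiveCollide q) l = passive_code q l"
| "code_of N t (Combine q) l = combine_code q l"
| "code_of N t (MultiEliminate q) l = elim_code q l"
  (* return mOp.cell.data *)
| "code_of N t PopResult1 l = read_mop l (vMOp l) m_cell (\<lambda>v. (PopResult2, l\<lparr>tC := v\<rparr>))"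
| "code_of N t PopResult2 l = read_cell l (tC l) c_data (\<lambda>d. (Ret, l\<lparr>vResp := Popped d\<rparr>))"
| "code_of N t Fault l = pick {()} (\<lambda>_. (Fault, l))"
| "code_of N t Idle l = (\<lambda>_. {})"
| "code_of N t Ret l = (\<lambda>_. {})"


section \<open>Executions\<close>

record 'd config =
  mem :: "'d mem"
  ctl :: "nat \<Rightarrow> pc"
  lcl :: "nat \<Rightarrow> 'd locals"

datatype 'd event = Invoke "'d operation" | Internal | Return "'d response"

definition initial :: "'d config \<Rightarrow> bool" where
  "initial c \<longleftrightarrow> mem c = init_mem \<and> (\<forall>t. ctl c t = Idle)"

inductive step :: "nat \<Rightarrow> nat \<Rightarrow> 'd event \<Rightarrow> 'd config \<Rightarrow> 'd config \<Rightarrow> bool" for N t where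
  invoke: "ctl c t = Idle \<Longrightarrow>
    step N t (Invoke x) c
      (c\<lparr>ctl := (ctl c)(t := Init), lcl := (lcl c)(t := (lcl c t)\<lparr>invoked := x\<rparr>)\<rparr>)"
| internal: "((q, l), m) \<in> code_of N t (ctl c t) (lcl c t) (mem c) \<Longrightarrow>
    step N t Internal c
      (c\<lparr>mem := m, ctl := (ctl c)(t := q), lcl := (lcl c)(t := l)\<rparr>)"
| return: "ctl c t = Ret \<Longrightarrow>
    step N t (Return (vResp (lcl c t))) c (c\<lparr>ctl := (ctl c)(t := Idle)\<rparr>)"

text \<open>An execution is given by its configurations \<open>c\<close> and its events \<open>e\<close>. At an index where \<open>e\<close> is
  \<^term>\<open>None\<close> no thread takes a step, so that finite executions are included.\<close>

definition execution :: "nat \<Rightarrow> (nat \<Rightarrow> 'd config) \<Rightarrow> (nat \<Rightarrow> (nat \<times> 'd event) option) \<Rightarrow> bool" where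
  "execution N c e \<longleftrightarrow> initial (c 0) \<and>
     (\<forall>j. case e j of None \<Rightarrow> c (Suc j) = c j
          | Some (t, a) \<Rightarrow> t \<in> {1..N} \<and> step N t a (c j) (c (Suc j)))"

definition pending :: "'d config \<Rightarrow> nat \<Rightarrow> bool" where
  "pending c t \<longleftrightarrow> ctl c t \<noteq> Idle"

definition completes :: "(nat \<Rightarrow> (nat \<times> 'd event) option) \<Rightarrow> nat \<Rightarrow> nat \<Rightarrow> bool" where
  "completes e j t \<longleftrightarrow> (\<exists>r. e j = Some (t, Return r))"

definition keeps_scheduling ::
  "nat \<Rightarrow> (nat \<Rightarrow> 'd config) \<Rightarrow> (nat \<Rightarrow> (nat \<times> 'd event) option) \<Rightarrow> bool" where
  "keeps_scheduling N c e \<longleftrightarrow>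
     (\<forall>t \<in> {1..N}. \<forall>i. pending (c i) t \<longrightarrow>
        (\<exists>j\<ge>i. completes e j t) \<or> infinite {j. \<exists>a. e j = Some (t, a)})"

end

theory Submission
  imports Defs
begin

text \<open>
  Safety part. Every thread that is not waiting leads a finite null-terminated list of multiOps: its
  own record followed by the records of the threads it has combined with. A thread that captures a
  passive partner takes over the list of the partner. Each record that is still to be served is
  owned by exactly one thread and belongs to a thread that waits with status INIT; conversely the
  record of every thread that waits with status INIT is on the list of its owner. This excludes
  null dereferences, and it makes the loops that serve a list run on a finite list that no other
  thread changes.

  Liveness part. Suppose that no operation returns from some time on. A thread that has succeeded in
  a CAS on the central stack, or eliminates, needs only finitely many more steps to return, so there
  is no such thread. Hence the central stack is constant, no status becomes FINISHED or RETRY, and a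
  thread that reads the top afresh would succeed in its next CAS. The position of every thread
  relative to that CAS therefore moves in one direction only and is eventually constant. From then
  on no CAS on the collision array succeeds, and every thread ends up spinning in the await of
  \<open>passiveCollide\<close>. But the record of a spinning thread is on the list of a thread that does
  not spin.
\<close>

section \<open>The invariant\<close>

text \<open>The obstacle is that a passive thread learns late what has happened to it: between the
  CAS that replaces its entry of \<open>location\<close> and its own next look at that entry, it
  runs the code of \<open>collide\<close> although its list already belongs to another thread. Nor
  does a record say who serves it. Hence ownership is a ghost function, chosen anew at every step,
  and whether a thread waits is read off the shared memory and not off its program point alone.
  Ownership changes in three atomic steps only: the creation of a record, the successful CAS of
  \<open>activeCollide\<close>, and the store of RETRY, which hands the rest of a list to the thread
  of its first record. All other steps work on lists owned by the executing thread, so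
  non-interference is proved once. A served record leaves its ghost list at the store of FINISHED,
  since its thread may return from then on.

  For liveness, the rank is compared only while the stage is constant, because it looks at the
  collision array, which is frozen only then. The constants in the measures are arbitrary apart from
  the comparisons that they have to satisfy.\<close>

abbreviation next_of :: "'d mem \<Rightarrow> mref \<Rightarrow> mref option" where "next_of m x \<equiv> m_next (the (mops m x))"
abbreviation last_of :: "'d mem \<Rightarrow> mref \<Rightarrow> mref option" where "last_of m x \<equiv> m_last (the (mops m x))"
abbreviation status_of :: "'d mem \<Rightarrow> mref \<Rightarrow> status" where "status_of m x \<equiv> m_cStatus (the (mops m x))"
abbreviation op_of :: "'d mem \<Rightarrow> mref \<Rightarrow> kind" where "op_of m x \<equiv> m_op (the (mops m x))"
abbreviation id_of :: "'d mem \<Rightarrow> mref \<Rightarrow> nat" where "id_of m x \<equiv> m_id (the (mops m x))"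
abbreviation cell_of :: "'d mem \<Rightarrow> mref \<Rightarrow> cref option" where "cell_of m x \<equiv> m_cell (the (mops m x))"
abbreviation alive :: "'d mem \<Rightarrow> mref \<Rightarrow> bool" where "alive m x \<equiv> mops m x \<noteq> None"

text \<open>Only the \<open>next\<close> fields matter here; that the records exist is a clause of
  \<open>Inv\<close>. Since the list ends at null, \<open>path\<close> excludes a cycle.\<close>

fun path :: "'d mem \<Rightarrow> mref option \<Rightarrow> mref list \<Rightarrow> bool" where
  "path m p [] \<longleftrightarrow> p = None"
| "path m p (x # xs) \<longleftrightarrow> p = Some x \<and> path m (next_of m x) xs"

definition cell_ok :: "'d mem \<Rightarrow> cref option \<Rightarrow> bool" where
  "cell_ok m p \<longleftrightarrow> p = None \<or> cells m (the p) \<noteq> None"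

definition cell_present :: "'d mem \<Rightarrow> cref option \<Rightarrow> bool" where
  "cell_present m p \<longleftrightarrow> p \<noteq> None \<and> cells m (the p) \<noteq> None"

fun kind_of :: "'d operation \<Rightarrow> kind" where
  "kind_of Pop = POP"
| "kind_of (Push d) = PUSH"

text \<open>The conditions on the cells of records anticipate dereferences: the cell of a PUSH
  record is written through \<open>last.cell.next\<close>, and the data of the cell is read when the
  thread of a FINISHED pop record returns. The chain of cells may have any shape, because the walk
  in \<open>cMultiPop\<close> is bounded by the length of the multiOp.\<close>

definition heap_ok :: "'d mem \<Rightarrow> bool" where
  "heap_ok m \<longleftrightarrow>
     (\<forall>x. alive m x \<longrightarrow> cell_ok m (cell_of m x) \<and> (op_of m x = PUSH \<longrightarrow> cell_of m x \<noteq> None) \<and>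
        (status_of m x = FINISHED \<longrightarrow> cell_of m x \<noteq> None)) \<and>
     (\<forall>x. cells m x \<noteq> None \<longrightarrow> cell_ok m (c_next (the (cells m x)))) \<and>
     cell_ok m (centralStack m) \<and> cells m EMPTY_CELL \<noteq> None \<and>
     (\<forall>u a. location m u = Some a \<longrightarrow> alive m a)"

definition base :: "'d mem \<Rightarrow> nat \<Rightarrow> mref option \<Rightarrow> 'd operation \<Rightarrow> bool" where
  "base m u v i \<longleftrightarrow> v \<noteq> None \<and> alive m (the v) \<and> id_of m (the v) = u \<and> op_of m (the v) = kind_of i"

text \<open>Opaque, since as a rewrite rule the right-hand side loops when the leader is in the list.\<close>
definition same_op :: "'d mem \<Rightarrow> mref option \<Rightarrow> mref list \<Rightarrow> bool" where
  "same_op m v g \<longleftrightarrow> (\<forall>x \<in> set g. op_of m x = op_of m (the v))"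

definition owned :: "(mref \<Rightarrow> nat) \<Rightarrow> nat \<Rightarrow> mref \<Rightarrow> bool" where
  "owned ow u x \<longleftrightarrow> ow x = u"

text \<open>In \<open>lead0\<close> the \<open>last\<close> pointer may lag behind, as it does inside \<open>combine\<close>.\<close>
definition lead0 :: "'d mem \<Rightarrow> nat \<Rightarrow> (mref \<Rightarrow> nat) \<Rightarrow> mref option \<Rightarrow> mref list \<Rightarrow> bool" where
  "lead0 m u ow v g \<longleftrightarrow> owned ow u (the v) \<and> status_of m (the v) = INIT \<and> path m v g \<and> g \<noteq> [] \<and>
     same_op m v g"

definition lead :: "'d mem \<Rightarrow> nat \<Rightarrow> (mref \<Rightarrow> nat) \<Rightarrow> mref option \<Rightarrow> mref list \<Rightarrow> bool" where
  "lead m u ow v g \<longleftrightarrow> lead0 m u ow v g \<and> last_of m (the v) = Some (last g)"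

text \<open>Weaker than \<open>lead\<close>: the loops behind the successful CAS unlink served
  records without updating \<open>last\<close>, which may then point outside the list.\<close>

definition serve :: "'d mem \<Rightarrow> nat \<Rightarrow> (mref \<Rightarrow> nat) \<Rightarrow> mref option \<Rightarrow> mref list \<Rightarrow> bool" where
  "serve m u ow v g \<longleftrightarrow> owned ow u (the v) \<and> path m v g \<and> g \<noteq> [] \<and> same_op m v g"

text \<open>The second record has been served and left the list, but \<open>mOp.next\<close> still points to it.\<close>
definition unlink :: "'d mem \<Rightarrow> nat \<Rightarrow> (mref \<Rightarrow> nat) \<Rightarrow> mref option \<Rightarrow> mref list \<Rightarrow> bool" where
  "unlink m u ow v g \<longleftrightarrow> owned ow u (the v) \<and> g \<noteq> [] \<and> hd g = the v \<and> same_op m v g \<and>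
     (\<exists>y. next_of m (the v) = Some y \<and> alive m y \<and> owned ow u y \<and> path m (next_of m y) (tl g))"

text \<open>A waiting thread owns its record exactly if it has been told to RETRY; the remainder of the list
  has then been handed over to it.\<close>
definition wait_list :: "'d mem \<Rightarrow> nat \<Rightarrow> (mref \<Rightarrow> nat) \<Rightarrow> mref option \<Rightarrow> mref list \<Rightarrow> bool" where
  "wait_list m u ow v g \<longleftrightarrow>
     (if owned ow u (the v)
      then status_of m (the v) = RETRY \<and> path m v g \<and> g \<noteq> [] \<and> last_of m (the v) = Some (last g) \<and>
        same_op m v g
      else g = [])"

text \<open>\<open>a\<close> is the record of the capturing thread. If the operations differ, the captured thread
  returns without waiting.\<close>
definition captured :: "'d mem \<Rightarrow> nat \<Rightarrow> (mref \<Rightarrow> nat) \<Rightarrow> mref option \<Rightarrow> mref option \<Rightarrow> mref list \<Rightarrow> bool" where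
  "captured m u ow v a g \<longleftrightarrow> a \<noteq> None \<and> alive m (the a) \<and> id_of m (the a) \<noteq> u \<and>
     (if op_of m (the a) = op_of m (the v) then wait_list m u ow v g else g = [])"

text \<open>Ownership of the captured records, and the threads that wait on them, are supplied by
  the clause of \<open>Inv\<close> on \<open>H\<close>.\<close>

definition grab :: "'d mem \<Rightarrow> nat \<Rightarrow> (mref \<Rightarrow> nat) \<Rightarrow> mref option \<Rightarrow> mref list \<Rightarrow> bool" where
  "grab m u ow p h \<longleftrightarrow> path m p h \<and> h \<noteq> [] \<and> last_of m (the p) = Some (last h) \<and>
     same_op m p h"

text \<open>Both lists are consumed from the front, while the original heads \<open>v\<close> and
  \<open>p\<close> remain the places where \<open>last\<close> and the length are kept. Hence the
  heads stay owned after they have left their lists, and their \<open>last\<close> pointers still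
  describe the remainders.\<close>

definition elim0 :: "'d mem \<Rightarrow> nat \<Rightarrow> (mref \<Rightarrow> nat) \<Rightarrow> mref option \<Rightarrow> mref option \<Rightarrow> mref list \<Rightarrow> mref list \<Rightarrow> bool" where
  "elim0 m u ow v p g h \<longleftrightarrow> owned ow u (the v) \<and> p \<noteq> None \<and> alive m (the p) \<and> owned ow u (the p) \<and>
     op_of m (the p) \<noteq> op_of m (the v) \<and>
     same_op m v g \<and> same_op m p h \<and>
     (g \<noteq> [] \<longrightarrow> last_of m (the v) = Some (last g)) \<and> (h \<noteq> [] \<longrightarrow> last_of m (the p) = Some (last h))"

text \<open>The pointer \<open>c\<close> is at a record that has been served; \<open>g\<close> is the list behind it.\<close>
definition beyond :: "'d mem \<Rightarrow> nat \<Rightarrow> (mref \<Rightarrow> nat) \<Rightarrow> mref option \<Rightarrow> mref list \<Rightarrow> bool" where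
  "beyond m u ow c g \<longleftrightarrow> c \<noteq> None \<and> alive m (the c) \<and> owned ow u (the c) \<and> path m (next_of m (the c)) g"

definition has_cell :: "'d mem \<Rightarrow> mref option \<Rightarrow> bool" where
  "has_cell m v \<longleftrightarrow> cell_of m (the v) \<noteq> None"

text \<open>With an empty stack, \<open>g\<close> starts at the cursor \<open>vPOp\<close> and may
  have lost the own record; after a successful CAS, \<open>g\<close> keeps the own record in front
  and shrinks behind it. The disjunction at \<open>CPop2a\<close> covers the first iteration, in
  which the own record may have no cell yet.\<close>

fun pop_inv where
  "pop_inv m u CPop1 l ow g \<longleftrightarrow> vPOp l = vMOp l \<and> lead m u ow (vMOp l) g"
| "pop_inv m u CPop3a l ow g \<longleftrightarrow> vPOp l = vMOp l \<and> lead m u ow (vMOp l) g \<and> cell_present m (vTop l)"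
| "pop_inv m u CPop3b l ow g \<longleftrightarrow> vPOp l = vMOp l \<and> lead m u ow (vMOp l) g \<and> cell_present m (vTop l) \<and> cell_present m (vNTop l)"
| "pop_inv m u CPop3c l ow g \<longleftrightarrow> vPOp l = vMOp l \<and> lead m u ow (vMOp l) g \<and> cell_present m (vTop l) \<and> cell_present m (vNTop l)"
| "pop_inv m u CPop4a l ow g \<longleftrightarrow> vPOp l = vMOp l \<and> lead m u ow (vMOp l) g \<and> cell_present m (vTop l) \<and> cell_ok m (vNTop l)"
| "pop_inv m u CPop2a l ow g \<longleftrightarrow> path m (vPOp l) g \<and> g \<noteq> [] \<and> (vPOp l = vMOp l \<or> has_cell m (vMOp l))"
| "pop_inv m u CPop2b l ow g \<longleftrightarrow> path m (vPOp l) g \<and> g \<noteq> [] \<and> has_cell m (vMOp l) \<and> has_cell m (vPOp l)"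
| "pop_inv m u CPop2c l ow g \<longleftrightarrow> beyond m u ow (vPOp l) g \<and> has_cell m (vMOp l)"
| "pop_inv m u CPop4b l ow g \<longleftrightarrow> vPOp l = vMOp l \<and> serve m u ow (vMOp l) g \<and> cell_present m (vTop l)"
| "pop_inv m u CPop4c l ow g \<longleftrightarrow> vPOp l = vMOp l \<and> serve m u ow (vMOp l) g \<and> cell_present m (vTop l) \<and> has_cell m (vMOp l)"
| "pop_inv m u CPop4d l ow g \<longleftrightarrow> vPOp l = vMOp l \<and> serve m u ow (vMOp l) g \<and> cell_ok m (vTop l) \<and> has_cell m (vMOp l)"
| "pop_inv m u CPop4e l ow g \<longleftrightarrow> vPOp l = vMOp l \<and> serve m u ow (vMOp l) g \<and> cell_ok m (vTop l) \<and> has_cell m (vMOp l) \<and> tl g \<noteq> []"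
| "pop_inv m u CPop4f l ow g \<longleftrightarrow> vPOp l = vMOp l \<and> serve m u ow (vMOp l) g \<and> cell_ok m (vTop l) \<and> has_cell m (vMOp l) \<and> tl g \<noteq> [] \<and>
    tM l = Some (hd (tl g))"
| "pop_inv m u CPop4g l ow g \<longleftrightarrow> vPOp l = vMOp l \<and> serve m u ow (vMOp l) g \<and> cell_present m (vTop l) \<and> has_cell m (vMOp l) \<and> tl g \<noteq> [] \<and>
    tM l = Some (hd (tl g))"
| "pop_inv m u CPop4h l ow g \<longleftrightarrow> vPOp l = vMOp l \<and> serve m u ow (vMOp l) g \<and> cell_present m (vTop l) \<and> has_cell m (vMOp l) \<and> tl g \<noteq> [] \<and>
    has_cell m (Some (hd (tl g)))"
| "pop_inv m u CPop4i l ow g \<longleftrightarrow> vPOp l = vMOp l \<and> serve m u ow (vMOp l) g \<and> cell_ok m (vTop l) \<and> has_cell m (vMOp l) \<and> tl g \<noteq> [] \<and>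
    has_cell m (Some (hd (tl g)))"
| "pop_inv m u CPop4j l ow g \<longleftrightarrow> vPOp l = vMOp l \<and> serve m u ow (vMOp l) g \<and> cell_ok m (vTop l) \<and> has_cell m (vMOp l) \<and> tl g \<noteq> [] \<and>
    has_cell m (Some (hd (tl g))) \<and> tM l = Some (hd (tl g))"
| "pop_inv m u CPop4k l ow g \<longleftrightarrow> vPOp l = vMOp l \<and> unlink m u ow (vMOp l) g \<and> cell_ok m (vTop l) \<and> has_cell m (vMOp l)"
| "pop_inv m u CPop4l l ow g \<longleftrightarrow> vPOp l = vMOp l \<and> unlink m u ow (vMOp l) g \<and> cell_ok m (vTop l) \<and> has_cell m (vMOp l) \<and>
    tM l = next_of m (the (vMOp l))"
| "pop_inv m u CPop4m l ow g \<longleftrightarrow> vPOp l = vMOp l \<and> unlink m u ow (vMOp l) g \<and> cell_ok m (vTop l) \<and> has_cell m (vMOp l) \<and>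
    path m (tM l) (tl g)"

fun push_inv where
  "push_inv m u CPush1 l ow g \<longleftrightarrow> lead m u ow (vMOp l) g"
| "push_inv m u CPush2a l ow g \<longleftrightarrow> lead m u ow (vMOp l) g \<and> cell_ok m (vTop l)"
| "push_inv m u CPush2b l ow g \<longleftrightarrow> lead m u ow (vMOp l) g \<and> cell_ok m (vTop l) \<and> tM l = Some (last g)"
| "push_inv m u CPush2c l ow g \<longleftrightarrow> lead m u ow (vMOp l) g \<and> cell_ok m (vTop l) \<and> cell_present m (tC l)"
| "push_inv m u CPush3a l ow g \<longleftrightarrow> lead m u ow (vMOp l) g \<and> cell_ok m (vTop l)"
| "push_inv m u CPush3b l ow g \<longleftrightarrow> lead m u ow (vMOp l) g \<and> cell_ok m (vTop l) \<and> cell_ok m (tC l)"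
| "push_inv m u CPush4a l ow g \<longleftrightarrow> serve m u ow (vMOp l) g"
| "push_inv m u CPush4b l ow g \<longleftrightarrow> serve m u ow (vMOp l) g \<and> tl g \<noteq> []"
| "push_inv m u CPush4c l ow g \<longleftrightarrow> serve m u ow (vMOp l) g \<and> tl g \<noteq> [] \<and> tM l = Some (hd (tl g))"
| "push_inv m u CPush4d l ow g \<longleftrightarrow> unlink m u ow (vMOp l) g"
| "push_inv m u CPush4e l ow g \<longleftrightarrow> unlink m u ow (vMOp l) g \<and> tM l = next_of m (the (vMOp l))"
| "push_inv m u CPush4f l ow g \<longleftrightarrow> unlink m u ow (vMOp l) g \<and> path m (tM l) (tl g)"

definition other :: "'d mem \<Rightarrow> nat \<Rightarrow> mref option \<Rightarrow> bool" where
  "other m u p \<longleftrightarrow> p \<noteq> None \<and> alive m (the p) \<and> id_of m (the p) \<noteq> u"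

definition known :: "'d mem \<Rightarrow> mref option \<Rightarrow> bool" where
  "known m p \<longleftrightarrow> p \<noteq> None \<and> alive m (the p)"

text \<open>A thread in \<open>collide\<close> cannot tell the two cases apart: either nobody has
  touched its entry and it leads its list, or it has been captured without having noticed.\<close>

definition exposed where
  "exposed m u l ow g \<longleftrightarrow> location m u = vMOp l \<and> lead m u ow (vMOp l) g \<or> captured m u ow (vMOp l) (location m u) g"

fun collide_inv where
  "collide_inv m u Col1a l ow g \<longleftrightarrow> lead m u ow (vMOp l) g \<and> location m u = None"
| "collide_inv m u Col3b l ow g \<longleftrightarrow> exposed m u l ow g \<and> known m (vOInfo l)"
| "collide_inv m u Col3c l ow g \<longleftrightarrow> exposed m u l ow g \<and> other m u (vOInfo l)"
| "collide_inv m u Col3d l ow g \<longleftrightarrow> exposed m u l ow g \<and> other m u (vOInfo l)"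
| "collide_inv m u _ l ow g \<longleftrightarrow> exposed m u l ow g"

fun active_inv where
  "active_inv m u Act1a l ow g h \<longleftrightarrow> h = [] \<and> lead m u ow (vMOp l) g \<and> vAInf l = vMOp l \<and> other m u (vPInf l)"
| "active_inv m u Act1b l ow g h \<longleftrightarrow> h = [] \<and> lead m u ow (vMOp l) g \<and> vAInf l = vMOp l \<and> other m u (vPInf l) \<and> tId l = id_of m (the (vPInf l))"
| "active_inv m u Act2a l ow g h \<longleftrightarrow> lead m u ow (vMOp l) g \<and> vAInf l = vMOp l \<and> grab m u ow (vPInf l) h"
| "active_inv m u Act2b l ow g h \<longleftrightarrow> lead m u ow (vMOp l) g \<and> vAInf l = vMOp l \<and> grab m u ow (vPInf l) h \<and> tOp l = op_of m (the (vMOp l))"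

text \<open>Up to \<open>Pas2b\<close> the capturing record stands in \<open>location\<close>;
  afterwards it is remembered only in \<open>vAInf\<close>. The disjunction at \<open>Pas6a\<close>
  keeps the outcome of the await in a form that other threads cannot undo.\<close>

fun passive_inv where
  "passive_inv m u Pas1a l ow g \<longleftrightarrow> captured m u ow (vMOp l) (location m u) g \<and> vPInf l = vMOp l"
| "passive_inv m u Pas1b l ow g \<longleftrightarrow> captured m u ow (vMOp l) (location m u) g \<and> vPInf l = vMOp l \<and> tId l = id_of m (the (vMOp l))"
| "passive_inv m u Pas2a l ow g \<longleftrightarrow> captured m u ow (vMOp l) (location m u) g \<and> vPInf l = vMOp l \<and> vAInf l = location m u"
| "passive_inv m u Pas2b l ow g \<longleftrightarrow> captured m u ow (vMOp l) (location m u) g \<and> vPInf l = vMOp l \<and> vAInf l = location m u \<and> tId l = id_of m (the (vMOp l))"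
| "passive_inv m u Pas3a l ow g \<longleftrightarrow> location m u = None \<and> captured m u ow (vMOp l) (vAInf l) g \<and> vPInf l = vMOp l"
| "passive_inv m u Pas3b l ow g \<longleftrightarrow> location m u = None \<and> captured m u ow (vMOp l) (vAInf l) g \<and> vPInf l = vMOp l \<and>
    tOp l = op_of m (the (vMOp l))"
| "passive_inv m u Pas4a l ow g \<longleftrightarrow> location m u = None \<and> g = [] \<and> vPInf l = vMOp l \<and> known m (vAInf l) \<and> op_of m (the (vAInf l)) \<noteq> op_of m (the (vMOp l))"
| "passive_inv m u Pas4b l ow g \<longleftrightarrow> location m u = None \<and> g = [] \<and> vPInf l = vMOp l \<and> known m (vAInf l) \<and> op_of m (the (vAInf l)) = PUSH"
| "passive_inv m u Pas4c l ow g \<longleftrightarrow> location m u = None \<and> g = [] \<and> vPInf l = vMOp l \<and> cell_present m (tC l)"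
| "passive_inv m u Pas5 l ow g \<longleftrightarrow> location m u = None \<and> wait_list m u ow (vMOp l) g \<and> vPInf l = vMOp l"
| "passive_inv m u Pas6a l ow g \<longleftrightarrow> location m u = None \<and> wait_list m u ow (vMOp l) g \<and> vPInf l = vMOp l \<and> (owned ow u (the (vMOp l)) \<or> status_of m (the (vMOp l)) = FINISHED)"
| "passive_inv m u Pas6b l ow g \<longleftrightarrow> location m u = None \<and> wait_list m u ow (vMOp l) g \<and> vPInf l = vMOp l \<and> owned ow u (the (vMOp l))"

definition combining where
  "combining m u l ow g h \<longleftrightarrow> lead m u ow (vMOp l) g \<and> grab m u ow (vPInf l) h \<and> op_of m (the (vPInf l)) = op_of m (the (vMOp l))"

text \<open>The list \<open>h\<close> joins \<open>g\<close> at the store of the \<open>next\<close>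
  pointer, so \<open>h\<close> is empty from \<open>Com3a\<close> on. At that point the partner's
  \<open>last\<close> is the last record of the joined list.\<close>

fun combine_inv where
  "combine_inv m u Com1a l ow g h \<longleftrightarrow> combining m u l ow g h"
| "combine_inv m u Com1b l ow g h \<longleftrightarrow> combining m u l ow g h \<and> op_of m (the (vMOp l)) = PUSH"
| "combine_inv m u Com1c l ow g h \<longleftrightarrow> combining m u l ow g h \<and> op_of m (the (vMOp l)) = PUSH \<and> tM l = Some (last g)"
| "combine_inv m u Com1d l ow g h \<longleftrightarrow> combining m u l ow g h \<and> cell_present m (tC l)"
| "combine_inv m u Com1e l ow g h \<longleftrightarrow> combining m u l ow g h \<and> cell_present m (tC l) \<and> cell_ok m (tC' l)"
| "combine_inv m u Com2a l ow g h \<longleftrightarrow> combining m u l ow g h"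
| "combine_inv m u Com2b l ow g h \<longleftrightarrow> combining m u l ow g h \<and> tM l = Some (last g)"
| "combine_inv m u Com3a l ow g h \<longleftrightarrow> h = [] \<and> lead0 m u ow (vMOp l) g \<and> known m (vPInf l) \<and> the (vPInf l) \<in> set g \<and> last_of m (the (vPInf l)) = Some (last g)"
| "combine_inv m u Com3b l ow g h \<longleftrightarrow> h = [] \<and> lead0 m u ow (vMOp l) g \<and> known m (vPInf l) \<and> tM l = Some (last g)"
| "combine_inv m u Com4a l ow g h \<longleftrightarrow> h = [] \<and> lead m u ow (vMOp l) g \<and> known m (vPInf l)"
| "combine_inv m u Com4b l ow g h \<longleftrightarrow> h = [] \<and> lead m u ow (vMOp l) g \<and> known m (vPInf l)"
| "combine_inv m u Com4c l ow g h \<longleftrightarrow> h = [] \<and> lead m u ow (vMOp l) g"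

text \<open>Once served, the two heads stay outside the remainders. So a remainder consists of
  records of waiting threads only, and the later store into \<open>last\<close> of its first record
  does not hit \<open>vMOp\<close> or \<open>vPInf\<close>.\<close>

definition matching where
  "matching m u l ow g h \<longleftrightarrow> elim0 m u ow (vMOp l) (vPInf l) g h \<and> path m (vACurr l) g \<and> g \<noteq> [] \<and> path m (vPCurr l) h \<and> h \<noteq> [] \<and>
     the (vMOp l) \<notin> set (tl g) \<and> the (vPInf l) \<notin> set (tl h) \<and> (hd g = the (vMOp l) \<or> has_cell m (vMOp l))"

definition matched where
  "matched m u l ow g h \<longleftrightarrow> elim0 m u ow (vMOp l) (vPInf l) g h \<and>
     the (vMOp l) \<notin> set g \<and> the (vPInf l) \<notin> set h \<and> has_cell m (vMOp l)"

definition retry_act where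
  "retry_act m u l ow g h \<longleftrightarrow> matched m u l ow g h \<and> path m (vACurr l) g \<and> g \<noteq> [] \<and> h = []"

definition retry_pas where
  "retry_pas m u l ow g h \<longleftrightarrow> matched m u l ow g h \<and> path m (vPCurr l) h \<and> h \<noteq> [] \<and> g = []"

fun elim_inv where
  "elim_inv m u Eli1a l ow g h \<longleftrightarrow> matching m u l ow g h"
| "elim_inv m u Eli1b l ow g h \<longleftrightarrow> matching m u l ow g h \<and> op_of m (the (vMOp l)) = POP"
| "elim_inv m u Eli1c l ow g h \<longleftrightarrow> matching m u l ow g h \<and> op_of m (the (vMOp l)) = POP \<and> cell_present m (tC l)"
| "elim_inv m u Eli1d l ow g h \<longleftrightarrow> matching m u l ow g h \<and> op_of m (the (vMOp l)) = PUSH"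
| "elim_inv m u Eli1e l ow g h \<longleftrightarrow> matching m u l ow g h \<and> op_of m (the (vMOp l)) = PUSH \<and> cell_present m (tC l)"
| "elim_inv m u Eli2a l ow g h \<longleftrightarrow> matching m u l ow g h \<and> has_cell m (Some (hd g)) \<and> has_cell m (Some (hd h)) \<and> has_cell m (vMOp l)"
| "elim_inv m u Eli2b l ow g h \<longleftrightarrow> elim0 m u ow (vMOp l) (vPInf l) g h \<and> beyond m u ow (vACurr l) g \<and> path m (vPCurr l) h \<and> h \<noteq> [] \<and>
     the (vMOp l) \<notin> set g \<and> the (vPInf l) \<notin> set (tl h) \<and> has_cell m (vMOp l) \<and> has_cell m (Some (hd h))"
| "elim_inv m u Eli4b l ow g h \<longleftrightarrow> matched m u l ow g h \<and> path m (vACurr l) g \<and> beyond m u ow (vPCurr l) h"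
| "elim_inv m u Eli5a l ow g h \<longleftrightarrow> retry_act m u l ow g h"
| "elim_inv m u Eli5b l ow g h \<longleftrightarrow> retry_act m u l ow g h"
| "elim_inv m u Eli5c l ow g h \<longleftrightarrow> retry_act m u l ow g h"
| "elim_inv m u Eli5d l ow g h \<longleftrightarrow> retry_act m u l ow g h \<and> tM l = Some (last g)"
| "elim_inv m u Eli5e l ow g h \<longleftrightarrow> retry_act m u l ow g h \<and> last_of m (hd g) = Some (last g)"
| "elim_inv m u Eli6a l ow g h \<longleftrightarrow> retry_pas m u l ow g h"
| "elim_inv m u Eli6b l ow g h \<longleftrightarrow> retry_pas m u l ow g h"
| "elim_inv m u Eli6c l ow g h \<longleftrightarrow> retry_pas m u l ow g h"
| "elim_inv m u Eli6d l ow g h \<longleftrightarrow> retry_pas m u l ow g h \<and> tM l = Some (last h)"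
| "elim_inv m u Eli6e l ow g h \<longleftrightarrow> retry_pas m u l ow g h \<and> last_of m (hd h) = Some (last h)"
| "elim_inv m u _ l ow g h \<longleftrightarrow> matched m u l ow g h \<and> beyond m u ow (vACurr l) g \<and> beyond m u ow (vPCurr l) h"

fun local_inv :: "'d mem \<Rightarrow> nat \<Rightarrow> pc \<Rightarrow> 'd locals \<Rightarrow> (mref \<Rightarrow> nat) \<Rightarrow> mref list \<Rightarrow> mref list \<Rightarrow> bool" where
  "local_inv m u Idle l ow g h \<longleftrightarrow> g = [] \<and> h = [] \<and> location m u = None"
| "local_inv m u Init l ow g h \<longleftrightarrow> g = [] \<and> h = [] \<and> location m u = None"
| "local_inv m u Ret l ow g h \<longleftrightarrow> g = [] \<and> h = [] \<and> location m u = None"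
| "local_inv m u Fault l ow g h \<longleftrightarrow> False"
| "local_inv m u PopResult1 l ow g h \<longleftrightarrow> g = [] \<and> h = [] \<and> location m u = None \<and> base m u (vMOp l) (invoked l) \<and> has_cell m (vMOp l)"
| "local_inv m u PopResult2 l ow g h \<longleftrightarrow> g = [] \<and> h = [] \<and> location m u = None \<and> cell_present m (tC l)"
| "local_inv m u (CMultiPop q) l ow g h \<longleftrightarrow> base m u (vMOp l) (invoked l) \<and> location m u = None \<and> h = [] \<and> invoked l = Pop \<and> pop_inv m u q l ow g"
| "local_inv m u (CMultiPush q) l ow g h \<longleftrightarrow> base m u (vMOp l) (invoked l) \<and> location m u = None \<and> h = [] \<and> invoked l \<noteq> Pop \<and> push_inv m u q l ow g"
| "local_inv m u (Collide q) l ow g h \<longleftrightarrow> base m u (vMOp l) (invoked l) \<and> h = [] \<and> collide_inv m u q l ow g"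
| "local_inv m u (ActiveCollide q) l ow g h \<longleftrightarrow> base m u (vMOp l) (invoked l) \<and> location m u = None \<and> active_inv m u q l ow g h"
| "local_inv m u (PassiveCollide q) l ow g h \<longleftrightarrow> base m u (vMOp l) (invoked l) \<and> h = [] \<and> passive_inv m u q l ow g"
| "local_inv m u (Combine q) l ow g h \<longleftrightarrow> base m u (vMOp l) (invoked l) \<and> location m u = None \<and> vAInf l = vMOp l \<and> combine_inv m u q l ow g h"
| "local_inv m u (MultiEliminate q) l ow g h \<longleftrightarrow> base m u (vMOp l) (invoked l) \<and> location m u = None \<and> vAInf l = vMOp l \<and> elim_inv m u q l ow g h"

section \<open>Waiting threads and the global invariant\<close>

definition partner :: "'d mem \<Rightarrow> mref option \<Rightarrow> mref option \<Rightarrow> bool" where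
  "partner m a v \<longleftrightarrow> a \<noteq> None \<and> a \<noteq> v \<and> op_of m (the a) = op_of m (the v)"

text \<open>A thread counts as waiting from the moment of its capture, even while it is still in
  \<open>collide\<close>; otherwise its record would be listed by the capturing thread without a
  waiter for a while. A thread captured by the opposite operation does not wait.\<close>

fun waiting :: "'d mem \<Rightarrow> nat \<Rightarrow> pc \<Rightarrow> 'd locals \<Rightarrow> bool" where
  "waiting m u (Collide q) l \<longleftrightarrow> q \<noteq> Col1a \<and> partner m (location m u) (vMOp l)"
| "waiting m u (PassiveCollide q) l \<longleftrightarrow>
     (if q \<in> {Pas1a, Pas1b} then partner m (location m u) (vMOp l)
      else if q \<in> {Pas2a, Pas2b, Pas3a, Pas3b} then partner m (vAInf l) (vMOp l)
      else q \<in> {Pas5, Pas6a, Pas6b})"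
| "waiting m u _ l \<longleftrightarrow> False"

text \<open>The records on the lists of a thread that do not belong to waiting threads: its own record, and
  that of a partner with the opposite operation.\<close>
definition exempt :: "'d mem \<Rightarrow> 'd locals \<Rightarrow> mref \<Rightarrow> bool" where
  "exempt m l x \<longleftrightarrow> vMOp l = Some x \<or> vPInf l = Some x \<and> op_of m x \<noteq> op_of m (the (vMOp l))"

definition waiter :: "'d config \<Rightarrow> mref \<Rightarrow> bool" where
  "waiter c x \<longleftrightarrow> status_of (mem c) x = INIT \<and> vMOp (lcl c (id_of (mem c) x)) = Some x \<and>
     waiting (mem c) (id_of (mem c) x) (ctl c (id_of (mem c) x)) (lcl c (id_of (mem c) x))"

text \<open>Ghost state: \<open>ow x\<close> is the thread that may change the links and the status of the record \<open>x\<close>;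
  \<open>G t\<close> is the list that \<open>t\<close> leads, with its own record in front, and \<open>H t\<close> the list captured from a
  passive partner; both without the records that have already been served.\<close>
definition Inv :: "'d config \<Rightarrow> (mref \<Rightarrow> nat) \<Rightarrow> (nat \<Rightarrow> mref list) \<Rightarrow> (nat \<Rightarrow> mref list) \<Rightarrow> bool" where
  "Inv c ow G H \<longleftrightarrow> heap_ok (mem c) \<and>
     (\<forall>u. local_inv (mem c) u (ctl c u) (lcl c u) ow (G u) (H u)) \<and>
     (\<forall>u. distinct (G u @ H u)) \<and>
     (\<forall>u. \<forall>x \<in> set (G u) \<union> set (H u). alive (mem c) x \<and> ow x = u \<and> (exempt (mem c) (lcl c u) x \<or> waiter c x)) \<and>
     (\<forall>p x. waiting (mem c) p (ctl c p) (lcl c p) \<and> vMOp (lcl c p) = Some x \<and> ow x \<noteq> p \<longrightarrow>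
        status_of (mem c) x = FINISHED \<or> status_of (mem c) x = INIT \<and> x \<in> set (G (ow x)) \<union> set (H (ow x)))"

section \<open>Non-interference\<close>

definition frame :: "'d mem \<Rightarrow> 'd mem \<Rightarrow> (mref \<Rightarrow> nat) \<Rightarrow> (mref \<Rightarrow> nat) \<Rightarrow> nat \<Rightarrow> bool" where
  "frame m m' ow ow' u \<longleftrightarrow>
     (\<forall>x. alive m x \<longrightarrow> alive m' x \<and> id_of m' x = id_of m x \<and> op_of m' x = op_of m x \<and>
        (cell_of m x \<noteq> None \<longrightarrow> cell_of m' x \<noteq> None) \<and> (status_of m x = FINISHED \<longrightarrow> status_of m' x = FINISHED) \<and>
        (ow' x = u \<longleftrightarrow> ow x = u) \<and>
        (ow x = u \<longrightarrow> next_of m' x = next_of m x \<and> last_of m' x = last_of m x \<and> status_of m' x = status_of m x)) \<and>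
     (\<forall>x. cells m x \<noteq> None \<longrightarrow> cells m' x \<noteq> None) \<and>
     location m' u = location m u"

lemma path_cong: "(\<And>x. x \<in> set xs \<Longrightarrow> next_of m' x = next_of m x) \<Longrightarrow> path m' p xs = path m p xs"
  by (induction xs arbitrary: p) auto

lemma path_frame:
  "frame m m' ow ow' u \<Longrightarrow> (\<forall>x \<in> set g. alive m x \<and> ow x = u) \<Longrightarrow> path m' p g = path m p g"
  by (rule path_cong) (auto simp: frame_def)

text \<open>\<open>frame\<close> is the rely condition of thread \<open>u\<close>: allocation, id
  and operation are permanent, having a cell and being FINISHED are never revoked, and what
  \<open>u\<close> owns keeps its owner, links and status. Each assertion in
  \<open>local_inv\<close> is built from such facts about the own record, the listed records and the
  pointers in local variables. Lengths occur in no assertion, so the frame is silent about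
  them.\<close>

lemma local_inv_frame:
  assumes F: "frame m m' ow ow' u" and O: "\<forall>x \<in> set g. alive m x \<and> ow x = u" "\<forall>x \<in> set h. alive m x \<and> ow x = u"
    and L: "local_inv m u q l ow g h"
  shows "local_inv m' u q l ow' g h"
proof -
  note P = path_frame[OF F O(1)] path_frame[OF F O(2)]
  have P3: "path m' p (tl g) = path m p (tl g)" for p
    by (rule path_frame[OF F]) (use O(1) in \<open>metis list.sel(2) list.set_sel(2)\<close>)
  have loc: "location m' u = location m u" using F by (simp add: frame_def)
  note F1 = F[unfolded frame_def, THEN conjunct1, rule_format]
  have al: "alive m' x" "id_of m' x = id_of m x" "op_of m' x = op_of m x"
      "cell_of m x \<noteq> None \<Longrightarrow> cell_of m' x \<noteq> None" "status_of m x = FINISHED \<Longrightarrow> status_of m' x = FINISHED"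
      "ow' x = u \<longleftrightarrow> ow x = u" if "alive m x" for x
    using F1[OF that] by (safe; simp)+
  have own: "next_of m' x = next_of m x" "last_of m' x = last_of m x" "status_of m' x = status_of m x" if "alive m x" "ow x = u" for x
    using F1[OF that(1)] that(2) by simp_all
  have F2: "cells m x \<noteq> None \<Longrightarrow> cells m' x \<noteq> None" for x
    using F unfolding frame_def by simp
  have ceq: "cell_ok m p \<Longrightarrow> cell_ok m' p" "cell_present m p \<Longrightarrow> cell_present m' p" for p
    unfolding cell_ok_def cell_present_def using F2 by blast+
  have bs: "base m u v i \<Longrightarrow> base m' u v i" for v i
    unfolding base_def using al(1-3)[of "the v"] by presburger
  have opg: "\<forall>x\<in>set g. op_of m' x = op_of m x" "\<forall>x\<in>set h. op_of m' x = op_of m x" using O al(3) by blast+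
  have kn: "known m p \<Longrightarrow> known m' p" "other m u p \<Longrightarrow> other m' u p" for p
    unfolding known_def other_def using al(1,2)[of "the p"] by presburger+
  have so: "same_op m' v g" if "alive m (the v)" "same_op m v g" for v
    using that opg(1) al(3) unfolding same_op_def by simp
  have so': "same_op m' v h" if "alive m (the v)" "same_op m v h" for v
    using that opg(2) al(3) unfolding same_op_def by simp
  have la: "alive m (the v) \<Longrightarrow> lead0 m u ow v g \<Longrightarrow> lead0 m' u ow' v g" 
    "alive m (the v) \<Longrightarrow> lead m u ow v g \<Longrightarrow> lead m' u ow' v g"
    "alive m (the v) \<Longrightarrow> serve m u ow v g \<Longrightarrow> serve m' u ow' v g"
    "alive m (the v) \<Longrightarrow> wait_list m u ow v g \<Longrightarrow> wait_list m' u ow' v g" for v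
    unfolding lead0_def lead_def serve_def wait_list_def P owned_def
    using al(3,6)[of "the v"] own[of "the v"] so[of v] by simp_all
  have un: "alive m (the v) \<Longrightarrow> unlink m u ow v g \<Longrightarrow> unlink m' u ow' v g" for v
    unfolding unlink_def P3 owned_def using al(1,3,6) own(1) so by metis
  have ca: "alive m (the v) \<Longrightarrow> captured m u ow v a g \<Longrightarrow> captured m' u ow' v a g" for v a
    unfolding captured_def using al(3)[of "the v"] al(1-3)[of "the a"] la(4) by simp
  have ex: "alive m (the (vMOp l)) \<Longrightarrow> exposed m u l ow g \<Longrightarrow> exposed m' u l ow' g"
    unfolding exposed_def loc using la(2) ca by blast
  have hda: "path m p g' \<Longrightarrow> g' \<noteq> [] \<Longrightarrow> the p \<in> set g'" for p g' by (cases g') auto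
  have gr: "grab m u ow p h \<Longrightarrow> grab m' u ow' p h" for p
  proof -
    assume G: "grab m u ow p h"
    then have "the p \<in> set h" unfolding grab_def using hda by blast
    with O(2) have "alive m (the p)" "last_of m' (the p) = last_of m (the p)" using own(2) by blast+
    with G so' show ?thesis unfolding grab_def P by metis
  qed
  have e0: "alive m (the v) \<Longrightarrow> elim0 m u ow v p g h \<Longrightarrow> elim0 m' u ow' v p g h" for v p
    unfolding elim0_def owned_def using al(1,3,6)[of "the v"] own(2)[of "the v"] al(1,3,6)[of "the p"] own(2)[of "the p"] so[of v] so'[of p] by simp
  have be: "beyond m u ow v g \<Longrightarrow> beyond m' u ow' v g"
    "beyond m u ow v h \<Longrightarrow> beyond m' u ow' v h" for v
    unfolding beyond_def P owned_def using al(1,6)[of "the v"] own(1)[of "the v"] by simp_all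
  have hc: "alive m (the v) \<Longrightarrow> has_cell m v \<Longrightarrow> has_cell m' v" for v
    unfolding has_cell_def using al(4) by blast
  have hg: "g' \<noteq> [] \<Longrightarrow> \<forall>x\<in>set g'. alive m x \<Longrightarrow> has_cell m (Some (hd g')) \<Longrightarrow> has_cell m' (Some (hd g'))" for g'
    using hc[of "Some (hd g')"] hd_in_set[of g'] by simp
  have hg3: "\<forall>x\<in>set (tl g). alive m x" using O(1) by (metis list.sel(2) list.set_sel(2))
  have hgs: "g \<noteq> [] \<Longrightarrow> has_cell m (Some (hd g)) \<Longrightarrow> has_cell m' (Some (hd g))"
     "h \<noteq> [] \<Longrightarrow> has_cell m (Some (hd h)) \<Longrightarrow> has_cell m' (Some (hd h))"
     "tl g \<noteq> [] \<Longrightarrow> has_cell m (Some (hd (tl g))) \<Longrightarrow> has_cell m' (Some (hd (tl g)))"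
    using O hg[of g] hg[of h] hg[of "tl g"] hg3 by blast+
  have hdo: "g \<noteq> [] \<Longrightarrow> last_of m' (hd g) = last_of m (hd g)" "h \<noteq> [] \<Longrightarrow> last_of m' (hd h) = last_of m (hd h)"
    using O own(2) hd_in_set[of g] hd_in_set[of h] by blast+
  have ba: "base m u v i \<Longrightarrow> alive m (the v)" for v i by (simp add: base_def)
  have cm: "alive m (the (vMOp l)) \<Longrightarrow> combining m u l ow g h \<Longrightarrow> combining m' u l ow' g h"
    unfolding combining_def
    using la(2)[of "vMOp l"] gr[of "vPInf l"] hda[of "vPInf l" h] al(3)[of "the (vMOp l)"] al(3)[of "the (vPInf l)"] O(2)
    unfolding grab_def by metis
  have mc: "alive m (the (vMOp l)) \<Longrightarrow> matching m u l ow g h \<Longrightarrow> matching m' u l ow' g h"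
    "alive m (the (vMOp l)) \<Longrightarrow> matched m u l ow g h \<Longrightarrow> matched m' u l ow' g h"
    unfolding matching_def matched_def P using e0 hc by blast+
  have rt: "alive m (the (vMOp l)) \<Longrightarrow> retry_act m u l ow g h \<Longrightarrow> retry_act m' u l ow' g h"
    "alive m (the (vMOp l)) \<Longrightarrow> retry_pas m u l ow g h \<Longrightarrow> retry_pas m' u l ow' g h"
    unfolding retry_act_def retry_pas_def P using mc by blast+
  have hp: "path m p g \<Longrightarrow> g \<noteq> [] \<Longrightarrow> has_cell m p \<Longrightarrow> has_cell m' p" for p
    using hda[of p g] hc[of p] O(1) by blast
  have nu: "alive m (the v) \<Longrightarrow> unlink m u ow v g \<Longrightarrow> next_of m (the v) = next_of m' (the v)" for v
    unfolding unlink_def owned_def using own(1) by metis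
  have io: "other m u p \<Longrightarrow> id_of m (the p) = id_of m' (the p)"
      "known m p \<Longrightarrow> op_of m' (the p) = op_of m (the p)" for p
    unfolding other_def known_def using al(2,3)[of "the p"] by simp_all
  have oe: "alive m x \<Longrightarrow> op_of m x = op_of m' x" "alive m x \<Longrightarrow> k = op_of m x \<Longrightarrow> k = op_of m' x"
     "alive m x \<Longrightarrow> op_of m x = k \<Longrightarrow> op_of m' x = k" for x k using al(3) by simp_all
  have fin: "alive m x \<Longrightarrow> status_of m x = FINISHED \<Longrightarrow> status_of m' x = FINISHED" "alive m x \<Longrightarrow> owned ow' u x = owned ow u x" for x
    using al(5,6) by (simp_all add: owned_def)
  have lg: "x \<in> set g \<Longrightarrow> last_of m x = v \<Longrightarrow> last_of m' x = v" for x v using O(1) own(2) by blast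
  have ne: "matching m u l ow g h \<Longrightarrow> has_cell m (Some (hd g)) \<Longrightarrow> has_cell m' (Some (hd g))"
    "matching m u l ow g h \<Longrightarrow> has_cell m (Some (hd h)) \<Longrightarrow> has_cell m' (Some (hd h))"
    "retry_act m u l ow g h \<Longrightarrow> last_of m (hd g) = v \<Longrightarrow> last_of m' (hd g) = v"
    "retry_pas m u l ow g h \<Longrightarrow> last_of m (hd h) = v \<Longrightarrow> last_of m' (hd h) = v" for v
    unfolding matching_def retry_act_def retry_pas_def using hgs hdo by metis+
  note rules = ne lg fin io oe hp nu hdo hdo[symmetric] bs la un ca gr e0 be hc hgs cm mc rt ceq kn ex
  show ?thesis
  proof (cases q)
    case (CMultiPop r)
    then show ?thesis using L
      by (cases r) (auto simp: loc P P3 intro: rules dest: ba)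
  next
    case (CMultiPush r)
    then show ?thesis using L
      by (cases r) (auto simp: loc P P3 intro: rules dest: ba)
  next
    case (Collide r)
    then show ?thesis using L
      by (cases r) (auto simp: loc P P3 intro: rules dest: ba)
  next
    case (ActiveCollide r)
    then show ?thesis using L
      by (cases r) (auto simp: loc P P3 intro: rules dest: ba)
  next
    case (PassiveCollide r)
    then have a: "alive m (the (vMOp l))" using L by (auto dest: ba)
    note keep = ca[OF a] la(4)[OF a] bs kn al(3)[OF a] fin[OF a] al(2)[OF a] ceq(2)
    have "known m (vAInf l) \<Longrightarrow> op_of m' (the (vAInf l)) = op_of m (the (vAInf l))"
      using io(2) .
    then show ?thesis using L PassiveCollide
      by (cases r) (simp_all add: loc keep, metis al(5)[OF a])
  next
    case (Combine r)
    then show ?thesis using L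
      by (cases r) (auto simp: loc P P3 intro: rules dest: ba)
  next
    case (MultiEliminate r)
    then show ?thesis using L
      by (cases r) (auto simp: loc P P3 intro: rules dest: ba)
  qed (use L in \<open>auto simp: loc intro: rules dest: ba\<close>)
qed

section \<open>Preservation of the invariant\<close>

text \<open>The program points from which a thread returns without interacting with other threads.\<close>
fun settled :: "pc \<Rightarrow> bool" where
  "settled (CMultiPop q) \<longleftrightarrow> q \<notin> {CPop1, CPop3a, CPop3b, CPop3c, CPop4a}"
| "settled (CMultiPush q) \<longleftrightarrow> q \<in> {CPush4a, CPush4b, CPush4c, CPush4d, CPush4e, CPush4f}"
| "settled (MultiEliminate q) \<longleftrightarrow> True"
| "settled PopResult1 \<longleftrightarrow> True"
| "settled PopResult2 \<longleftrightarrow> True"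
| "settled Ret \<longleftrightarrow> True"
| "settled _ \<longleftrightarrow> False"

text \<open>Bounds the steps left, where \<open>a\<close> and \<open>b\<close> are the lengths of the two ghost lists. The jumps upwards,
  such as from \<open>CPop2b\<close> to \<open>CPop2c\<close>, occur where a record leaves a list.\<close>
fun settled_rank :: "pc \<Rightarrow> nat \<Rightarrow> nat \<Rightarrow> nat" where
  "settled_rank PopResult1 a b = 2"
| "settled_rank PopResult2 a b = 1"
| "settled_rank (CMultiPop q) a b = (case q of
     CPop2a \<Rightarrow> 4 * a + 10 | CPop2b \<Rightarrow> 4 * a + 9 | CPop2c \<Rightarrow> 4 * a + 12 |
     CPop4b \<Rightarrow> 20 * a + 30 | CPop4c \<Rightarrow> 20 * a + 29 | CPop4d \<Rightarrow> 20 * a + 11 |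
     CPop4e \<Rightarrow> 20 * a + 10 | CPop4f \<Rightarrow> 20 * a + 9 | CPop4g \<Rightarrow> 20 * a + 9 | CPop4h \<Rightarrow> 20 * a + 8 |
     CPop4i \<Rightarrow> 20 * a + 7 | CPop4j \<Rightarrow> 20 * a + 6 |
     CPop4k \<Rightarrow> 20 * a + 24 | CPop4l \<Rightarrow> 20 * a + 23 | CPop4m \<Rightarrow> 20 * a + 22 | _ \<Rightarrow> 0)"
| "settled_rank (CMultiPush q) a b = (case q of
     CPush4a \<Rightarrow> 20 * a + 11 | CPush4b \<Rightarrow> 20 * a + 10 | CPush4c \<Rightarrow> 20 * a + 9 |
     CPush4d \<Rightarrow> 20 * a + 24 | CPush4e \<Rightarrow> 20 * a + 23 | CPush4f \<Rightarrow> 20 * a + 22 | _ \<Rightarrow> 0)"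
| "settled_rank (MultiEliminate q) a b = 100 * (a + b) + (case q of
     Eli1a \<Rightarrow> 50 | Eli1b \<Rightarrow> 49 | Eli1c \<Rightarrow> 48 | Eli1d \<Rightarrow> 49 | Eli1e \<Rightarrow> 48 | Eli2a \<Rightarrow> 47 |
     Eli2b \<Rightarrow> 140 | Eli3a \<Rightarrow> 136 | Eli3b \<Rightarrow> 135 | Eli3c \<Rightarrow> 134 | Eli3d \<Rightarrow> 133 | Eli4a \<Rightarrow> 132 | Eli4b \<Rightarrow> 131 |
     Eli5a \<Rightarrow> 14 | Eli5b \<Rightarrow> 13 | Eli5c \<Rightarrow> 12 | Eli5d \<Rightarrow> 11 | Eli5e \<Rightarrow> 10 |
     Eli6a \<Rightarrow> 14 | Eli6b \<Rightarrow> 13 | Eli6c \<Rightarrow> 12 | Eli6d \<Rightarrow> 11 | Eli6e \<Rightarrow> 10)"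
| "settled_rank _ a b = 0"

section \<open>Steps together with a change of the ghost state\<close>

definition thread_upd :: "'d config \<Rightarrow> nat \<Rightarrow> pc \<Rightarrow> 'd locals \<Rightarrow> 'd mem \<Rightarrow> 'd config" where
  "thread_upd c t q l m = c\<lparr>mem := m, ctl := (ctl c)(t := q), lcl := (lcl c)(t := l)\<rparr>"

text \<open>The rank of a settled thread depends on its ghost lists, so steps of other threads must
  leave these alone. The two steps that do change the lists of another thread, capture and handover,
  hit a thread that is in \<open>collide\<close> or waits, hence is not settled.\<close>

definition progress where
  "progress c G H t c' G' H' \<longleftrightarrow>
     (\<forall>u. u \<noteq> t \<longrightarrow> settled (ctl c u) \<longrightarrow> G' u = G u \<and> H' u = H u) \<and>
     (settled (ctl c t) \<longrightarrow> settled (ctl c' t) \<and>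
        settled_rank (ctl c' t) (length (G' t)) (length (H' t)) < settled_rank (ctl c t) (length (G t)) (length (H t)))"

definition preserved where
  "preserved c ow G H t c' \<longleftrightarrow> (\<exists>ow' G' H'. Inv c' ow' G' H' \<and> progress c G H t c' G' H')"

lemma thread_upd_simps [simp]:
  "mem (thread_upd c t q l m) = m" "ctl (thread_upd c t q l m) = (ctl c)(t := q)" "lcl (thread_upd c t q l m) = (lcl c)(t := l)"
  by (simp_all add: thread_upd_def)

lemma local_inv_base:
  "local_inv m u q l ow g h \<Longrightarrow> g \<noteq> [] \<or> h \<noteq> [] \<Longrightarrow> base m u (vMOp l) (invoked l)"
  by (cases q) auto

lemma waiting_base:
  "local_inv m u q l ow g h \<Longrightarrow> waiting m u q l \<Longrightarrow> base m u (vMOp l) (invoked l)"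
  by (cases q) auto

lemma partner_frame:
  assumes "frame m m' ow ow' w" "alive m (the v)" "a \<noteq> None \<Longrightarrow> alive m (the a)"
  shows "partner m' a v = partner m a v"
proof -
  have "\<forall>x. alive m x \<longrightarrow> op_of m' x = op_of m x" using assms(1) unfolding frame_def by blast
  then show ?thesis using assms(2,3) unfolding partner_def by metis
qed

text \<open>Only permanent operations and the entry of \<open>u\<close> in \<open>location\<close>
  enter, so the frame may be that of any thread \<open>w\<close>.\<close>

lemma waiting_frame:
  assumes F: "frame m m' ow ow' w" and loc: "location m' u = location m u"
    and L: "local_inv m u q l ow g h" and h: "heap_ok m"
  shows "waiting m' u q l = waiting m u q l"
proof -
  have A: "location m u \<noteq> None \<Longrightarrow> alive m (the (location m u))"
    using h unfolding heap_ok_def by auto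
  note P = partner_frame[OF F]
  show ?thesis
  proof (cases q)
    case (Collide r)
    with L have "alive m (the (vMOp l))" by (simp add: base_def)
    then show ?thesis using Collide P[OF _ A] loc by simp
  next
    case (PassiveCollide r)
    with L have a: "alive m (the (vMOp l))" by (simp add: base_def)
    have "r \<in> {Pas2a, Pas2b, Pas3a, Pas3b} \<Longrightarrow> alive m (the (vAInf l))"
      using L PassiveCollide by (auto simp: captured_def)
    then show ?thesis using PassiveCollide P[OF a A] P[OF a, of "vAInf l"] loc by auto
  qed auto
qed

lemma exempt_frame:
  assumes F: "frame m m' ow ow' w" and "alive m x" "alive m (the (vMOp l))"
  shows "exempt m' l x = exempt m l x"
proof -
  have "\<forall>x. alive m x \<longrightarrow> op_of m' x = op_of m x" using F unfolding frame_def by blast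
  then show ?thesis using assms(2,3) unfolding exempt_def by metis
qed

lemma InvD:
  assumes "Inv c ow G H"
  shows "heap_ok (mem c)" "local_inv (mem c) u (ctl c u) (lcl c u) ow (G u) (H u)"
    "distinct (G u @ H u)"
    "x \<in> set (G u) \<union> set (H u) \<Longrightarrow> alive (mem c) x \<and> ow x = u"
    "x \<in> set (G u) \<union> set (H u) \<Longrightarrow> exempt (mem c) (lcl c u) x \<or> waiter c x"
    "waiting (mem c) u (ctl c u) (lcl c u) \<Longrightarrow> vMOp (lcl c u) = Some x \<Longrightarrow> ow x \<noteq> u \<Longrightarrow>
        status_of (mem c) x = FINISHED \<or> status_of (mem c) x = INIT \<and> x \<in> set (G (ow x)) \<union> set (H (ow x))"
  using assms unfolding Inv_def by blast+

text \<open>Covers the steps that leave ownership as it is. A record may leave the lists of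
  \<open>t\<close> only if it is FINISHED or the own record of \<open>t\<close>, for otherwise its
  waiting thread would be forgotten. Conversely \<open>t\<close> may stop waiting only if it owns
  its record or has been served: then no other thread relies on it as a waiter.\<close>

lemma own_step_Inv:
  fixes c :: "'d config"
  assumes I: "Inv c ow G H"
    and q: "ctl c t = q" and l: "lcl c t = l" and m: "mem c = m"
    and hp: "heap_ok m'"
    and F: "\<And>u. u \<noteq> t \<Longrightarrow> frame m m' ow ow u"
    and L: "local_inv m' t q' l' ow g' h'"
    and di: "distinct (g' @ h')"
    and sub: "set g' \<union> set h' \<subseteq> set (G t) \<union> set (H t)"
    and v: "vMOp l' = vMOp l"
    and keep: "\<And>x. x \<in> set g' \<union> set h' \<Longrightarrow> exempt m l x \<Longrightarrow> exempt m' l' x"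
    and drop: "\<And>x. x \<in> set (G t) \<union> set (H t) \<Longrightarrow> x \<notin> set g' \<union> set h' \<Longrightarrow> status_of m' x = FINISHED \<or> vMOp l = Some x"
    and st: "\<And>x. x \<in> set g' \<union> set h' \<Longrightarrow> vMOp l \<noteq> Some x \<Longrightarrow> status_of m' x = status_of m x"
    and w: "waiting m' t q' l' = waiting m t q l \<or>
        \<not> waiting m' t q' l' \<and> (\<forall>x. vMOp l = Some x \<longrightarrow> ow x = t \<or> status_of m x = FINISHED)"
  shows "Inv (thread_upd c t q' l' m') ow (G(t := g')) (H(t := h'))"
proof -
  let ?c = "thread_upd c t q' l' m'" and ?G = "G(t := g')" and ?H = "H(t := h')"
  note D = InvD[OF I, unfolded m]
  \<comment> \<open>\<open>Suc t\<close> merely stands for some thread other than \<open>t\<close>;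
    only clauses that are the same for all threads are extracted from this frame.\<close>
  have F1: "frame m m' ow ow (Suc t)" by (rule F) simp
  have al: "alive m' x" "id_of m' x = id_of m x" "op_of m' x = op_of m x"
      "status_of m x = FINISHED \<Longrightarrow> status_of m' x = FINISHED" if "alive m x" for x
    using F1 that unfolding frame_def by blast+
  have stu: "status_of m' x = status_of m x" if "alive m x" "ow x \<noteq> t" for x
    using F[OF that(2)] that(1) unfolding frame_def by blast
  have wu: "waiting m' u (ctl c u) (lcl c u) = waiting m u (ctl c u) (lcl c u)" if "u \<noteq> t" for u
    using waiting_frame[OF F1 _ D(2) D(1)] F[OF that] unfolding frame_def by blast
  have bw: "alive m x \<and> id_of m x = u" if "waiting m u (ctl c u) (lcl c u)" "vMOp (lcl c u) = Some x" for u x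
    using waiting_base[OF D(2) that(1)] that(2) by (simp add: base_def)
  have bt: "id_of m x = t" if "vMOp l = Some x" "y \<in> set (G t) \<union> set (H t)" for x y
  proof -
    have "G t \<noteq> [] \<or> H t \<noteq> []" using that(2) by auto
    from local_inv_base[OF D(2) this] show ?thesis using that(1) l by (simp add: base_def)
  qed
  have new: "alive m' x \<and> ow x = u \<and> (exempt m' (lcl ?c u) x \<or> waiter ?c x)"
    if x: "x \<in> set (?G u) \<union> set (?H u)" for u x
  proof -
    have xo: "x \<in> set (G u) \<union> set (H u)" using x sub by (cases "u = t") auto
    have ax: "alive m x" "ow x = u" using D(4)[OF xo] by auto
    from D(5)[OF xo] have "exempt m' (lcl ?c u) x \<or> waiter ?c x"
    proof
      assume e: "exempt m (lcl c u) x"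
      show ?thesis
      proof (cases "u = t")
        case True
        then show ?thesis using keep x e l by auto
      next
        case False
        have "G u \<noteq> [] \<or> H u \<noteq> []" using xo by auto
        from local_inv_base[OF D(2) this] have "alive m (the (vMOp (lcl c u)))" by (simp add: base_def)
        then show ?thesis using exempt_frame[OF F1 ax(1)] e False by simp
      qed
    next
      assume W: "waiter c x"
      let ?p = "id_of m x"
      have W': "status_of m x = INIT" "vMOp (lcl c ?p) = Some x" "waiting m ?p (ctl c ?p) (lcl c ?p)"
        using W unfolding waiter_def m by auto
      show ?thesis
      proof (cases "?p = t")
        case False
        have "status_of m' x = status_of m x"
        proof (cases "u = t")
          case True
          then show ?thesis using st[of x] x bt[of x x] xo False by auto
        next
          case F: False
          then show ?thesis using stu ax by auto
        qed
        then have "waiter ?c x" using W' wu[OF False] False al(2)[OF ax(1)] unfolding waiter_def by simp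
        then show ?thesis ..
      next
        \<comment> \<open>The waiting thread is \<open>t\<close> itself. On its own list the record
          is exempt. On a foreign list it is INIT and not owned by \<open>t\<close>, so
          \<open>w\<close> leaves only the case in which \<open>t\<close> goes on waiting.\<close>
        case p: True
        show ?thesis
        proof (cases "u = t")
          case True
          have "vMOp (lcl c t) = Some x" using W'(2) p by simp
          then have "exempt m' l' x" using v l unfolding exempt_def by simp
          then show ?thesis using True by simp
        next
          case False
          then have "status_of m' x = status_of m x" using stu ax by auto
          moreover have "waiting m' t q' l'" using w W' p l q ax False by auto
          ultimately have "waiter ?c x" using W' p al(2)[OF ax(1)] v l unfolding waiter_def by simp
          then show ?thesis ..
        qed
      qed
    qed
    then show ?thesis using ax al by auto
  qed
  have wt: "status_of m' x = FINISHED \<or> status_of m' x = INIT \<and> x \<in> set (?G (ow x)) \<union> set (?H (ow x))"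
    if A: "waiting m' p (ctl ?c p) (lcl ?c p)" "vMOp (lcl ?c p) = Some x" "ow x \<noteq> p" for p x
  proof -
    have W: "waiting m p (ctl c p) (lcl c p)" "vMOp (lcl c p) = Some x"
      using A wu[of p] w q l v by (auto split: if_splits)
    have ax: "alive m x" "id_of m x = p" using bw[OF W] by auto
    from D(6)[OF W A(3)] show ?thesis
    proof
      assume "status_of m x = FINISHED"
      then show ?thesis using al ax by auto
    next
      assume B: "status_of m x = INIT \<and> x \<in> set (G (ow x)) \<union> set (H (ow x))"
      show ?thesis
      proof (cases "ow x = t")
        case False
        then show ?thesis using B stu ax by auto
      next
        case True
        then have xt: "x \<in> set (G t) \<union> set (H t)" using B by auto
        \<comment> \<open>The id of the record is \<open>p\<close>, which differs from its owner
          \<open>t\<close>. So it is not the own record of \<open>t\<close>, and \<open>drop\<close>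
          can have released it only as FINISHED.\<close>
        have "vMOp l \<noteq> Some x" using bt[OF _ xt] ax True A(3) by auto
        then show ?thesis using drop[OF xt] st[of x] B True by auto
      qed
    qed
  qed
  show ?thesis
    unfolding Inv_def
  proof (intro conjI allI)
    show "heap_ok (mem ?c)" using hp by simp
  next
    fix u
    show "local_inv (mem ?c) u (ctl ?c u) (lcl ?c u) ow (?G u) (?H u)"
    proof (cases "u = t")
      case True then show ?thesis using L by simp
    next
      case False
      have "local_inv m' u (ctl c u) (lcl c u) ow (G u) (H u)"
        using D(4) by (intro local_inv_frame[OF F[OF False] _ _ D(2)]) blast+
      then show ?thesis using False by simp
    qed
  next
    fix u show "distinct (?G u @ ?H u)" using di D(3)[of u] by (cases "u = t") auto
  next
    fix u show "\<forall>x\<in>set (?G u) \<union> set (?H u). alive (mem ?c) x \<and> ow x = u \<and> (exempt (mem ?c) (lcl ?c u) x \<or> waiter ?c x)"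
      using new by (metis thread_upd_simps(1))
  next
    fix p x
    show "waiting (mem ?c) p (ctl ?c p) (lcl ?c p) \<and> vMOp (lcl ?c p) = Some x \<and> ow x \<noteq> p \<longrightarrow>
        status_of (mem ?c) x = FINISHED \<or> status_of (mem ?c) x = INIT \<and> x \<in> set (?G (ow x)) \<union> set (?H (ow x))"
      using wt unfolding thread_upd_simps(1) by blast
  qed
qed

lemma own_step:
  fixes c :: "'d config"
  assumes I: "Inv c ow G H"
    and q: "ctl c t = q" and l: "lcl c t = l" and m: "mem c = m"
    and hp: "heap_ok m'"
    and F: "\<And>u. u \<noteq> t \<Longrightarrow> frame m m' ow ow u"
    and L: "local_inv m' t q' l' ow g' h'"
    and di: "distinct (g' @ h')"
    and sub: "set g' \<union> set h' \<subseteq> set (G t) \<union> set (H t)"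
    and v: "vMOp l' = vMOp l"
    and keep: "\<And>x. x \<in> set g' \<union> set h' \<Longrightarrow> exempt m l x \<Longrightarrow> exempt m' l' x"
    and drop: "\<And>x. x \<in> set (G t) \<union> set (H t) \<Longrightarrow> x \<notin> set g' \<union> set h' \<Longrightarrow> status_of m' x = FINISHED \<or> vMOp l = Some x"
    and st: "\<And>x. x \<in> set g' \<union> set h' \<Longrightarrow> vMOp l \<noteq> Some x \<Longrightarrow> status_of m' x = status_of m x"
    and w: "waiting m' t q' l' = waiting m t q l \<or>
        \<not> waiting m' t q' l' \<and> (\<forall>x. vMOp l = Some x \<longrightarrow> ow x = t \<or> status_of m x = FINISHED)"
    and s: "settled q \<Longrightarrow> settled q' \<and> settled_rank q' (length g') (length h') < settled_rank q (length (G t)) (length (H t))"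
  shows "preserved c ow G H t (thread_upd c t q' l' m')"
proof -
  have "Inv (thread_upd c t q' l' m') ow (G(t := g')) (H(t := h'))"
    by (rule own_step_Inv[OF I q l m hp F L di sub v keep drop st w])
  moreover have "progress c G H t (thread_upd c t q' l' m') (G(t := g')) (H(t := h'))" unfolding progress_def using s q by simp
  ultimately show ?thesis unfolding preserved_def by blast
qed

lemma frame_refl [simp]: "frame m m ow ow u"
  by (simp add: frame_def)

text \<open>A change of \<open>vPInf\<close> could only spoil an exemption granted through it. With
  \<open>H t\<close> empty and all of \<open>G t\<close> of the own operation, no listed record is
  exempt in that way.\<close>

lemma own_read:
  assumes I: "Inv c ow G H"
    and L: "local_inv (mem c) t q' l' ow (G t) (H t)"
    and v: "vMOp l' = vMOp (lcl c t)"
    and x: "vPInf l' = vPInf (lcl c t) \<or> H t = [] \<and> same_op (mem c) (vMOp (lcl c t)) (G t)"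
    and w: "waiting (mem c) t q' l' = waiting (mem c) t (ctl c t) (lcl c t) \<or>
        \<not> waiting (mem c) t q' l' \<and> (\<forall>x. vMOp (lcl c t) = Some x \<longrightarrow> owned ow t x \<or> status_of (mem c) x = FINISHED)"
    and s: "settled (ctl c t) \<Longrightarrow> settled q' \<and> settled_rank q' (length (G t)) (length (H t)) < settled_rank (ctl c t) (length (G t)) (length (H t))"
  shows "preserved c ow G H t (thread_upd c t q' l' (mem c))"
  by (rule own_step[OF I refl refl refl InvD(1)[OF I] _ L InvD(3)[OF I] _ v _ _ _ w[unfolded owned_def] s])
     (use x v in \<open>auto simp: exempt_def same_op_def\<close>)

section \<open>Accesses to allocated records\<close>

lemma read_mop_known:
  "known m p \<Longrightarrow> read_mop l p f k m = {(k (f (the (mops m (the p)))), m)}"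
  unfolding known_def read_mop_def by auto

definition set_mop :: "mref \<Rightarrow> (multiop \<Rightarrow> multiop) \<Rightarrow> 'd mem \<Rightarrow> 'd mem" where
  "set_mop x f m = m\<lparr>mops := (mops m)(x \<mapsto> f (the (mops m x)))\<rparr>"

lemma write_mop_known:
  "known m p \<Longrightarrow> write_mop l p f k m = {(k, set_mop (the p) f m)}"
  unfolding known_def write_mop_def set_mop_def by auto

lemma read_cell_present:
  "cell_present m p \<Longrightarrow> read_cell l p f k m = {(k (f (the (cells m (the p)))), m)}"
  unfolding cell_present_def read_cell_def by auto

lemma set_mop_simps [simp]:
  "cells (set_mop x f m) = cells m" "centralStack (set_mop x f m) = centralStack m"
  "location (set_mop x f m) = location m" "collision (set_mop x f m) = collision m"
  "cell_ok (set_mop x f m) p = cell_ok m p" "cell_present (set_mop x f m) p = cell_present m p"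
  by (simp_all add: set_mop_def cell_ok_def cell_present_def)

lemma mops_set_mop:
  "mops (set_mop x f m) y = (if y = x then Some (f (the (mops m x))) else mops m y)"
  by (simp add: set_mop_def)

lemma known_set_mop [simp]: "known m p \<Longrightarrow> known (set_mop x f m) p"
  by (simp add: known_def mops_set_mop)

lemma set_mop_cell [simp]:
  "id_of (set_mop x (m_cell_update f) m) y = id_of m y" "op_of (set_mop x (m_cell_update f) m) y = op_of m y"
  "status_of (set_mop x (m_cell_update f) m) y = status_of m y" "next_of (set_mop x (m_cell_update f) m) y = next_of m y"
  "last_of (set_mop x (m_cell_update f) m) y = last_of m y"
  by (simp_all add: mops_set_mop)

lemma set_mop_length [simp]:
  "id_of (set_mop x (m_length_update f) m) y = id_of m y" "op_of (set_mop x (m_length_update f) m) y = op_of m y"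
  "status_of (set_mop x (m_length_update f) m) y = status_of m y" "next_of (set_mop x (m_length_update f) m) y = next_of m y"
  "last_of (set_mop x (m_length_update f) m) y = last_of m y" "cell_of (set_mop x (m_length_update f) m) y = cell_of m y"
  by (simp_all add: mops_set_mop)

lemma set_mop_status [simp]:
  "id_of (set_mop x (m_cStatus_update f) m) y = id_of m y" "op_of (set_mop x (m_cStatus_update f) m) y = op_of m y"
  "cell_of (set_mop x (m_cStatus_update f) m) y = cell_of m y" "next_of (set_mop x (m_cStatus_update f) m) y = next_of m y"
  "last_of (set_mop x (m_cStatus_update f) m) y = last_of m y"
  by (simp_all add: mops_set_mop)

lemma set_mop_last [simp]:
  "id_of (set_mop x (m_last_update f) m) y = id_of m y" "op_of (set_mop x (m_last_update f) m) y = op_of m y"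
  "status_of (set_mop x (m_last_update f) m) y = status_of m y" "next_of (set_mop x (m_last_update f) m) y = next_of m y"
  "cell_of (set_mop x (m_last_update f) m) y = cell_of m y"
  by (simp_all add: mops_set_mop)

lemma set_mop_next [simp]:
  "id_of (set_mop x (m_next_update f) m) y = id_of m y" "op_of (set_mop x (m_next_update f) m) y = op_of m y"
  "status_of (set_mop x (m_next_update f) m) y = status_of m y" "last_of (set_mop x (m_next_update f) m) y = last_of m y"
  "cell_of (set_mop x (m_next_update f) m) y = cell_of m y"
  by (simp_all add: mops_set_mop)

lemma path_set_mop [simp]:
  "path (set_mop x (m_cell_update fa) m) p g = path m p g"
  "path (set_mop x (m_length_update fb) m) p g = path m p g"
  "path (set_mop x (m_cStatus_update fc) m) p g = path m p g"
  "path (set_mop x (m_last_update fd) m) p g = path m p g"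
  "x \<notin> set g \<Longrightarrow> path (set_mop x (m_next_update fe) m) p g = path m p g"
  by (rule path_cong; simp add: mops_set_mop; blast)+

lemma frame_set_mop:
  fixes m :: "'d mem"
  assumes "alive m x" and r: "r = the (mops m x)"
    and "m_id (f r) = m_id r" "m_op (f r) = m_op r"
    and "m_cell r \<noteq> None \<Longrightarrow> m_cell (f r) \<noteq> None" "m_cStatus r = FINISHED \<Longrightarrow> m_cStatus (f r) = FINISHED"
    and "ow x \<noteq> u \<or> m_next (f r) = m_next r \<and> m_last (f r) = m_last r \<and> m_cStatus (f r) = m_cStatus r"
  shows "frame m (set_mop x f m) ow ow u"
  using assms(3-) unfolding frame_def r by (auto simp: mops_set_mop)

lemma heap_ok_set_mop:
  fixes m :: "'d mem"
  assumes "heap_ok m" "alive m x" and r: "r = the (mops m x)"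
    and "m_op (f r) = m_op r" "cell_ok m (m_cell (f r))"
    and "m_cell r \<noteq> None \<Longrightarrow> m_cell (f r) \<noteq> None"
    and "m_cStatus (f r) = FINISHED \<Longrightarrow> m_cell (f r) \<noteq> None"
  shows "heap_ok (set_mop x f m)"
  using assms unfolding heap_ok_def r by (auto simp: mops_set_mop)

text \<open>Links and status are written only by the owner, while cells and lengths may be written
  without ownership. A record that stays listed and is not the own one keeps its status, because it
  has to remain INIT for its waiter; its status changes in the step in which it leaves the
  list.\<close>

lemma own_write:
  fixes c :: "'d config"
  assumes I: "Inv c ow G H" and a: "alive (mem c) x" and r: "r = the (mops (mem c) x)"
    and f: "m_id (f r) = m_id r" "m_op (f r) = m_op r" "m_cell (f r) = m_cell r \<or> cell_ok (mem c) (m_cell (f r))"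
      "m_cell r \<noteq> None \<Longrightarrow> m_cell (f r) \<noteq> None" "m_cStatus r = FINISHED \<Longrightarrow> m_cStatus (f r) = FINISHED"
      "m_cStatus (f r) = FINISHED \<Longrightarrow> m_cStatus r = FINISHED \<or> m_cell (f r) \<noteq> None"
      "owned ow t x \<or> m_next (f r) = m_next r \<and> m_last (f r) = m_last r \<and> m_cStatus (f r) = m_cStatus r"
    and L: "local_inv (set_mop x f (mem c)) t q' l' ow g' h'"
    and di: "distinct (g' @ h')"
    and sub: "set g' \<union> set h' \<subseteq> set (G t) \<union> set (H t)"
    and v: "vMOp l' = vMOp (lcl c t)"
    and p: "vPInf l' = vPInf (lcl c t)"
    and drop: "\<And>y. y \<in> set (G t) \<union> set (H t) \<Longrightarrow> y \<notin> set g' \<union> set h' \<Longrightarrow> y = x \<and> m_cStatus (f r) = FINISHED"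
    and st: "m_cStatus (f r) = m_cStatus r \<or> x \<notin> set g' \<union> set h' \<or> vMOp (lcl c t) = Some x"
    and w: "waiting (set_mop x f (mem c)) t q' l' = waiting (mem c) t (ctl c t) (lcl c t) \<or>
        \<not> waiting (set_mop x f (mem c)) t q' l' \<and> (\<forall>x. vMOp (lcl c t) = Some x \<longrightarrow> owned ow t x \<or> status_of (mem c) x = FINISHED)"
    and s: "settled (ctl c t) \<Longrightarrow> settled q' \<and> settled_rank q' (length g') (length h') < settled_rank (ctl c t) (length (G t)) (length (H t))"
  shows "preserved c ow G H t (thread_upd c t q' l' (set_mop x f (mem c)))"
proof (rule own_step[OF I refl refl refl _ _ L di sub v _ _ _ w[unfolded owned_def] s])
  have "cell_ok (mem c) (m_cell r)" using InvD(1)[OF I] a r unfolding heap_ok_def by blast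
  then have "cell_ok (mem c) (m_cell (f r))" using f(3) by auto
  moreover have "m_cStatus r = FINISHED \<Longrightarrow> m_cell r \<noteq> None"
    using InvD(1)[OF I] a r unfolding heap_ok_def by blast
  ultimately show "heap_ok (set_mop x f (mem c))" using heap_ok_set_mop[OF InvD(1)[OF I] a r] f by blast
  show "frame (mem c) (set_mop x f (mem c)) ow ow u" if "u \<noteq> t" for u
    using f that unfolding owned_def by (intro frame_set_mop[OF a r]) auto
  have op: "op_of (set_mop x f (mem c)) y = op_of (mem c) y" for y using f(2) r by (simp add: mops_set_mop)
  show "exempt (mem c) (lcl c t) y \<Longrightarrow> exempt (set_mop x f (mem c)) l' y" for y
    unfolding exempt_def op v p .
  show "y \<in> set (G t) \<union> set (H t) \<Longrightarrow> y \<notin> set g' \<union> set h' \<Longrightarrow>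
       status_of (set_mop x f (mem c)) y = FINISHED \<or> vMOp (lcl c t) = Some y" for y
    using drop[of y] r by (auto simp: mops_set_mop)
  show "y \<in> set g' \<union> set h' \<Longrightarrow> vMOp (lcl c t) \<noteq> Some y \<Longrightarrow>
         status_of (set_mop x f (mem c)) y = status_of (mem c) y" for y
    using st r by (auto simp: mops_set_mop)
qed

text \<open>The central stack, the collision array and the links between cells occur in no assertion
  of a thread; of the cells only their existence does. So it suffices to check the new assertion in
  the old memory.\<close>

lemma own_other:
  fixes c :: "'d config"
  assumes I: "Inv c ow G H"
    and m: "mops m' = mops (mem c)" "location m' = location (mem c)"
      "\<And>x. cells (mem c) x \<noteq> None \<Longrightarrow> cells m' x \<noteq> None" "heap_ok m'"
    and L: "local_inv (mem c) t q' l' ow (G t) (H t)"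
    and v: "vMOp l' = vMOp (lcl c t)" "vPInf l' = vPInf (lcl c t)"
    and w: "waiting (mem c) t q' l' = waiting (mem c) t (ctl c t) (lcl c t)"
    and s: "settled (ctl c t) \<Longrightarrow> settled q' \<and> settled_rank q' (length (G t)) (length (H t)) < settled_rank (ctl c t) (length (G t)) (length (H t))"
  shows "preserved c ow G H t (thread_upd c t q' l' m')"
proof -
  have F: "frame (mem c) m' ow ow u" for u
    using m unfolding frame_def by simp
  have e: "exempt m' l' x = exempt (mem c) (lcl c t) x" for x
    using m v by (simp add: exempt_def)
  have "waiting m' t q' l' = waiting (mem c) t q' l'"
    by (rule waiting_frame[OF F _ L InvD(1)[OF I]]) (simp add: m)
  with w have w': "waiting m' t q' l' = waiting (mem c) t (ctl c t) (lcl c t)" by simp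
  have L': "local_inv m' t q' l' ow (G t) (H t)"
    using InvD(4)[OF I] by (intro local_inv_frame[OF F _ _ L]) blast+
  show ?thesis
    by (rule own_step[OF I refl refl refl m(4) F L' InvD(3)[OF I] _ v(1) _ _ _ disjI1[OF w'] s])
       (auto simp: e m)
qed

text \<open>At the end of a serving loop only the own record is left. It may be dropped without
  being FINISHED, since nobody waits on it.\<close>

lemma own_exit:
  fixes c :: "'d config"
  assumes I: "Inv c ow G H"
    and L: "local_inv (mem c) t q' l' ow [] []"
    and g: "tl (G t) = []" "path (mem c) (vMOp (lcl c t)) (G t)" "H t = []"
    and v: "vMOp l' = vMOp (lcl c t)"
    and w: "\<not> waiting (mem c) t q' l'" "\<not> waiting (mem c) t (ctl c t) (lcl c t)"
    and s: "settled (ctl c t) \<Longrightarrow> settled q' \<and> settled_rank q' 0 0 < settled_rank (ctl c t) (length (G t)) 0"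
  shows "preserved c ow G H t (thread_upd c t q' l' (mem c))"
proof (rule own_step[OF I refl refl refl InvD(1)[OF I] frame_refl L _ _ v])
  show "status_of (mem c) x = FINISHED \<or> vMOp (lcl c t) = Some x" if "x \<in> set (G t) \<union> set (H t)" for x
    using that g by (cases "G t") auto
qed (use w s g in auto)

lemma cell_present_iff: "cell_present m p \<longleftrightarrow> cell_ok m p \<and> p \<noteq> None"
  unfolding cell_present_def cell_ok_def by blast

lemma base_known: "base m u v i \<Longrightarrow> known m v"
  by (simp add: base_def known_def)

lemma heap_okD:
  assumes "heap_ok m"
  shows "cell_ok m (centralStack m)" "cell_ok m (Some EMPTY_CELL)"
    "known m p \<Longrightarrow> cell_ok m (cell_of m (the p))"
    "cell_present m q \<Longrightarrow> cell_ok m (c_next (the (cells m (the q))))"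
    "known m p \<Longrightarrow> op_of m (the p) = PUSH \<Longrightarrow> cell_of m (the p) \<noteq> None"
  using assms unfolding heap_ok_def known_def cell_present_def by (auto simp: cell_ok_def)

lemma path_hd: "path m p g \<Longrightarrow> g \<noteq> [] \<Longrightarrow> p = Some (hd g) \<and> path m (next_of m (hd g)) (tl g)"
  by (cases g) auto

lemma path_None: "path m None g \<longleftrightarrow> g = []"
  by (cases g) auto

lemma path_next:
  "path m v g \<Longrightarrow> g \<noteq> [] \<Longrightarrow> next_of m (the v) = (if tl g = [] then None else Some (hd (tl g)))"
  by (cases g; cases "tl g") auto

lemma cell_ok_None [simp]: "cell_ok m None"
  by (simp add: cell_ok_def)

lemma has_cell_set_cell: "v \<noteq> None \<Longrightarrow> has_cell m p \<Longrightarrow> has_cell (set_mop x (m_cell_update (\<lambda>_. v)) m) p"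
  by (simp add: has_cell_def mops_set_mop)

lemma has_cell_set_cell_same: "v \<noteq> None \<Longrightarrow> x = the p \<Longrightarrow> has_cell (set_mop x (m_cell_update (\<lambda>_. v)) m) p"
  by (simp add: has_cell_def mops_set_mop)

lemma has_cell_set_other [simp]:
  "has_cell (set_mop x (m_length_update fb) m) p = has_cell m p"
  "has_cell (set_mop x (m_cStatus_update fc) m) p = has_cell m p"
  "has_cell (set_mop x (m_last_update fd) m) p = has_cell m p"
  "has_cell (set_mop x (m_next_update fe) m) p = has_cell m p"
  by (simp_all add: has_cell_def)

lemma base_set_mop [simp]:
  assumes "base m u v i"
  shows "base (set_mop x (m_cell_update fa) m) u v i" "base (set_mop x (m_length_update fb) m) u v i"
    "base (set_mop x (m_cStatus_update fc) m) u v i" "base (set_mop x (m_last_update fd) m) u v i"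
    "base (set_mop x (m_next_update fe) m) u v i"
  using assms by (auto simp: base_def mops_set_mop)

lemma same_op_set_mop [simp]:
  "same_op (set_mop x (m_cell_update fa) m) v g = same_op m v g"
  "same_op (set_mop x (m_length_update fb) m) v g = same_op m v g"
  "same_op (set_mop x (m_cStatus_update fc) m) v g = same_op m v g"
  "same_op (set_mop x (m_last_update fd) m) v g = same_op m v g"
  "same_op (set_mop x (m_next_update fe) m) v g = same_op m v g"
  by (simp_all add: same_op_def)

lemma same_op_Nil [simp]: "same_op m v []"
  by (simp add: same_op_def)

lemma same_op_simps:
  "same_op m v (x # g) \<longleftrightarrow> op_of m x = op_of m (the v) \<and> same_op m v g"
  by (auto simp: same_op_def)

lemma same_op_sub: "same_op m v g \<Longrightarrow> set h \<subseteq> set g \<Longrightarrow> same_op m v h"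
  by (auto simp: same_op_def)

lemma knownD: "known m p \<Longrightarrow> alive m (the p)"
  by (simp add: known_def)

lemma heap_ok_put_central: "heap_ok m \<Longrightarrow> cell_ok m v \<Longrightarrow> heap_ok (put_central v m)"
  unfolding heap_ok_def put_central_def cell_ok_def by simp

lemma own_central:
  fixes c :: "'d config"
  assumes I: "Inv c ow G H" and v: "cell_ok (mem c) p"
    and "local_inv (mem c) t q' (lcl c t) ow (G t) (H t)"
    and "waiting (mem c) t q' (lcl c t) = waiting (mem c) t (ctl c t) (lcl c t)"
    and "\<not> settled (ctl c t)"
  shows "preserved c ow G H t (thread_upd c t q' (lcl c t) (put_central p (mem c)))"
  by (rule own_other[OF I]) (use assms(3-) heap_ok_put_central[OF InvD(1)[OF I] v] in \<open>auto simp: put_central_def\<close>)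

lemma heap_ok_set_cell:
  assumes "heap_ok m" "cell_ok m v" "cells m x \<noteq> None"
  shows "heap_ok (m\<lparr>cells := (cells m)(x \<mapsto> (the (cells m x))\<lparr>c_next := v\<rparr>)\<rparr>)"
  using assms unfolding heap_ok_def cell_ok_def by (auto simp: split: if_splits)

lemma write_cell_present:
  "cell_present m p \<Longrightarrow> write_cell l p f k m = {(k, m\<lparr>cells := (cells m)(the p \<mapsto> f (the (cells m (the p))))\<rparr>)}"
  unfolding cell_present_def write_cell_def by auto

lemma own_cell:
  fixes c :: "'d config"
  assumes I: "Inv c ow G H" and v: "cell_ok (mem c) p" "cell_present (mem c) x"
    and "local_inv (mem c) t q' (lcl c t) ow (G t) (H t)"
    and "waiting (mem c) t q' (lcl c t) = waiting (mem c) t (ctl c t) (lcl c t)"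
    and "\<not> settled (ctl c t)"
  shows "preserved c ow G H t (thread_upd c t q' (lcl c t)
    ((mem c)\<lparr>cells := (cells (mem c))(the x \<mapsto> (the (cells (mem c) (the x)))\<lparr>c_next := p\<rparr>)\<rparr>))"
  by (rule own_other[OF I]) (use assms(3-) heap_ok_set_cell[OF InvD(1)[OF I] v(1)] in \<open>auto simp: cell_present_def\<close>)

section \<open>The steps of the code\<close>

text \<open>The list shrinks at the stores of FINISHED in \<open>CPop2b\<close> and
  \<open>CPop4j\<close>, and at the exit from the second loop; the unlinking from
  \<open>CPop4k\<close> to \<open>CPop4m\<close> only lets the pointers catch up.\<close>

lemma pop_preserves:
  fixes c :: "'d config"
  assumes I: "Inv c ow G H" and q: "ctl c t = CMultiPop p"
    and E: "((q', l'), m') \<in> pop_code p (lcl c t) (mem c)"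
  shows "preserved c ow G H t (thread_upd c t q' l' m')"
proof -
  let ?m = "mem c" and ?l = "lcl c t"
  have L: "base ?m t (vMOp ?l) (invoked ?l)" "location ?m t = None" "H t = []" "invoked ?l = Pop"
      "pop_inv ?m t p ?l ow (G t)"
    using InvD(2)[OF I, of t] q by auto
  have hp: "heap_ok ?m" by (rule InvD(1)[OF I])
  have k: "known ?m (vMOp ?l)" by (rule base_known[OF L(1)])
  have al: "known ?m (Some x)" "owned ow t x" if "x \<in> set (G t)" for x
    using InvD(4)[OF I, of x t] that by (auto simp: known_def owned_def)
  have kp: "known ?m p \<and> owned ow t (the p)" if "path ?m p (G t)" "G t \<noteq> []" for p
    using path_hd[OF that] al that by auto
  have di: "distinct (G t)" using InvD(3)[OF I, of t] by simp
  note R = own_read[OF I] and W = own_write[OF I _ refl]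
  note sm = q load_def read_mop_known read_cell_present op_return_def cell_present_iff write_mop_known serve_def beyond_def unlink_def
  note hc = heap_okD(4)[OF hp, of "vTop ?l"] heap_okD(4)[OF hp, of "vNTop ?l"]
  show ?thesis
  proof (cases p)
    case CPop1
    show ?thesis using E L heap_okD(1)[OF hp] unfolding CPop1
      by (auto simp: sm CPop1 lead_def lead0_def split: if_splits intro!: R)
  next
    case CPop2a
    have "known ?m (vPOp ?l)" "owned ow t (the (vPOp ?l))" using L(5) kp CPop2a by auto
    then show ?thesis using E L heap_okD(2)[OF hp] di unfolding CPop2a
      by (auto simp: sm CPop2a has_cell_set_cell has_cell_set_cell_same dest: knownD intro!: W[where g' = "G t" and h' = "[]"])
  next
    case CPop2b
    have "known ?m (vPOp ?l)" "owned ow t (the (vPOp ?l))" using L(5) kp CPop2b by auto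
    moreover obtain x g where "G t = x # g" using L(5) CPop2b by (cases "G t") auto
    ultimately show ?thesis using E L heap_okD(3)[OF hp] di unfolding CPop2b
      by (auto simp: sm CPop2b has_cell_def known_def mops_set_mop intro!: W[where g' = "tl (G t)" and h' = "[]"])
  next
    case CPop2c
    have "known ?m (vPOp ?l)" using L(5) CPop2c by (simp add: beyond_def known_def)
    then show ?thesis using E L unfolding CPop2c
      by (auto simp: sm CPop2c path_None split: if_splits intro!: R)
  next
    case CPop3a
    show ?thesis using E L hc unfolding CPop3a
      by (auto simp: sm CPop3a split: if_splits intro!: R)
  next
    case CPop3b
    show ?thesis using E L k unfolding CPop3b
      by (auto simp: sm CPop3b split: if_splits intro!: R)
  next
    case CPop3c
    show ?thesis using E L k hc unfolding CPop3c
      by (auto simp: sm CPop3c split: if_splits intro!: R)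
  next
    case CPop4a
    show ?thesis using E L unfolding CPop4a
      by (auto simp: sm CPop4a cas_def lead_def lead0_def exposed_def split: if_splits intro!: R own_central[OF I])
  next
    case CPop4b
    show ?thesis using E L k di unfolding CPop4b
      by (auto simp: sm CPop4b has_cell_set_cell has_cell_set_cell_same dest: knownD intro!: W[where g' = "G t" and h' = "[]"])
  next
    case CPop4c
    show ?thesis using E L hc unfolding CPop4c
      by (auto simp: sm CPop4c split: if_splits intro!: R)
  next
    case CPop4d
    note e = E L k path_next[of ?m "vMOp ?l" "G t"]
    show ?thesis
    proof (cases "tl (G t) = []")
      case True
      then show ?thesis using e unfolding CPop4d by (auto simp: sm CPop4d intro!: own_exit[OF I])
    next
      case False
      then show ?thesis using e unfolding CPop4d by (auto simp: sm CPop4d intro!: R)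
    qed
  next
    case CPop4e
    show ?thesis using E L k path_next[of ?m "vMOp ?l" "G t"] unfolding CPop4e
      by (auto simp: sm CPop4e split: if_splits intro!: R)
  next
    case CPop4f
    obtain x y g where g: "G t = x # y # g" using L(5) CPop4f by (cases "G t"; cases "tl (G t)") (auto simp: serve_def)
    then show ?thesis using E L k di heap_okD(2)[OF hp] al[of y] unfolding CPop4f
      by (auto simp: sm CPop4f has_cell_set_cell has_cell_set_cell_same dest: knownD intro!: W[where g' = "G t" and h' = "[]"])
  next
    case CPop4g
    obtain x y g where g: "G t = x # y # g" using L(5) CPop4g by (cases "G t"; cases "tl (G t)") (auto simp: serve_def)
    then show ?thesis using E L k di heap_okD(2)[OF hp] al[of y] unfolding CPop4g
      by (auto simp: sm CPop4g has_cell_set_cell has_cell_set_cell_same dest: knownD intro!: W[where g' = "G t" and h' = "[]"])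
  next
    case CPop4h
    show ?thesis using E L hc unfolding CPop4h
      by (auto simp: sm CPop4h split: if_splits intro!: R)
  next
    case CPop4i
    show ?thesis using E L k path_next[of ?m "vMOp ?l" "G t"] unfolding CPop4i
      by (auto simp: sm CPop4i split: if_splits intro!: R)
  next
    case CPop4j
    obtain x y g where g: "G t = x # y # g" using L(5) CPop4j by (cases "G t"; cases "tl (G t)") (auto simp: serve_def)
    have "same_op ?m (vMOp ?l) (x # g)" using L(5) CPop4j g by (auto simp: serve_def intro: same_op_sub)
    with g show ?thesis using E L k di al[of y] al[of x] unfolding CPop4j
      by (auto simp: sm CPop4j has_cell_def known_def mops_set_mop intro!: W[where g' = "x # g" and h' = "[]"])
  next
    case CPop4k
    show ?thesis using E L k unfolding CPop4k
      by (auto simp: sm CPop4k split: if_splits intro!: R)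
  next
    case CPop4l
    have "known ?m (tM ?l)" using L(5) CPop4l by (auto simp: unlink_def known_def)
    then show ?thesis using E L unfolding CPop4l
      by (auto simp: sm CPop4l split: if_splits intro!: R)
  next
    case CPop4m
    obtain x g where g: "G t = x # g" using L(5) CPop4m by (cases "G t") (auto simp: unlink_def)
    have xm: "vMOp ?l = Some x" using k L(5) CPop4m g by (auto simp: unlink_def known_def)
    show ?thesis using E L k xm g di al[of x] unfolding CPop4m
      by (auto simp: sm CPop4m known_def mops_set_mop intro!: W[where g' = "x # g" and h' = "[]"])
  qed
qed

lemma push_preserves:
  fixes c :: "'d config"
  assumes I: "Inv c ow G H" and q: "ctl c t = CMultiPush p"
    and E: "((q', l'), m') \<in> push_code p (lcl c t) (mem c)"
  shows "preserved c ow G H t (thread_upd c t q' l' m')"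
proof -
  let ?m = "mem c" and ?l = "lcl c t"
  have L: "base ?m t (vMOp ?l) (invoked ?l)" "location ?m t = None" "H t = []" "invoked ?l \<noteq> Pop"
      "push_inv ?m t p ?l ow (G t)"
    using InvD(2)[OF I, of t] q by auto
  obtain d where d: "invoked ?l = Push d" using L(4) by (cases "invoked ?l") auto
  have hp: "heap_ok ?m" by (rule InvD(1)[OF I])
  have k: "known ?m (vMOp ?l)" by (rule base_known[OF L(1)])
  have al: "known ?m (Some x)" "owned ow t x" if "x \<in> set (G t)" for x
    using InvD(4)[OF I, of x t] that by (auto simp: known_def owned_def)
  have di: "distinct (G t)" using InvD(3)[OF I, of t] by simp
  note R = own_read[OF I] and W = own_write[OF I _ refl]
  note sm = q d load_def read_mop_known read_cell_present op_return_def cell_present_iff write_mop_known serve_def beyond_def unlink_def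
  have la: "known ?m (Some (last (G t))) \<and> op_of ?m (last (G t)) = PUSH" if "lead ?m t ow (vMOp ?l) (G t)"
  proof -
    have "last (G t) \<in> set (G t)" "same_op ?m (vMOp ?l) (G t)" using that by (auto simp: lead_def lead0_def)
    moreover have "op_of ?m (the (vMOp ?l)) = PUSH" using L(1) d by (simp add: base_def)
    ultimately show ?thesis using al(1) unfolding same_op_def by metis
  qed
  show ?thesis
  proof (cases p)
    case CPush1
    show ?thesis using E L heap_okD(1)[OF hp] unfolding CPush1
      by (auto simp: sm CPush1 split: if_splits intro!: R)
  next
    case CPush2a
    show ?thesis using E L k unfolding CPush2a
      by (auto simp: sm CPush2a lead_def split: if_splits intro!: R)
  next
    case CPush2b
    show ?thesis using E L la heap_okD(3,5)[OF hp, of "Some (last (G t))"] unfolding CPush2b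
      by (auto simp: sm CPush2b split: if_splits intro!: R)
  next
    case CPush2c
    show ?thesis using E L unfolding CPush2c
      by (auto simp: sm(1-2) CPush2c write_cell_present intro!: own_cell[OF I])
  next
    case CPush3a
    show ?thesis using E L k heap_okD(3)[OF hp, of "vMOp ?l"] unfolding CPush3a
      by (auto simp: sm CPush3a split: if_splits intro!: R)
  next
    case CPush3b
    show ?thesis using E L unfolding CPush3b
      by (auto simp: sm CPush3b cas_def lead_def lead0_def exposed_def split: if_splits intro!: R own_central[OF I])
  next
    case CPush4a
    note e = E L k path_next[of ?m "vMOp ?l" "G t"]
    show ?thesis
    proof (cases "tl (G t) = []")
      case True
      then show ?thesis using e unfolding CPush4a by (auto simp: sm CPush4a intro!: own_exit[OF I])
    next
      case False
      then show ?thesis using e unfolding CPush4a by (auto simp: sm CPush4a intro!: R)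
    qed
  next
    case CPush4b
    show ?thesis using E L k path_next[of ?m "vMOp ?l" "G t"] unfolding CPush4b
      by (auto simp: sm CPush4b split: if_splits intro!: R)
  next
    case CPush4c
    obtain x y g where g: "G t = x # y # g" using L(5) CPush4c by (cases "G t"; cases "tl (G t)") (auto simp: serve_def)
    have so: "same_op ?m (vMOp ?l) (G t)" using L(5) CPush4c by (simp add: serve_def)
    then have "op_of ?m y = op_of ?m (the (vMOp ?l))" unfolding same_op_def g by (meson list.set_intros)
    then have "op_of ?m y = PUSH" using L(1) d by (simp add: base_def)
    \<comment> \<open>FINISHED demands a cell, which here comes from the record being a
      push.\<close>
    then have cy: "cell_of ?m y \<noteq> None" using heap_okD(5)[OF hp, of "Some y"] al[of y] g by simp
    have "same_op ?m (vMOp ?l) (x # g)" by (rule same_op_sub[OF so]) (auto simp: g)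
    with g show ?thesis using E L k di al[of y] al[of x] cy unfolding CPush4c
      by (auto simp: sm CPush4c has_cell_def known_def mops_set_mop intro!: W[where g' = "x # g" and h' = "[]"])
  next
    case CPush4d
    show ?thesis using E L k unfolding CPush4d
      by (auto simp: sm CPush4d split: if_splits intro!: R)
  next
    case CPush4e
    have "known ?m (tM ?l)" using L(5) CPush4e by (auto simp: unlink_def known_def)
    then show ?thesis using E L unfolding CPush4e
      by (auto simp: sm CPush4e split: if_splits intro!: R)
  next
    case CPush4f
    obtain x g where g: "G t = x # g" using L(5) CPush4f by (cases "G t") (auto simp: unlink_def)
    have xm: "vMOp ?l = Some x" using k L(5) CPush4f g by (auto simp: unlink_def known_def)
    show ?thesis using E L k xm g di al[of x] unfolding CPush4f
      by (auto simp: sm CPush4f known_def mops_set_mop intro!: W[where g' = "x # g" and h' = "[]"])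
  qed
qed

lemma put_location_simps [simp]:
  "mops (put_location t p m) = mops m" "cells (put_location t p m) = cells m"
  "centralStack (put_location t p m) = centralStack m" "collision (put_location t p m) = collision m"
  "location (put_location t p m) u = (if u = t then p else location m u)"
  by (simp_all add: put_location_def)

lemma put_location_inv [simp]:
  "path (put_location t p m) v g = path m v g" "same_op (put_location t p m) v g = same_op m v g"
  "base (put_location t p m) u v i = base m u v i" "lead (put_location t p m) u ow v g = lead m u ow v g"
  "wait_list (put_location t p m) u ow v g = wait_list m u ow v g" "captured (put_location t p m) u ow v a g = captured m u ow v a g"
  "other (put_location t p m) u w = other m u w" "partner (put_location t p m) a v = partner m a v"
proof -
  show p: "path (put_location t p m) v g = path m v g" for v g by (rule path_cong) simp
  show s: "same_op (put_location t p m) v g = same_op m v g" for v g by (simp add: same_op_def)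
  show "base (put_location t p m) u v i = base m u v i" "lead (put_location t p m) u ow v g = lead m u ow v g"
    "other (put_location t p m) u w = other m u w" "partner (put_location t p m) a v = partner m a v"
    by (simp_all add: base_def lead_def lead0_def p s other_def partner_def)
  show w: "wait_list (put_location t p m) u ow v g = wait_list m u ow v g" by (simp add: wait_list_def p s)
  show "captured (put_location t p m) u ow v a g = captured m u ow v a g" by (simp add: captured_def w)
qed

lemma own_location:
  fixes c :: "'d config"
  assumes I: "Inv c ow G H" and p: "p \<noteq> None \<Longrightarrow> known (mem c) p"
    and L: "local_inv (put_location t p (mem c)) t q' l' ow (G t) (H t)"
    and v: "vMOp l' = vMOp (lcl c t)"
    and x: "vPInf l' = vPInf (lcl c t) \<or> H t = [] \<and> same_op (mem c) (vMOp (lcl c t)) (G t)"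
    and w: "waiting (put_location t p (mem c)) t q' l' = waiting (mem c) t (ctl c t) (lcl c t)"
    and s: "\<not> settled (ctl c t)"
  shows "preserved c ow G H t (thread_upd c t q' l' (put_location t p (mem c)))"
proof (rule own_step[OF I refl refl refl _ _ L InvD(3)[OF I] _ v _ _ _ disjI1[OF w]])
  show "heap_ok (put_location t p (mem c))"
    using InvD(1)[OF I] p unfolding heap_ok_def known_def cell_ok_def by auto
  show "frame (mem c) (put_location t p (mem c)) ow ow u" if "u \<noteq> t" for u
    using that by (simp add: frame_def)
  show "exempt (mem c) (lcl c t) y \<Longrightarrow> exempt (put_location t p (mem c)) l' y"
    if "y \<in> set (G t) \<union> set (H t)" for y
    using x v that by (auto simp: exempt_def same_op_def)
qed (use s in auto)

lemma exposed_simps [simp]: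
  "exposed m u (l\<lparr>vIndex := a\<rparr>) ow g = exposed m u l ow g" "exposed m u (l\<lparr>vHim := b\<rparr>) ow g = exposed m u l ow g"
  "exposed m u (l\<lparr>vOInfo := d\<rparr>) ow g = exposed m u l ow g" "exposed m u (l\<lparr>vDelay := e\<rparr>) ow g = exposed m u l ow g"
  by (simp_all add: exposed_def)

text \<open>The record of a capturing thread carries a foreign id, so an entry that still holds the
  own record excludes the captured case.\<close>

lemma exposed_free:
  assumes "exposed m u l ow g" "base m u (vMOp l) i" "location m u = vMOp l"
  shows "lead m u ow (vMOp l) g"
  using assms unfolding exposed_def captured_def base_def by auto

lemma exposed_captured:
  assumes "exposed m u l ow g" "location m u \<noteq> vMOp l"
  shows "captured m u ow (vMOp l) (location m u) g"
  using assms unfolding exposed_def by auto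

lemma lead_same_op: "lead m u ow v g \<Longrightarrow> same_op m v g"
  by (simp add: lead_def lead0_def)

lemma wait_list_same_op: "wait_list m u ow v g \<Longrightarrow> same_op m v g"
  by (auto simp: wait_list_def split: if_splits)

lemma captured_same_op: "captured m u ow v a g \<Longrightarrow> same_op m v g"
  by (auto simp: captured_def wait_list_same_op split: if_splits)

lemma partner_self [simp]: "\<not> partner m v v"
  by (simp add: partner_def)

lemma heap_ok_put_collision: "heap_ok m \<Longrightarrow> heap_ok (put_collision i v m)"
  unfolding heap_ok_def put_collision_def cell_ok_def by simp

lemma own_collision:
  fixes c :: "'d config"
  assumes I: "Inv c ow G H"
    and "local_inv (mem c) t q' (lcl c t) ow (G t) (H t)"
    and "waiting (mem c) t q' (lcl c t) = waiting (mem c) t (ctl c t) (lcl c t)"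
    and "\<not> settled (ctl c t)"
  shows "preserved c ow G H t (thread_upd c t q' (lcl c t) (put_collision i p (mem c)))"
  by (rule own_other[OF I]) (use assms(2-) heap_ok_put_collision[OF InvD(1)[OF I]] in \<open>auto simp: put_collision_def\<close>)

text \<open>The CAS on the own entry decides which case of \<open>exposed\<close> holds: success
  proves that the thread still leads its list, and withdraws the entry; failure proves the
  capture.\<close>

lemma collide_preserves:
  fixes c :: "'d config"
  assumes I: "Inv c ow G H" and q: "ctl c t = Collide p"
    and E: "((q', l'), m') \<in> collide_code N t p (lcl c t) (mem c)"
  shows "preserved c ow G H t (thread_upd c t q' l' m')"
proof -
  let ?m = "mem c" and ?l = "lcl c t"
  have L: "base ?m t (vMOp ?l) (invoked ?l)" "H t = []" "collide_inv ?m t p ?l ow (G t)"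
    using InvD(2)[OF I, of t] q by auto
  have hp: "heap_ok ?m" by (rule InvD(1)[OF I])
  have k: "known ?m (vMOp ?l)" by (rule base_known[OF L(1)])
  have kl: "location ?m u \<noteq> None \<Longrightarrow> known ?m (location ?m u)" for u
    using hp by (auto simp: heap_ok_def known_def)
  note R = own_read[OF I]
  note sm = q load_def read_mop_known store_def pick_def cas_def
  show ?thesis
  proof (cases p)
    case Col1a
    show ?thesis using E L k unfolding Col1a
      by (auto simp: sm Col1a exposed_def intro!: own_location[OF I])
  next
    case Col1b
    show ?thesis using E L unfolding Col1b
      by (auto simp: sm Col1b intro!: R)
  next
    case Col2a
    show ?thesis using E L unfolding Col2a
      by (auto simp: sm Col2a intro!: R)
  next
    case Col2b
    show ?thesis using E L unfolding Col2b
      by (auto simp: sm Col2b split: if_splits intro!: R own_collision[OF I])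
  next
    case Col3a
    show ?thesis using E L kl[of "the (vHim ?l)"] unfolding Col3a
      by (auto simp: sm Col3a split: if_splits intro!: R)
  next
    case Col3b
    then have ko: "known ?m (vOInfo ?l)" using L(3) by simp
    have e: "l' = ?l" "m' = ?m" "q' = Collide Col4a \<or> id_of ?m (the (vOInfo ?l)) \<noteq> t \<and> q' = Collide Col3c"
      using E ko unfolding Col3b by (simp_all add: read_mop_known split: if_splits)
    from e(3) show ?thesis using L ko unfolding e(1,2)
      by (auto simp: q Col3b other_def known_def intro!: R)
  next
    case Col3c
    have "known ?m (vOInfo ?l)" using L(3) Col3c by (simp add: other_def known_def)
    then show ?thesis using E L unfolding Col3c
      by (auto simp: sm Col3c split: if_splits intro!: R)
  next
    case Col3d
    show ?thesis
    proof (cases "location ?m t = vMOp ?l")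
      case True
      with exposed_free[OF _ L(1)] L(3) Col3d have "lead ?m t ow (vMOp ?l) (G t)" by simp
      then show ?thesis using E L True lead_same_op unfolding Col3d
        by (auto simp: sm Col3d call_active_def intro!: own_location[OF I])
    next
      case False
      with exposed_captured[OF _ False] L(3) Col3d have "captured ?m t ow (vMOp ?l) (location ?m t) (G t)" by simp
      then show ?thesis using E L False captured_same_op unfolding Col3d
        by (auto simp: sm Col3d call_passive_def intro!: R)
    qed
  next
    case Col4a
    show ?thesis using E L unfolding Col4a
      by (auto simp: sm Col4a intro!: R)
  next
    case Col4b
    show ?thesis using E L unfolding Col4b
      by (auto simp: sm Col4b split: if_splits intro!: R)
  next
    case Col4c
    show ?thesis
    proof (cases "location ?m t = vMOp ?l")
      case True
      with exposed_free[OF _ L(1)] L(3) Col4c have "lead ?m t ow (vMOp ?l) (G t)" by simp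
      then show ?thesis using E L True lead_same_op unfolding Col4c
        by (cases "invoked ?l") (auto simp: sm Col4c collide_return_def loop_body_def intro!: own_location[OF I])
    next
      case False
      with exposed_captured[OF _ False] L(3) Col4c have "captured ?m t ow (vMOp ?l) (location ?m t) (G t)" by simp
      then show ?thesis using E L False captured_same_op unfolding Col4c
        by (auto simp: sm Col4c call_passive_def intro!: R)
    qed
  qed
qed

lemma passive_preserves:
  fixes c :: "'d config"
  assumes I: "Inv c ow G H" and q: "ctl c t = PassiveCollide p"
    and E: "((q', l'), m') \<in> passive_code p (lcl c t) (mem c)"
  shows "preserved c ow G H t (thread_upd c t q' l' m')"
proof -
  let ?m = "mem c" and ?l = "lcl c t"
  have L: "base ?m t (vMOp ?l) (invoked ?l)" "H t = []" "passive_inv ?m t p ?l ow (G t)"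
    using InvD(2)[OF I, of t] q by auto
  have hp: "heap_ok ?m" by (rule InvD(1)[OF I])
  have k: "known ?m (vMOp ?l)" by (rule base_known[OF L(1)])
  have id: "id_of ?m (the (vMOp ?l)) = t" using L(1) by (simp add: base_def)
  have op: "op_of ?m (the (vMOp ?l)) = kind_of (invoked ?l)" using L(1) by (simp add: base_def)
  note R = own_read[OF I] and W = own_write[OF I _ refl]
  note sm = q load_def read_mop_known store_def write_mop_known
  show ?thesis
  proof (cases p)
    case Pas1a
    show ?thesis using E L k unfolding Pas1a
      by (auto simp: sm Pas1a intro!: R)
  next
    case Pas1b
    show ?thesis using E L unfolding Pas1b
      by (auto simp: sm Pas1b id intro!: R)
  next
    case Pas2a
    show ?thesis using E L k unfolding Pas2a
      by (auto simp: sm Pas2a intro!: R)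
  next
    case Pas2b
    show ?thesis using E L unfolding Pas2b
      by (auto simp: sm Pas2b id intro!: own_location[OF I])
  next
    case Pas3a
    show ?thesis using E L k unfolding Pas3a
      by (auto simp: sm Pas3a intro!: R)
  next
    case Pas3b
    \<comment> \<open>The ids differ, so the inequality of the records in \<open>partner\<close> is
      automatic and only the comparison of the operations decides about waiting.\<close>
    have ka: "known ?m (vAInf ?l)" "vAInf ?l \<noteq> vMOp ?l"
      using L(3) id Pas3b by (auto simp: captured_def known_def)
    then show ?thesis using E L unfolding Pas3b
      by (auto simp: sm Pas3b captured_def known_def partner_def split: if_splits intro!: R)
  next
    case Pas4a
    have "k \<noteq> POP \<Longrightarrow> k = PUSH" for k by (cases k) auto
    then show ?thesis using E L k op unfolding Pas4a
      by (cases "invoked ?l") (auto simp: sm Pas4a collide_return_def op_return_def split: if_splits intro!: R)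
  next
    case Pas4b
    show ?thesis using E L heap_okD(3,5)[OF hp, of "vAInf ?l"] unfolding Pas4b
      by (auto simp: sm Pas4b cell_present_iff intro!: R)
  next
    case Pas4c
    show ?thesis using E L k unfolding Pas4c
      by (cases "invoked ?l") (auto simp: sm Pas4c cell_present_iff collide_return_def op_return_def has_cell_set_cell_same
          dest: knownD intro!: W[where g' = "[]" and h' = "[]"])
  next
    case Pas5
    \<comment> \<open>A waiting record that its thread does not own is INIT or FINISHED by the last
      clause of \<open>Inv\<close>. Leaving the await therefore means FINISHED, or ownership and
      hence RETRY.\<close>
    have "owned ow t (the (vMOp ?l)) \<or> status_of ?m (the (vMOp ?l)) = FINISHED" if "status_of ?m (the (vMOp ?l)) \<noteq> INIT"
      using InvD(6)[OF I, of t "the (vMOp ?l)"] that k q Pas5 unfolding owned_def known_def by auto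
    then show ?thesis using E L k unfolding Pas5
      by (auto simp: sm Pas5 split: if_splits intro!: R)
  next
    case Pas6a
    have "has_cell ?m (vMOp ?l)" if "status_of ?m (the (vMOp ?l)) = FINISHED"
      using hp k that unfolding heap_ok_def has_cell_def known_def by auto
    then show ?thesis using E L k unfolding Pas6a
      by (cases "invoked ?l")
         (auto simp: sm Pas6a collide_return_def op_return_def wait_list_def split: if_splits intro!: R)
  next
    case Pas6b
    have di: "distinct (G t)" using InvD(3)[OF I, of t] by simp
    \<comment> \<open>Resetting the status turns an owned \<open>wait_list\<close> into
      \<open>lead\<close>: the thread resumes as leader of the list handed over to it.\<close>
    show ?thesis using E L k di unfolding Pas6b
      by (cases "invoked ?l")
         (auto simp: sm Pas6b collide_return_def loop_body_def wait_list_def lead_def lead0_def known_def mops_set_mop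
           intro!: W[where g' = "G t" and h' = "[]"])
  qed
qed

lemma combining_simps [simp]:
  "combining m u (l\<lparr>tC := a\<rparr>) ow g h = combining m u l ow g h" "combining m u (l\<lparr>tC' := a\<rparr>) ow g h = combining m u l ow g h"
  "combining m u (l\<lparr>tM := d\<rparr>) ow g h = combining m u l ow g h"
  by (simp_all add: combining_def)

lemma grab_hd: "grab m u ow p h \<Longrightarrow> h \<noteq> [] \<and> p = Some (hd h)"
  unfolding grab_def using path_hd by blast

text \<open>The successful CAS is excluded because it moves the partner's list to another owner; it
  is treated in \<open>capture_preserves\<close>.\<close>

lemma active_preserves:
  fixes c :: "'d config"
  assumes I: "Inv c ow G H" and q: "ctl c t = ActiveCollide p"
    and E: "((q', l'), m') \<in> active_code p (lcl c t) (mem c)"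
    and n: "\<not> (p = Act1b \<and> location (mem c) (tId (lcl c t)) = vPInf (lcl c t))"
  shows "preserved c ow G H t (thread_upd c t q' l' m')"
proof -
  let ?m = "mem c" and ?l = "lcl c t"
  have L: "base ?m t (vMOp ?l) (invoked ?l)" "location ?m t = None" "active_inv ?m t p ?l ow (G t) (H t)"
    using InvD(2)[OF I, of t] q by auto
  have k: "known ?m (vMOp ?l)" by (rule base_known[OF L(1)])
  have al: "known ?m (Some x)" "owned ow t x" if "x \<in> set (G t) \<union> set (H t)" for x
    using InvD(4)[OF I, of x t] that by (auto simp: known_def owned_def)
  have di: "distinct (G t)" "distinct (H t)" using InvD(3)[OF I, of t] by simp_all
  have kp: "known ?m (vPInf ?l) \<and> owned ow t (the (vPInf ?l)) \<and> H t \<noteq> [] \<and> vPInf ?l = Some (hd (H t)) \<and> hd (H t) \<notin> set (tl (H t))"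
    if "grab ?m t ow (vPInf ?l) (H t)"
    using grab_hd[OF that] al[of "hd (H t)"] di(2) by (cases "H t") auto
  have hg: "hd (G t) = the (vMOp ?l) \<and> the (vMOp ?l) \<notin> set (tl (G t)) \<and> G t \<noteq> []" if "lead ?m t ow (vMOp ?l) (G t)"
  proof -
    have "path ?m (vMOp ?l) (G t) \<and> G t \<noteq> []" using that by (simp add: lead_def lead0_def)
    with di(1) show ?thesis by (cases "G t") auto
  qed
  note R = own_read[OF I]
  note sm = q read_mop_known cas_def
  show ?thesis
  proof (cases p)
    case Act1a
    have "known ?m (vPInf ?l)" using L(3) Act1a by (simp add: other_def known_def)
    then show ?thesis using E L unfolding Act1a
      by (auto simp: sm Act1a intro!: R)
  next
    case Act1b
    show ?thesis using E L n unfolding Act1b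
      by (cases "invoked ?l") (auto simp: sm Act1b collide_return_def loop_body_def split: if_splits intro!: R)
  next
    case Act2a
    show ?thesis using E L k unfolding Act2a
      by (auto simp: sm Act2a intro!: R)
  next
    case Act2b
    note g = kp hg
    show ?thesis
    proof (cases "op_of ?m (the (vPInf ?l)) = op_of ?m (the (vMOp ?l))")
      case True
      then show ?thesis using E L g unfolding Act2b
        by (auto simp: sm Act2b combining_def intro!: R)
    next
      case False
      have e: "q' = MultiEliminate Eli1a" "l' = ?l\<lparr>vACurr := vMOp ?l, vPCurr := vPInf ?l\<rparr>" "m' = ?m"
        using E L g False unfolding Act2b by (auto simp: sm)
      have "matching ?m t l' ow (G t) (H t)"
      proof -
        have l: "lead ?m t ow (vMOp ?l) (G t)" and gr: "grab ?m t ow (vPInf ?l) (H t)"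
          using L(3) Act2b by auto
        note kp[OF gr, THEN conjunct1] kp[OF gr, THEN conjunct2, THEN conjunct1] kp[OF gr, THEN conjunct2, THEN conjunct2]
        moreover have "path ?m (vPInf ?l) (H t)" "last_of ?m (the (vPInf ?l)) = Some (last (H t))" "same_op ?m (vPInf ?l) (H t)"
          using gr by (auto simp: grab_def)
        ultimately show ?thesis
          using l hg[OF l] False unfolding e matching_def elim0_def lead_def lead0_def known_def by simp
      qed
      then show ?thesis using L unfolding e
        by (auto simp: sm Act2b intro!: R)
    qed
  qed
qed

text \<open>Distinctness of \<open>g\<close>, and the last record of \<open>g\<close> not being in
  \<open>h\<close>, ensure that the store changes no other link of the joined list.\<close>

lemma path_append:
  assumes "path m p g" "g \<noteq> []" "distinct g" "last g \<notin> set h" "path m r h"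
  shows "path (set_mop (last g) (m_next_update (\<lambda>_. r)) m) p (g @ h)"
  using assms
proof (induction g arbitrary: p)
  case (Cons x g)
  show ?case
  proof (cases "g = []")
    case True
    then show ?thesis using Cons.prems by (simp add: mops_set_mop)
  next
    case False
    then have "x \<noteq> last g" using Cons.prems(3) by auto
    then show ?thesis using Cons False by (simp add: mops_set_mop)
  qed
qed simp

lemma combine_preserves:
  fixes c :: "'d config"
  assumes I: "Inv c ow G H" and q: "ctl c t = Combine p"
    and E: "((q', l'), m') \<in> combine_code p (lcl c t) (mem c)"
  shows "preserved c ow G H t (thread_upd c t q' l' m')"
proof -
  let ?m = "mem c" and ?l = "lcl c t"
  have L: "base ?m t (vMOp ?l) (invoked ?l)" "location ?m t = None" "vAInf ?l = vMOp ?l" "combine_inv ?m t p ?l ow (G t) (H t)"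
    using InvD(2)[OF I, of t] q by auto
  have hp: "heap_ok ?m" by (rule InvD(1)[OF I])
  have k: "known ?m (vMOp ?l)" by (rule base_known[OF L(1)])
  have al: "known ?m (Some x)" "owned ow t x" if "x \<in> set (G t) \<union> set (H t)" for x
    using InvD(4)[OF I, of x t] that by (auto simp: known_def owned_def)
  have di: "distinct (G t @ H t)" using InvD(3)[OF I, of t] .
  have lg: "known ?m (Some (last (G t))) \<and> owned ow t (last (G t)) \<and>
      op_of ?m (last (G t)) = op_of ?m (the (vMOp ?l))" if "combining ?m t ?l ow (G t) (H t)"
  proof -
    have "last (G t) \<in> set (G t)" "same_op ?m (vMOp ?l) (G t)"
      using that by (auto simp: combining_def lead_def lead0_def)
    then show ?thesis using al unfolding same_op_def by blast
  qed
  have kp: "known ?m (vPInf ?l)" if "combining ?m t ?l ow (G t) (H t)"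
    using grab_hd[of ?m t ow "vPInf ?l" "H t"] that al[of "hd (H t)"] unfolding combining_def by (cases "H t") auto
  note R = own_read[OF I] and W = own_write[OF I _ refl]
  note sm = q L(3) read_mop_known write_mop_known
  show ?thesis
  proof (cases p)
    case Com1a
    show ?thesis using E L k unfolding Com1a
      by (auto simp: sm Com1a split: if_splits intro!: R)
  next
    case Com1b
    show ?thesis using E L k unfolding Com1b
      by (auto simp: sm Com1b combining_def lead_def intro!: R)
  next
    case Com1c
    then have "known ?m (tM ?l)" "cell_present ?m (cell_of ?m (the (tM ?l)))"
      using L(4) lg heap_okD(3,5)[OF hp, of "tM ?l"] by (auto simp: cell_present_iff)
    then show ?thesis using E L unfolding Com1c
      by (auto simp: sm Com1c intro!: R)
  next
    case Com1d
    then have "known ?m (vPInf ?l)" "cell_ok ?m (cell_of ?m (the (vPInf ?l)))"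
      using L(4) kp heap_okD(3)[OF hp, of "vPInf ?l"] by auto
    then show ?thesis using E L unfolding Com1d
      by (auto simp: sm Com1d combining_def intro!: R)
  next
    case Com1e
    show ?thesis using E L unfolding Com1e
      by (auto simp: sm Com1e write_cell_present intro!: own_cell[OF I])
  next
    case Com2a
    show ?thesis using E L k unfolding Com2a
      by (auto simp: sm Com2a combining_def lead_def intro!: R)
  next
    case Com2b
    \<comment> \<open>The splice. Both lists have belonged to \<open>t\<close> since the capture, so
      only the division between \<open>G t\<close> and \<open>H t\<close> changes.\<close>
    define m1 where "m1 = set_mop (last (G t)) (m_next_update (\<lambda>_. vPInf ?l)) ?m"
    have C: "combining ?m t ?l ow (G t) (H t)" using L(4) Com2b by simp
    have e: "q' = Combine Com3a" "l' = ?l" "m' = m1"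
      using E L lg[OF C] unfolding Com2b m1_def by (simp_all add: sm)
    have ld: "lead ?m t ow (vMOp ?l) (G t)" and gr: "grab ?m t ow (vPInf ?l) (H t)"
      and op: "op_of ?m (the (vPInf ?l)) = op_of ?m (the (vMOp ?l))" using C by (auto simp: combining_def)
    have ne: "G t \<noteq> []" "H t \<noteq> []" using ld gr by (auto simp: lead_def lead0_def grab_def)
    have "last (G t) \<in> set (G t)" using ne by simp
    then have "last (G t) \<notin> set (H t)" using di by auto
    then have "path m1 (vMOp ?l) (G t @ H t)"
      unfolding m1_def using ld gr di by (intro path_append) (auto simp: lead_def lead0_def grab_def)
    moreover have "same_op ?m (vMOp ?l) (G t @ H t)"
      using ld gr op unfolding lead_def lead0_def grab_def same_op_def by auto
    ultimately have "lead0 m1 t ow (vMOp ?l) (G t @ H t)"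
      using ld ne unfolding lead_def lead0_def m1_def by simp
    moreover have "the (vPInf ?l) \<in> set (G t @ H t)" "last_of m1 (the (vPInf ?l)) = Some (last (G t @ H t))"
      using grab_hd[OF gr] gr ne unfolding m1_def grab_def by auto
    ultimately have "local_inv m1 t (Combine Com3a) ?l ow (G t @ H t) []"
      using L kp[OF C] unfolding m1_def by auto
    then show ?thesis using lg[OF C] di unfolding e m1_def
      by (intro W[where g' = "G t @ H t" and h' = "[]"]) (auto simp: q known_def)
  next
    case Com3a
    show ?thesis using E L unfolding Com3a
      by (auto simp: sm Com3a intro!: R)
  next
    case Com3b
    show ?thesis using E L k di unfolding Com3b
      by (auto simp: sm Com3b lead_def lead0_def known_def mops_set_mop intro!: W[where g' = "G t" and h' = "[]"])
  next
    case Com4a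
    show ?thesis using E L k unfolding Com4a
      by (auto simp: sm Com4a intro!: R)
  next
    case Com4b
    show ?thesis using E L k unfolding Com4b
      by (auto simp: sm Com4b intro!: R)
  next
    case Com4c
    show ?thesis using E L k di unfolding Com4c
      by (cases "invoked ?l") (auto simp: sm Com4c collide_return_def loop_body_def lead_def lead0_def dest: knownD 
         intro!: W[where g' = "G t" and h' = "[]"])
  qed
qed

lemma elim0_set_mop [simp]:
  assumes "elim0 m u ow v p g h"
  shows "elim0 (set_mop x (m_cell_update fa) m) u ow v p g h"
    "elim0 (set_mop x (m_length_update fb) m) u ow v p g h"
    "elim0 (set_mop x (m_cStatus_update fc) m) u ow v p g h"
  using assms by (simp_all add: elim0_def, simp_all add: mops_set_mop)

lemma beyond_set_mop [simp]:
  assumes "beyond m u ow v g"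
  shows "beyond (set_mop x (m_cell_update fa) m) u ow v g"
    "beyond (set_mop x (m_length_update fb) m) u ow v g"
    "beyond (set_mop x (m_cStatus_update fc) m) u ow v g"
  using assms by (simp_all add: beyond_def, simp_all add: mops_set_mop)

lemma matched_simps [simp]:
  "matched m u (l\<lparr>tC := a\<rparr>) ow g h = matched m u l ow g h" "matched m u (l\<lparr>tLen := i\<rparr>) ow g h = matched m u l ow g h"
  "matched m u (l\<lparr>tM := d\<rparr>) ow g h = matched m u l ow g h" "matched m u (l\<lparr>vACurr := d\<rparr>) ow g h = matched m u l ow g h"
  "matched m u (l\<lparr>vPCurr := d\<rparr>) ow g h = matched m u l ow g h"
  "matching m u (l\<lparr>tC := a\<rparr>) ow g h = matching m u l ow g h"
  by (simp_all add: matched_def matching_def)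

lemma matched_set_length [simp]:
  "matched m u l ow g h \<Longrightarrow> matched (set_mop x (m_length_update fb) m) u l ow g h"
  by (simp add: matched_def)

lemma retry_simps [simp]:
  "retry_act m u (l\<lparr>tLen := i\<rparr>) ow g h = retry_act m u l ow g h" "retry_act m u (l\<lparr>tM := d\<rparr>) ow g h = retry_act m u l ow g h"
  "retry_pas m u (l\<lparr>tLen := i\<rparr>) ow g h = retry_pas m u l ow g h" "retry_pas m u (l\<lparr>tM := d\<rparr>) ow g h = retry_pas m u l ow g h"
  by (simp_all add: retry_act_def retry_pas_def)

lemma retry_set_length [simp]:
  "retry_act m u l ow g h \<Longrightarrow> retry_act (set_mop x (m_length_update fb) m) u l ow g h"
  "retry_pas m u l ow g h \<Longrightarrow> retry_pas (set_mop x (m_length_update fb) m) u l ow g h"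
  by (auto simp: retry_act_def retry_pas_def)

lemma elim0_tl:
  "elim0 m u ow v p g h \<Longrightarrow> elim0 m u ow v p (tl g) h"
  "elim0 m u ow v p g h \<Longrightarrow> elim0 m u ow v p g (tl h)"
  unfolding elim0_def by (cases g; cases h; auto simp: same_op_simps)+

lemma elim0_known: "elim0 m u ow v p g h \<Longrightarrow> known m p"
  by (simp add: elim0_def known_def)

text \<open>The stores of RETRY are excluded, as they give the remainder away. Both front records
  must have a cell before FINISHED is stored: the push record has one from the start, and the pop
  record receives it.\<close>

lemma elim_preserves:
  fixes c :: "'d config"
  assumes I: "Inv c ow G H" and q: "ctl c t = MultiEliminate p"
    and E: "((q', l'), m') \<in> elim_code p (lcl c t) (mem c)"
    and n: "p \<noteq> Eli5e" "p \<noteq> Eli6e"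
  shows "preserved c ow G H t (thread_upd c t q' l' m')"
proof -
  let ?m = "mem c" and ?l = "lcl c t"
  let ?g = "G t" and ?h = "H t"
  have L: "base ?m t (vMOp ?l) (invoked ?l)" "location ?m t = None" "vAInf ?l = vMOp ?l"
      "elim_inv ?m t p ?l ow ?g ?h"
    using InvD(2)[OF I, of t] q by auto
  have hp: "heap_ok ?m" by (rule InvD(1)[OF I])
  have k: "known ?m (vMOp ?l)" by (rule base_known[OF L(1)])
  have al: "known ?m (Some x)" "owned ow t x" if "x \<in> set ?g \<union> set ?h" for x
    using InvD(4)[OF I, of x t] that by (auto simp: known_def owned_def)
  have di: "distinct (?g @ ?h)" using InvD(3)[OF I, of t] .
  have pk: "known ?m v" "owned ow t (the v)" "v = Some (hd g)" "path ?m (next_of ?m (hd g)) (tl g)" 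
    if "path ?m v g" "g \<noteq> []" "g = ?g \<or> g = ?h" for v g
    using path_hd[OF that(1,2)] al[of "hd g"] hd_in_set[OF that(2)] that(3) by auto
  have mt: "path ?m (vACurr ?l) ?g" "?g \<noteq> []" "path ?m (vPCurr ?l) ?h" "?h \<noteq> []"
      "op_of ?m (hd ?g) = op_of ?m (the (vMOp ?l))" "op_of ?m (hd ?h) \<noteq> op_of ?m (the (vMOp ?l))"
    if "matching ?m t ?l ow ?g ?h"
    using that hd_in_set[of ?g] hd_in_set[of ?h] unfolding matching_def elim0_def same_op_def by metis+
  have mp: "known ?m (vACurr ?l)" "owned ow t (the (vACurr ?l))" "vACurr ?l = Some (hd ?g)" "path ?m (next_of ?m (hd ?g)) (tl ?g)" 
      "known ?m (vPCurr ?l)" "owned ow t (the (vPCurr ?l))" "vPCurr ?l = Some (hd ?h)" "path ?m (next_of ?m (hd ?h)) (tl ?h)" 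
    if "matching ?m t ?l ow ?g ?h"
    using pk[OF mt(1,2)[OF that]] pk[OF mt(3,4)[OF that]] by blast+
  have kd: "k \<noteq> POP \<Longrightarrow> k = PUSH" for k by (cases k) auto
  have hk: "known ?m v \<Longrightarrow> op_of ?m (the v) = PUSH \<Longrightarrow> cell_present ?m (cell_of ?m (the v))" for v
    using heap_okD(3,5)[OF hp, of v] by (simp add: cell_present_iff)
  note R = own_read[OF I] and W = own_write[OF I _ refl]
  note sm = q L(3) read_mop_known write_mop_known
  show ?thesis
  proof (cases p)
    case Eli1a
    show ?thesis using E L k kd unfolding Eli1a
      by (auto simp: sm Eli1a split: if_splits intro!: R)
  next
    case Eli1b
    then have M: "matching ?m t ?l ow ?g ?h" and op: "op_of ?m (the (vMOp ?l)) = POP" using L(4) by auto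
    have "op_of ?m (the (vPCurr ?l)) = PUSH" using mt(6)[OF M] op mp(7)[OF M] kd by simp
    then show ?thesis using E L mp(5)[OF M] hk[of "vPCurr ?l"] unfolding Eli1b
      by (auto simp: sm Eli1b intro!: R)
  next
    case Eli1c
    then have M: "matching ?m t ?l ow ?g ?h" and op: "op_of ?m (the (vMOp ?l)) = POP" and tc: "cell_present ?m (tC ?l)"
      using L(4) by auto
    let ?m1 = "set_mop (hd ?g) (m_cell_update (\<lambda>_. tC ?l)) ?m"
    have "op_of ?m (hd ?h) = PUSH" using mt(6)[OF M] op kd by simp
    then have c: "cell_of ?m (hd ?h) \<noteq> None" using hk[OF mp(5)[OF M]] mp(7)[OF M] by (simp add: cell_present_iff)
    have e: "q' = MultiEliminate Eli2a" "l' = ?l" "m' = ?m1"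
      using E mp(1)[OF M] mp(3)[OF M] unfolding Eli1c by (simp_all add: sm)
    have t: "tC ?l \<noteq> None" using tc by (simp add: cell_present_iff)
    have "matching ?m1 t ?l ow ?g ?h" "has_cell ?m1 (vMOp ?l)" "has_cell ?m1 (Some (hd ?g))" "has_cell ?m1 (Some (hd ?h))"
      using M t c unfolding matching_def by (auto simp: has_cell_set_cell has_cell_set_cell_same has_cell_def mops_set_mop)
    then show ?thesis using L(1-3) tc mp(1-3)[OF M] di unfolding e
      by (intro W[where g' = "?g" and h' = "?h"]) (auto simp: q Eli1c cell_present_iff known_def)
  next
    case Eli1d
    then have M: "matching ?m t ?l ow ?g ?h" and op: "op_of ?m (the (vMOp ?l)) = PUSH" using L(4) by auto
    have "op_of ?m (the (vACurr ?l)) = PUSH" using mt(5)[OF M] op mp(3)[OF M] by simp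
    then show ?thesis using E L mp(1)[OF M] hk[of "vACurr ?l"] unfolding Eli1d
      by (auto simp: sm Eli1d intro!: R)
  next
    case Eli1e
    then have M: "matching ?m t ?l ow ?g ?h" and op: "op_of ?m (the (vMOp ?l)) = PUSH" and tc: "cell_present ?m (tC ?l)"
      using L(4) by auto
    let ?m1 = "set_mop (hd ?h) (m_cell_update (\<lambda>_. tC ?l)) ?m"
    have "cell_of ?m (hd ?g) \<noteq> None" "cell_of ?m (the (vMOp ?l)) \<noteq> None"
      using mt(5)[OF M] op hk[OF mp(1)[OF M]] mp(3)[OF M] hk[OF k] by (auto simp: cell_present_iff)
    then have c: "has_cell ?m (Some (hd ?g))" "has_cell ?m (vMOp ?l)" by (simp_all add: has_cell_def)
    have e: "q' = MultiEliminate Eli2a" "l' = ?l" "m' = ?m1"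
      using E mp(5)[OF M] mp(7)[OF M] unfolding Eli1e by (simp_all add: sm)
    have t: "tC ?l \<noteq> None" using tc by (simp add: cell_present_iff)
    have "matching ?m1 t ?l ow ?g ?h" "has_cell ?m1 (vMOp ?l)" "has_cell ?m1 (Some (hd ?g))" "has_cell ?m1 (Some (hd ?h))"
      using M c has_cell_set_cell[OF t] has_cell_set_cell_same[OF t, of "hd ?h" "Some (hd ?h)"] unfolding matching_def by auto
    then show ?thesis using L(1-3) tc mp(5-7)[OF M] di unfolding e
      by (intro W[where g' = "?g" and h' = "?h"]) (auto simp: q Eli1e cell_present_iff known_def)
  next
    case Eli2a
    then have M: "matching ?m t ?l ow ?g ?h" and c: "has_cell ?m (vMOp ?l)" "has_cell ?m (Some (hd ?g))" "has_cell ?m (Some (hd ?h))"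
      using L(4) by auto
    have e: "q' = MultiEliminate Eli2b" "l' = ?l" "m' = set_mop (hd ?g) (m_cStatus_update (\<lambda>_. FINISHED)) ?m"
      using E mp(1)[OF M] mp(3)[OF M] unfolding Eli2a by (simp_all add: sm)
    \<comment> \<open>The front record leaves the list with this store, although the cursor still
      points to it.\<close>
    have "beyond ?m t ow (vACurr ?l) (tl ?g)" using mp(1-4)[OF M] by (auto simp: beyond_def known_def)
    moreover have "elim0 ?m t ow (vMOp ?l) (vPInf ?l) (tl ?g) ?h" "path ?m (vPCurr ?l) ?h" "?h \<noteq> []"
      "the (vMOp ?l) \<notin> set (tl ?g)" "the (vPInf ?l) \<notin> set (tl ?h)"
      using M elim0_tl(1) by (auto simp: matching_def)
    moreover obtain x g where "?g = x # g" using mt(2)[OF M] by (cases ?g) auto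
    ultimately show ?thesis using L(1-3) c mp(1-3)[OF M] di unfolding e
      by (intro W[where g' = "tl ?g" and h' = "?h"]) (auto simp: q Eli2a known_def has_cell_def)
  next
    case Eli2b
    then have M: "elim0 ?m t ow (vMOp ?l) (vPInf ?l) ?g ?h" "beyond ?m t ow (vACurr ?l) ?g" 
      "the (vMOp ?l) \<notin> set ?g" "the (vPInf ?l) \<notin> set (tl ?h)" "has_cell ?m (vMOp ?l)" "has_cell ?m (Some (hd ?h))"
      and ph: "path ?m (vPCurr ?l) ?h" "?h \<noteq> []"
      using L(4) by auto
    note hp = pk[OF ph disjI2[OF refl]]
    have e: "q' = MultiEliminate Eli3a" "l' = ?l" "m' = set_mop (hd ?h) (m_cStatus_update (\<lambda>_. FINISHED)) ?m"
      using E hp(1,3) unfolding Eli2b by (simp_all add: sm)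
    have "beyond ?m t ow (vPCurr ?l) (tl ?h)" using hp by (auto simp: beyond_def known_def)
    moreover have "elim0 ?m t ow (vMOp ?l) (vPInf ?l) ?g (tl ?h)" by (rule elim0_tl(2)[OF M(1)])
    moreover obtain x h where "?h = x # h" using ph by (cases ?h) auto
    ultimately show ?thesis using L(1-3) M hp(1-3) di unfolding e
      by (intro W[where g' = "?g" and h' = "tl ?h"]) (auto simp: q Eli2b matched_def known_def has_cell_def)
  next
    case Eli3a
    show ?thesis using E L k unfolding Eli3a
      by (auto simp: sm Eli3a intro!: R)
  next
    case Eli3b
    show ?thesis using E L k di unfolding Eli3b
      by (auto simp: sm Eli3b dest: knownD intro!: W[where g' = "?g" and h' = "?h"])
  next
    case Eli3c
    have "known ?m (vPInf ?l)" using L(4) Eli3c elim0_known by (auto simp: matched_def)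
    then show ?thesis using E L unfolding Eli3c
      by (auto simp: sm Eli3c intro!: R)
  next
    case Eli3d
    have "known ?m (vPInf ?l)" using L(4) Eli3d elim0_known by (auto simp: matched_def)
    then show ?thesis using E L di unfolding Eli3d
      by (auto simp: sm Eli3d dest: knownD intro!: W[where g' = "?g" and h' = "?h"])
  next
    case Eli4a
    have "known ?m (vACurr ?l)" using L(4) Eli4a by (auto simp: beyond_def known_def)
    then show ?thesis using E L unfolding Eli4a
      by (auto simp: sm Eli4a beyond_def intro!: R)
  next
    case Eli4b
    have ka: "known ?m (vPCurr ?l)" using L(4) Eli4b by (auto simp: beyond_def known_def)
    define v where "v = next_of ?m (the (vPCurr ?l))"
    have e: "(q', l') = elim_continue (?l\<lparr>vPCurr := v\<rparr>)" "m' = ?m"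
      using E ka unfolding Eli4b v_def by (simp_all add: sm)
    have M: "matched ?m t ?l ow ?g ?h" "path ?m (vACurr ?l) ?g" "path ?m v ?h"
      using L(4) Eli4b by (simp_all add: beyond_def v_def)
    \<comment> \<open>So the null tests on the cursors are tests for emptiness of the ghost
      lists.\<close>
    have "p = None \<longleftrightarrow> g = []" if "path ?m p g" for p g
      using that by (cases g) auto
    then have N: "vACurr ?l = None \<longleftrightarrow> ?g = []" "v = None \<longleftrightarrow> ?h = []"
      using M(2,3) by blast+
    consider (none) "?g = []" "?h = []" | (pas) "?g = []" "?h \<noteq> []" | (act) "?g \<noteq> []" "?h = []"
      | (both) "?g \<noteq> []" "?h \<noteq> []" by blast
    then show ?thesis
    proof cases
      case none
      then have f: "(q', l') = op_return (?l\<lparr>vPCurr := v\<rparr>)" 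
        using e(1) N by (simp add: elim_continue_def collide_return_def)
      show ?thesis using f L(1,2) M(1) none unfolding e(2) Eli4b
        by (cases "invoked ?l") (auto simp: q Eli4b op_return_def matched_def intro!: R)
    next
      case pas
      then have f: "q' = MultiEliminate Eli6a" "l' = ?l\<lparr>vPCurr := v\<rparr>" 
        using e(1) N by (simp_all add: elim_continue_def)
      have "retry_pas ?m t l' ow ?g ?h" using M pas unfolding f by (simp add: retry_pas_def)
      then show ?thesis using L(1-3) unfolding f e(2)
        by (auto simp: q Eli4b intro!: R)
    next
      case act
      then have f: "q' = MultiEliminate Eli5a" "l' = ?l\<lparr>vPCurr := v\<rparr>" 
        using e(1) N by (simp_all add: elim_continue_def)
      have "retry_act ?m t l' ow ?g ?h" using M act unfolding f by (simp add: retry_act_def)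
      then show ?thesis using L(1-3) unfolding f e(2)
        by (auto simp: q Eli4b intro!: R)
    next
      case both
      then have f: "q' = MultiEliminate Eli1a" "l' = ?l\<lparr>vPCurr := v\<rparr>" 
        using e(1) N by (simp_all add: elim_continue_def)
      have "the (vMOp ?l) \<notin> set (tl ?g)" "the (vPInf ?l) \<notin> set (tl ?h)"
        using M(1) both unfolding matched_def by (auto dest: list.set_sel(2))
      then have "matching ?m t l' ow ?g ?h" using M both unfolding f matching_def matched_def by simp
      then show ?thesis using L(1-3) unfolding f e(2)
        by (auto simp: q Eli4b intro!: R)
    qed
  next
    case Eli5a
    show ?thesis using E L k unfolding Eli5a
      by (auto simp: sm Eli5a intro!: R)
  next
    case Eli5b
    have "known ?m (vACurr ?l)" using L(4) Eli5b pk(1)[of "vACurr ?l" ?g] by (auto simp: retry_act_def)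
    then show ?thesis using E L di unfolding Eli5b
      by (auto simp: sm Eli5b dest: knownD intro!: W[where g' = "?g" and h' = "?h"])
  next
    case Eli5c
    show ?thesis using E L k unfolding Eli5c
      by (auto simp: sm Eli5c retry_act_def matched_def elim0_def intro!: R)
  next
    case Eli5d
    then have A: "retry_act ?m t ?l ow ?g ?h" "tM ?l = Some (last ?g)" using L(4) by auto
    then have ph: "path ?m (vACurr ?l) ?g" "?g \<noteq> []" by (auto simp: retry_act_def)
    note hg = pk[OF ph disjI1[OF refl]]
    let ?m1 = "set_mop (hd ?g) (m_last_update (\<lambda>_. tM ?l)) ?m"
    have e: "q' = MultiEliminate Eli5e" "l' = ?l" "m' = ?m1"
      using E hg(1,3) unfolding Eli5d by (simp_all add: sm)
    \<comment> \<open>The store must not hit the leading record, whose own \<open>last\<close>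
      pointer is part of \<open>elim0\<close>.\<close>
    have ne: "the (vMOp ?l) \<noteq> hd ?g" using A(1) ph(2) by (auto simp: retry_act_def matched_def)
    have "elim0 ?m1 t ow (vMOp ?l) (vPInf ?l) ?g ?h" 
      using A(1) ne unfolding retry_act_def matched_def elim0_def by (simp, simp add: mops_set_mop)
    then have "retry_act ?m1 t ?l ow ?g ?h"
      using A(1) unfolding retry_act_def matched_def by simp
    moreover have "last_of ?m1 (hd ?g) = Some (last ?g)" using A(2) by (simp add: mops_set_mop)
    ultimately show ?thesis using L(1-3) hg(1-3) di unfolding e
      by (intro W[where g' = "?g" and h' = "?h"]) (auto simp: q Eli5d known_def)
  next
    case Eli6a
    have "known ?m (vPInf ?l)" using L(4) Eli6a elim0_known by (auto simp: retry_pas_def matched_def)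
    then show ?thesis using E L unfolding Eli6a
      by (auto simp: sm Eli6a intro!: R)
  next
    case Eli6b
    have "known ?m (vPCurr ?l)" using L(4) Eli6b pk(1)[of "vPCurr ?l" ?h] by (auto simp: retry_pas_def)
    then show ?thesis using E L di unfolding Eli6b
      by (auto simp: sm Eli6b dest: knownD intro!: W[where g' = "?g" and h' = "?h"])
  next
    case Eli6c
    have "known ?m (vPInf ?l)" using L(4) Eli6c elim0_known by (auto simp: retry_pas_def matched_def)
    then show ?thesis using E L unfolding Eli6c
      by (auto simp: sm Eli6c retry_pas_def matched_def elim0_def intro!: R)
  next
    case Eli6d
    then have A: "retry_pas ?m t ?l ow ?g ?h" "tM ?l = Some (last ?h)" using L(4) by auto
    then have ph: "path ?m (vPCurr ?l) ?h" "?h \<noteq> []" by (auto simp: retry_pas_def)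
    note hg = pk[OF ph disjI2[OF refl]]
    let ?m1 = "set_mop (hd ?h) (m_last_update (\<lambda>_. tM ?l)) ?m"
    have e: "q' = MultiEliminate Eli6e" "l' = ?l" "m' = ?m1"
      using E hg(1,3) unfolding Eli6d by (simp_all add: sm)
    have ne: "the (vPInf ?l) \<noteq> hd ?h" using A(1) ph(2) by (auto simp: retry_pas_def matched_def)
    have "elim0 ?m1 t ow (vMOp ?l) (vPInf ?l) ?g ?h" 
      using A(1) ne unfolding retry_pas_def matched_def elim0_def by (simp, simp add: mops_set_mop)
    then have "retry_pas ?m1 t ?l ow ?g ?h"
      using A(1) unfolding retry_pas_def matched_def by simp
    moreover have "last_of ?m1 (hd ?h) = Some (last ?h)" using A(2) by (simp add: mops_set_mop)
    ultimately show ?thesis using L(1-3) hg(1-3) di unfolding e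
      by (intro W[where g' = "?g" and h' = "?h"]) (auto simp: q Eli6d known_def)
  qed (use n in auto)
qed

section \<open>Invocation, creation, return, and the transfer of lists between threads\<close>

lemma waiting_not_settled: "waiting m u q l \<Longrightarrow> \<not> settled q"
  by (cases q) auto

lemma waiting_loop_body: "loop_body l = (q, l') \<Longrightarrow> \<not> waiting m u q l'"
  by (auto simp: loop_body_def split: operation.splits)

lemma InvI:
  assumes "heap_ok (mem c)"
    "\<And>u. local_inv (mem c) u (ctl c u) (lcl c u) ow (G u) (H u)"
    "\<And>u. distinct (G u @ H u)"
    "\<And>u x. x \<in> set (G u) \<union> set (H u) \<Longrightarrow> alive (mem c) x \<and> ow x = u \<and> (exempt (mem c) (lcl c u) x \<or> waiter c x)"
    "\<And>p x. waiting (mem c) p (ctl c p) (lcl c p) \<Longrightarrow> vMOp (lcl c p) = Some x \<Longrightarrow> ow x \<noteq> p \<Longrightarrow>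
        status_of (mem c) x = FINISHED \<or> status_of (mem c) x = INIT \<and> x \<in> set (G (ow x)) \<union> set (H (ow x))"
  shows "Inv c ow G H"
  unfolding Inv_def using assms by blast

lemma invoke_preserves:
  assumes I: "Inv c ow G H" and q: "ctl c t = Idle"
  shows "preserved c ow G H t (c\<lparr>ctl := (ctl c)(t := Init), lcl := (lcl c)(t := (lcl c t)\<lparr>invoked := x\<rparr>)\<rparr>)"
proof -
  have "local_inv (mem c) t Idle (lcl c t) ow (G t) (H t)" using InvD(2)[OF I, of t] q by simp
  then have "preserved c ow G H t (thread_upd c t Init ((lcl c t)\<lparr>invoked := x\<rparr>) (mem c))"
    by (intro own_read[OF I]) (auto simp: q)
  then show ?thesis by (simp add: thread_upd_def)
qed

text \<open>Stated for \<open>Inv\<close> alone: a return leaves the settled points, so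
  \<open>progress\<close> cannot hold.\<close>

lemma return_inv:
  assumes I: "Inv c ow G H" and q: "ctl c t = Ret"
  shows "Inv (c\<lparr>ctl := (ctl c)(t := Idle)\<rparr>) ow G H"
proof -
  have L: "local_inv (mem c) t Ret (lcl c t) ow (G t) (H t)" using InvD(2)[OF I, of t] q by simp
  then have "Inv (thread_upd c t Idle (lcl c t) (mem c)) ow (G(t := [])) (H(t := []))"
    by (intro own_step_Inv[OF I refl refl refl InvD(1)[OF I]]) (auto simp: q)
  moreover have "G(t := []) = G" "H(t := []) = H" using L by auto
  ultimately show ?thesis by (simp add: thread_upd_def)
qed

lemma init_preserves:
  fixes c :: "'d config"
  assumes I: "Inv c ow G H" and q: "ctl c t = Init"
    and E: "((q', l'), m') \<in> init_multiop t (lcl c t) (mem c)"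
  shows "preserved c ow G H t (thread_upd c t q' l' m')"
proof -
  let ?m = "mem c" and ?l = "lcl c t"
  have L: "G t = []" "H t = []" "location ?m t = None" using InvD(2)[OF I, of t] q by auto
  note D = InvD[OF I]
  \<comment> \<open>The common effect of both allocations: one fresh record, and possibly a fresh
    cell whose \<open>next\<close> is null.\<close>
  obtain r k v where r: "\<not> alive ?m r" and lb: "(q', l') = loop_body (?l\<lparr>vMOp := Some r\<rparr>)"
    and mo: "mops m' = (mops ?m)(r \<mapsto> new_mop t r k v)" and k: "k = kind_of (invoked ?l)"
    and mc: "\<forall>x. cells ?m x \<noteq> None \<longrightarrow> cells m' x = cells ?m x"
      "\<forall>x. cells m' x \<noteq> None \<longrightarrow> cells ?m x \<noteq> None \<or> c_next (the (cells m' x)) = None"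
    and v: "cell_ok m' v" "k = PUSH \<longrightarrow> v \<noteq> None"
    and lc: "location m' = location ?m" "centralStack m' = centralStack ?m"
  proof (cases "invoked ?l")
    case Pop
    with E obtain r where "mops ?m r = None" "(q', l') = loop_body (?l\<lparr>vMOp := Some r\<rparr>)"
      "m' = ?m\<lparr>mops := (mops ?m)(r \<mapsto> new_mop t r POP None)\<rparr>" by (auto simp: init_multiop_def)
    then show ?thesis using Pop by (intro that[of r POP None]) auto
  next
    case (Push d)
    with E obtain r cr where "mops ?m r = None" "cells ?m cr = None" "(q', l') = loop_body (?l\<lparr>vMOp := Some r\<rparr>)"
      "m' = ?m\<lparr>mops := (mops ?m)(r \<mapsto> new_mop t r PUSH (Some cr)),
            cells := (cells ?m)(cr \<mapsto> \<lparr>c_data = Some d, c_next = None\<rparr>)\<rparr>" by (auto simp: init_multiop_def)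
    then show ?thesis using Push by (intro that[of r PUSH "Some cr"]) (auto simp: cell_ok_def)
  qed
  \<comment> \<open>The record is fresh, so no thread gains or loses an existing record.\<close>
  define ow' where "ow' = ow(r := t)"
  let ?c = "thread_upd c t q' l' m'" and ?G = "G(t := [r])"
  have rc: "the (mops m' x) = the (mops ?m x)" if "alive ?m x" for x using mo r that by auto
  have al: "alive m' x" if "alive ?m x" for x using mo that by auto
  have ow: "ow' x = ow x" if "alive ?m x" for x using r that unfolding ow'_def by auto
  have F: "frame ?m m' ow ow' u" for u
    unfolding frame_def using rc al ow mc(1) lc(1) by auto
  have okm: "cell_ok ?m p \<Longrightarrow> cell_ok m' p" for p using mc(1) unfolding cell_ok_def by auto
  have vl: "vMOp l' = Some r" "invoked l' = invoked ?l" using lb by (auto simp: loop_body_def split: operation.splits)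
  have nw: "\<not> waiting m' t q' l'" using waiting_loop_body lb by metis
  have nw0: "\<not> waiting ?m t (ctl c t) (lcl c t)" using q by simp
  have wu: "waiting m' u (ctl c u) (lcl c u) = waiting ?m u (ctl c u) (lcl c u)" for u
    by (rule waiting_frame[OF F _ D(2) D(1)]) (simp add: lc)
  have bw: "alive ?m x" if "waiting ?m u (ctl c u) (lcl c u)" "vMOp (lcl c u) = Some x" for u x
    using waiting_base[OF D(2) that(1)] that(2) by (simp add: base_def)
  have "Inv ?c ow' ?G H"
  proof (rule InvI)
    have "cell_ok m' (cell_of m' x) \<and> (op_of m' x = PUSH \<longrightarrow> cell_of m' x \<noteq> None) \<and> (status_of m' x = FINISHED \<longrightarrow> cell_of m' x \<noteq> None)"
      if "alive m' x" for x
      using D(1) that v okm k mo unfolding heap_ok_def by (cases "x = r") (auto simp: new_mop_def)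
    moreover have "cell_ok m' (c_next (the (cells m' x)))" if x: "cells m' x \<noteq> None" for x
    proof (cases "cells ?m x = None")
      case True
      then have "c_next (the (cells m' x)) = None" using mc(2) x by blast
      then show ?thesis by simp
    next
      case False
      then have "cell_ok ?m (c_next (the (cells ?m x)))" using D(1) unfolding heap_ok_def by blast
      then show ?thesis using okm mc(1) False by simp
    qed
    ultimately show "heap_ok (mem ?c)"
      using D(1) okm al mc(1) unfolding heap_ok_def by (simp add: lc)
    show "local_inv (mem ?c) u (ctl ?c u) (lcl ?c u) ow' (?G u) (H u)" for u
    proof (cases "u = t")
      case False
      have "local_inv m' u (ctl c u) (lcl c u) ow' (G u) (H u)"
        using D(4) by (intro local_inv_frame[OF F _ _ D(2)]) blast+
      then show ?thesis using False by simp
    next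
      case True
      have "base m' t (vMOp l') (invoked l')" using vl mo k by (simp add: base_def new_mop_def)
      moreover have "lead m' t ow' (vMOp l') [r]"
        using vl mo by (simp add: lead_def lead0_def owned_def ow'_def new_mop_def same_op_def)
      ultimately have "local_inv m' t q' l' ow' [r] []"
        using lb lc L by (cases "invoked ?l") (auto simp: loop_body_def)
      then show ?thesis using True L by simp
    qed
    show "distinct (?G u @ H u)" for u using D(3)[of u] L by auto
    show "alive (mem ?c) x \<and> ow' x = u \<and> (exempt (mem ?c) (lcl ?c u) x \<or> waiter ?c x)"
      if x: "x \<in> set (?G u) \<union> set (H u)" for u x
    proof (cases "u = t")
      case True
      then show ?thesis using x L vl mo by (auto simp: ow'_def exempt_def)
    next
      case False
      then have xo: "x \<in> set (G u) \<union> set (H u)" using x by auto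
      then have ne: "G u \<noteq> [] \<or> H u \<noteq> []" by auto
      from local_inv_base[OF D(2) ne] have av: "alive ?m (the (vMOp (lcl c u)))" by (simp add: base_def)
      have ax: "alive ?m x" "ow x = u" using D(4)[OF xo] by auto
      have "waiter ?c x" if W: "waiter c x"
      proof -
        have "id_of ?m x \<noteq> t" using W nw0 unfolding waiter_def by auto
        then show ?thesis using W wu rc[OF ax(1)] unfolding waiter_def by simp
      qed
      then show ?thesis using D(5)[OF xo] exempt_frame[OF F ax(1) av] False ax al ow by auto
    qed
    show "status_of (mem ?c) x = FINISHED \<or> status_of (mem ?c) x = INIT \<and> x \<in> set (?G (ow' x)) \<union> set (H (ow' x))"
      if A: "waiting (mem ?c) p (ctl ?c p) (lcl ?c p)" "vMOp (lcl ?c p) = Some x" "ow' x \<noteq> p" for p x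
    proof -
      have pt: "p \<noteq> t" using A nw by auto
      then have W: "waiting ?m p (ctl c p) (lcl c p)" "vMOp (lcl c p) = Some x" using A wu by auto
      note ax = bw[OF W]
      from D(6)[OF W] A(3) ow[OF ax] have
        "status_of ?m x = FINISHED \<or> status_of ?m x = INIT \<and> x \<in> set (G (ow x)) \<union> set (H (ow x))" by simp
      then show ?thesis using rc[OF ax] ow[OF ax] L by (cases "ow x = t") auto
    qed
  qed
  moreover have "progress c G H t ?c ?G H" using q unfolding progress_def by simp
  ultimately show ?thesis unfolding preserved_def by blast
qed

text \<open>An entry that is not null holds the thread's own record or that of its capturer, and the
  latter has a foreign id. Hence a capturing CAS that finds the partner's record hits a thread that
  still leads its list.\<close>

lemma exposed_location:
  assumes "local_inv m u q l ow g h" "location m u = Some x" "id_of m x = u"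
  shows "\<exists>r. q = Collide r \<and> r \<noteq> Col1a \<and> vMOp l = Some x \<and> lead m u ow (Some x) g \<and> h = []"
proof (cases q)
  case (Collide r)
  then have "r \<noteq> Col1a" "exposed m u l ow g" "h = []" using assms(1,2) by (cases r; auto)+
  then show ?thesis using Collide assms(2,3) unfolding exposed_def captured_def by auto
next
  case (PassiveCollide r)
  then show ?thesis using assms by (cases r) (auto simp: captured_def)
qed (use assms in auto)

text \<open>Apart from \<open>base\<close> and \<open>exposed\<close>, the points of
  \<open>collide\<close> other than \<open>Col1a\<close> claim only facts about
  \<open>vOInfo\<close>, which no step invalidates.\<close>

lemma exposed_local_inv:
  assumes "local_inv m u (Collide r) l ow g h" "r \<noteq> Col1a"
    and "base m' u (vMOp l) (invoked l)" "exposed m' u l ow' g'"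
    and "\<And>p. known m p \<Longrightarrow> known m' p" "\<And>p. other m u p \<Longrightarrow> other m' u p"
  shows "local_inv m' u (Collide r) l ow' g' []"
  using assms by (cases r) auto

text \<open>One CAS moves the whole list of the partner \<open>p\<close> to \<open>t\<close> behind
  the back of \<open>p\<close>, which stays at its point in \<open>collide\<close>;
  \<open>exposed\<close> just switches to its second case.\<close>

lemma capture_preserves:
  fixes c :: "'d config"
  assumes I: "Inv c ow G H" and q: "ctl c t = ActiveCollide Act1b"
    and E: "((q', l'), m') \<in> active_code Act1b (lcl c t) (mem c)"
    and n: "location (mem c) (tId (lcl c t)) = vPInf (lcl c t)"
  shows "preserved c ow G H t (thread_upd c t q' l' m')"
proof -
  let ?m = "mem c" and ?l = "lcl c t"
  note D = InvD[OF I]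
  have L: "base ?m t (vMOp ?l) (invoked ?l)" "location ?m t = None" "H t = []" "lead ?m t ow (vMOp ?l) (G t)"
    "vAInf ?l = vMOp ?l" "other ?m t (vPInf ?l)" "tId ?l = id_of ?m (the (vPInf ?l))"
    using D(2)[of t] q by auto
  obtain a where a: "vMOp ?l = Some a" "alive ?m a" "id_of ?m a = t" using L(1) by (auto simp: base_def)
  obtain x where x: "vPInf ?l = Some x" "alive ?m x" "id_of ?m x \<noteq> t" using L(6) by (auto simp: other_def)
  define p where "p = id_of ?m x"
  have pt: "p \<noteq> t" using x p_def by simp
  have lp: "location ?m p = Some x" using n L(7) x p_def by simp
  from exposed_location[OF D(2) lp] p_def obtain r where r: "ctl c p = Collide r" "r \<noteq> Col1a" "vMOp (lcl c p) = Some x"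
    "lead ?m p ow (Some x) (G p)" "H p = []" by auto
  have e: "q' = ActiveCollide Act2a" "l' = ?l" "m' = put_location p (Some a) ?m"
    using E n L(5,7) a(1) x(1) p_def by (auto simp: cas_def)
  define ow' where "ow' = (\<lambda>y. if y \<in> set (G p) then t else ow y)"
  let ?c = "thread_upd c t q' l' m'" and ?G = "G(p := [])" and ?H = "H(t := G p)"
  have xG: "x \<in> set (G p)" using r(4) by (cases "G p") (auto simp: lead_def lead0_def)
  have owp: "ow y = p" if "y \<in> set (G p)" for y using D(4)[of y p] that by auto
  have ow: "ow' y = u \<longleftrightarrow> ow y = u" if "u \<noteq> t" "u \<noteq> p" for u y using that owp unfolding ow'_def by auto
  have owt: "ow' y = t \<longleftrightarrow> ow y = t \<or> y \<in> set (G p)" for y unfolding ow'_def by auto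
  have mp: "mops m' = mops ?m" "location m' u = (if u = p then Some a else location ?m u)" for u using e by auto
  have F: "frame ?m m' ow ow' u" if "u \<noteq> t" "u \<noteq> p" for u
    unfolding frame_def using that ow e by simp
  have F0: "frame ?m m' ow ow u" if "u \<noteq> p" for u
    unfolding frame_def using that e by simp
  have wu: "waiting m' u (ctl c u) (lcl c u) = waiting ?m u (ctl c u) (lcl c u)" if "u \<noteq> p" for u
    by (rule waiting_frame[OF F0 _ D(2) D(1)]) (use that mp in auto)
  have nwp: "\<not> waiting ?m p (ctl c p) (lcl c p)" using r lp by simp
  have nwt: "\<not> waiting m' t q' l'" "\<not> waiting ?m t (ctl c t) (lcl c t)" using e q by auto
  have wx: "waiting m' p (Collide r) (lcl c p) \<longleftrightarrow> op_of ?m a = op_of ?m x"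
    using r a pt p_def by (auto simp: partner_def mp)
  have wt: "waiter ?c y" if W: "waiter c y" for y
  proof -
    have "id_of ?m y \<noteq> t" "id_of ?m y \<noteq> p" using W nwp nwt unfolding waiter_def by auto
    then show ?thesis using W wu unfolding waiter_def by (simp add: mp)
  qed
  have ex: "exempt m' l0 y = exempt ?m l0 y" for l0 y by (simp add: exempt_def mp)
  have "Inv ?c ow' ?G ?H"
  proof (rule InvI)
    show "heap_ok (mem ?c)" using D(1) a(2) unfolding e heap_ok_def cell_ok_def by auto
    show "local_inv (mem ?c) u (ctl ?c u) (lcl ?c u) ow' (?G u) (?H u)" for u
    proof -
      consider "u = t" | "u = p" | "u \<noteq> t" "u \<noteq> p" by blast
      then show ?thesis
      proof cases
        case 1
        have "lead ?m t ow' (vMOp ?l) (G t)" 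
          using L(4) owt unfolding lead_def lead0_def owned_def by simp
        moreover have "grab m' t ow' (vPInf ?l) (G p)"
          using r(4) x(1) unfolding grab_def lead_def lead0_def e by simp
        ultimately show ?thesis using 1 pt L unfolding e by simp
      next
        case 2
        have "captured m' p ow' (Some x) (Some a) []"
          using xG a pt unfolding captured_def wait_list_def owned_def ow'_def by (simp add: mp)
        then have X: "exposed m' p (lcl c p) ow' []" using r by (simp add: exposed_def mp)
        have "base m' p (vMOp (lcl c p)) (invoked (lcl c p))"
          using D(2)[of p] r unfolding e by simp
        then have "local_inv m' p (Collide r) (lcl c p) ow' [] []"
          using D(2)[of p] r(1,2) X by (intro exposed_local_inv) (auto simp: known_def e)
        then show ?thesis using 2 pt r by simp
      next
        case 3
        have "local_inv m' u (ctl c u) (lcl c u) ow' (G u) (H u)"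
          using D(4) by (intro local_inv_frame[OF F[OF 3] _ _ D(2)]) blast+
        then show ?thesis using 3 by simp
      qed
    qed
    show "distinct (?G u @ ?H u)" for u
    proof -
      have "set (G t) \<inter> set (G p) = {}" using D(4)[of _ t] owp pt by fastforce
      then show ?thesis using D(3)[of u] D(3)[of p] D(3)[of t] by auto
    qed
    show "alive (mem ?c) y \<and> ow' y = u \<and> (exempt (mem ?c) (lcl ?c u) y \<or> waiter ?c y)"
      if y: "y \<in> set (?G u) \<union> set (?H u)" for u y
    proof (cases "u = t \<and> y \<in> set (G p)")
      case True
      then have y: "y \<in> set (G p)" and u: "u = t" by auto
      have ya: "alive ?m y" using D(4)[of y p] y by simp
      have so: "op_of ?m y = op_of ?m x" using r(4) y unfolding lead_def lead0_def same_op_def by simp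
      have "exempt m' ?l y \<or> waiter ?c y"
      proof (cases "y = x")
        case True
        show ?thesis
        \<comment> \<open>Equal operations make the partner a waiter. Opposite ones leave it free to
          return, and its record is exempt through \<open>vPInf\<close>.\<close>
        proof (cases "op_of ?m a = op_of ?m x")
          case op: True
          have "status_of ?m x = INIT" using r(4) by (simp add: lead_def lead0_def)
          then have "waiter ?c x" unfolding waiter_def using wx op r pt by (simp add: mp p_def[symmetric])
          then show ?thesis using True by simp
        next
          case False
          then show ?thesis using True x a by (auto simp: exempt_def mp)
        qed
      next
        case False
        \<comment> \<open>The records behind the head were those of waiters already while
          \<open>p\<close> led them.\<close>
        then have "\<not> exempt ?m (lcl c p) y" using r(3) so by (auto simp: exempt_def)
        then show ?thesis using D(5)[of y p] y wt by auto
      qed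
      then show ?thesis using ya y u e by (auto simp: ow'_def)
    next
      case False
      then have xo: "y \<in> set (G u) \<union> set (H u)" "u \<noteq> p" using y r(5) pt by (auto split: if_splits)
      have ay: "alive ?m y" "ow y = u" using D(4)[OF xo(1)] by auto
      have "y \<notin> set (G p)" using owp ay xo by auto
      then show ?thesis using D(5)[OF xo(1)] ay wt e(2) ex by (auto simp: mp ow'_def)
    qed
    show "status_of (mem ?c) y = FINISHED \<or> status_of (mem ?c) y = INIT \<and> y \<in> set (?G (ow' y)) \<union> set (?H (ow' y))"
      if A: "waiting (mem ?c) z (ctl ?c z) (lcl ?c z)" "vMOp (lcl ?c z) = Some y" "ow' y \<noteq> z" for z y
    proof -
      have zt: "z \<noteq> t" using A nwt by auto
      show ?thesis
      proof (cases "z = p")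
        case True
        then have "y = x" using A r zt by simp
        moreover have "status_of ?m x = INIT" using r(4) by (simp add: lead_def lead0_def)
        ultimately show ?thesis using xG by (simp add: mp ow'_def)
      next
        case False
        then have W: "waiting ?m z (ctl c z) (lcl c z)" "vMOp (lcl c z) = Some y" using A wu zt by auto
        have "ow y \<noteq> z" using A(3) False owp unfolding ow'_def by (auto split: if_splits)
        note old = D(6)[OF W this]
        show ?thesis
        proof (cases "y \<in> set (G p)")
          case True
          then have "ow y = p" "ow' y = t" using owp by (auto simp: ow'_def)
          then show ?thesis using old True r(5) by (auto simp: mp)
        next
          case ny: False
          then have "ow' y = ow y" by (simp add: ow'_def)
          moreover have "ow y = p \<Longrightarrow> status_of ?m y = FINISHED" using old ny r(5) by auto
          ultimately show ?thesis using old L(3) by (cases "ow y = p"; cases "ow y = t") (auto simp: mp)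
        qed
      qed
    qed
  qed
  moreover have "progress c G H t ?c ?G ?H" using q r unfolding progress_def by auto
  ultimately show ?thesis unfolding preserved_def by blast
qed

text \<open>RETRY may arrive anywhere between the capture and the end of the await. At all these
  points the assertion constrains the list only through \<open>wait_list\<close>, so it is enough to
  replace the empty list by the one handed over.\<close>

lemma waiting_handover:
  assumes L: "local_inv m p q l ow g h" and w: "waiting m p q l" "\<not> owned ow p (the (vMOp l))" "status_of m (the (vMOp l)) = INIT"
  shows "g = [] \<and> h = []"
    and "wait_list (set_mop x (m_cStatus_update fc) m) p ow' (vMOp l) w \<Longrightarrow> owned ow' p (the (vMOp l)) \<Longrightarrow>
      local_inv (set_mop x (m_cStatus_update fc) m) p q l ow' w []"
proof -
  let ?m = "set_mop x (m_cStatus_update fc) m"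
  have C: "captured ?m u ow' v a w" if "captured m u ow v a g" "partner m a v" "wait_list ?m u ow' v w" for u v a
    using that unfolding captured_def partner_def by (simp, simp add: mops_set_mop)
  have Kn: "known m v \<Longrightarrow> known ?m v" "other m u v \<Longrightarrow> other ?m u v" for u v
    by (simp, simp add: other_def, simp add: mops_set_mop)
  show "g = [] \<and> h = []"
  proof (cases q)
    case (Collide r)
    then have "exposed m p l ow g" "h = []" "partner m (location m p) (vMOp l)" using L w(1) by (cases r; simp)+
    then show ?thesis using w(2) by (auto simp: exposed_def captured_def wait_list_def partner_def)
  next
    case (PassiveCollide r)
    then show ?thesis using L w by (cases r) (auto simp: captured_def wait_list_def partner_def)
  qed (use w in auto)
  assume W: "wait_list ?m p ow' (vMOp l) w" and o: "owned ow' p (the (vMOp l))"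
  show "local_inv ?m p q l ow' w []"
  proof (cases q)
    case (Collide r)
    then have "exposed m p l ow g" "r \<noteq> Col1a" "partner m (location m p) (vMOp l)" "base m p (vMOp l) (invoked l)"
      using L w(1) by (cases r; simp)+
    moreover from this have "captured m p ow (vMOp l) (location m p) g" by (auto simp: exposed_def partner_def)
    ultimately show ?thesis using C W Kn unfolding Collide 
      by (intro exposed_local_inv[OF L[unfolded Collide]]) (auto simp: exposed_def)
  next
    case (PassiveCollide r)
    then show ?thesis using L w C W o by (cases r) auto
  qed (use w in auto)
qed

text \<open>The reverse of a capture: the remainder \<open>w\<close>, from either side of an
  elimination, goes to the thread of its first record. That thread is there to take it, because no
  record of \<open>w\<close> is exempt and so each has a waiter.\<close>

lemma handover_preserves:
  fixes c :: "'d config"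
  assumes I: "Inv c ow G H" and q: "ctl c t = MultiEliminate e0"
    and w: "w \<noteq> []" "set w = set (G t) \<union> set (H t)" "path (mem c) (Some x) w" "last_of (mem c) x = Some (last w)"
      "same_op (mem c) (Some x) w" "distinct w"
    and ne: "\<And>y. y \<in> set w \<Longrightarrow> \<not> exempt (mem c) (lcl c t) y"
    and m': "m' = set_mop x (m_cStatus_update (\<lambda>_. RETRY)) (mem c)"
    and L': "\<And>ow. local_inv m' t q' l' ow [] []"
    and s: "settled q'" "settled_rank q' 0 0 < settled_rank (ctl c t) (length (G t)) (length (H t))" and nw: "\<not> waiting m' t q' l'"
  shows "preserved c ow G H t (thread_upd c t q' l' m')"
proof -
  let ?m = "mem c" and ?l = "lcl c t"
  note D = InvD[OF I]
  have xw: "x \<in> set w" using w(1,3) by (cases w) auto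
  have wa: "alive ?m y" "ow y = t" "waiter c y" if "y \<in> set w" for y
    using D(4)[of y t] D(5)[of y t] ne[OF that] that w(2) by auto
  define p where "p = id_of ?m x"
  have P: "vMOp (lcl c p) = Some x" "waiting ?m p (ctl c p) (lcl c p)" "status_of ?m x = INIT"
    using wa(3)[OF xw] unfolding waiter_def p_def by auto
  have pt: "p \<noteq> t" using P q by auto
  have own: "\<not> owned ow p (the (vMOp (lcl c p)))" using P wa(2)[OF xw] pt by (simp add: owned_def)
  note HO = waiting_handover[OF D(2) P(2) own]
  have gp: "G p = []" "H p = []" using HO(1) P by auto
  define ow' where "ow' = (\<lambda>y. if y \<in> set w then p else ow y)"
  let ?c = "thread_upd c t q' l' m'" and ?G = "G(t := [], p := w)" and ?H = "H(t := [])"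
  have mo: "id_of m' y = id_of ?m y" "op_of m' y = op_of ?m y" "alive m' y \<longleftrightarrow> alive ?m y" "location m' = location ?m"
    for y unfolding m' using wa(1)[OF xw] by (simp_all, simp add: mops_set_mop)
  have st: "status_of m' y = (if y = x then RETRY else status_of ?m y)" for y unfolding m' by (simp add: mops_set_mop)
  have F: "frame ?m m' ow ow' u" if u: "u \<noteq> t" "u \<noteq> p" for u
  proof -
    have o: "ow' y = u \<longleftrightarrow> ow y = u" for y using wa(2)[of y] u unfolding ow'_def by auto
    have "ow y = u \<Longrightarrow> status_of m' y = status_of ?m y" for y using st[of y] wa(2)[OF xw] u by auto
    moreover have "status_of ?m y = FINISHED \<Longrightarrow> status_of m' y = FINISHED" for y using st[of y] P(3) by auto
    ultimately show ?thesis unfolding frame_def using o mo by (simp add: m')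
  qed
  \<comment> \<open>\<open>frame\<close> fails for \<open>t\<close> and \<open>p\<close>, between
    which ownership moves, but \<open>waiting_frame\<close> needs it for one thread only.\<close>
  obtain u0 where u0: "u0 \<noteq> t" "u0 \<noteq> p" by (metis n_not_Suc_n not_less_eq_eq nat_le_linear)
  have wu: "waiting m' u (ctl c u) (lcl c u) = waiting ?m u (ctl c u) (lcl c u)" for u
    by (rule waiting_frame[OF F[OF u0] _ D(2) D(1)]) (simp add: mo)
  have nwt: "\<not> waiting ?m t (ctl c t) (lcl c t)" using q by auto
  have ex: "exempt m' l0 y = exempt ?m l0 y" for l0 y by (simp add: exempt_def mo)
  have wt: "waiter ?c y" if W: "waiter c y" "y \<noteq> x" for y
  proof -
    have "id_of ?m y \<noteq> t" using W nwt unfolding waiter_def by auto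
    then show ?thesis using W wu unfolding waiter_def by (simp add: mo st)
  qed
  have "Inv ?c ow' ?G ?H"
  proof (rule InvI)
    have "cell_ok ?m (cell_of ?m x)" using D(1) wa(1)[OF xw] unfolding heap_ok_def by blast
    moreover have "op_of ?m x = PUSH \<longrightarrow> cell_of ?m x \<noteq> None" using D(1) wa(1)[OF xw] unfolding heap_ok_def by blast
    ultimately show "heap_ok (mem ?c)"
      unfolding thread_upd_simps m' by (intro heap_ok_set_mop[OF D(1) wa(1)[OF xw] refl]) auto
    show "local_inv (mem ?c) u (ctl ?c u) (lcl ?c u) ow' (?G u) (?H u)" for u
    proof -
      consider "u = t" | "u = p" | "u \<noteq> t" "u \<noteq> p" by blast
      then show ?thesis
      proof cases
        case 1
        then show ?thesis using L' pt by simp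
      next
        case 2
        have o: "owned ow' p x" using xw by (simp add: owned_def ow'_def)
        have "wait_list m' p ow' (Some x) w"
          using o w st[of x] unfolding wait_list_def m' by (simp add: mops_set_mop)
        then have "local_inv m' p (ctl c p) (lcl c p) ow' w []"
          using HO(2) P o unfolding m' by simp
        then show ?thesis using 2 pt gp by simp
      next
        case 3
        have "local_inv m' u (ctl c u) (lcl c u) ow' (G u) (H u)"
          using D(4) by (intro local_inv_frame[OF F[OF 3] _ _ D(2)]) blast+
        then show ?thesis using 3 by simp
      qed
    qed
    show "distinct (?G u @ ?H u)" for u
      using D(3)[of u] w(6) gp by auto
    show "alive (mem ?c) y \<and> ow' y = u \<and> (exempt (mem ?c) (lcl ?c u) y \<or> waiter ?c y)"
      if y: "y \<in> set (?G u) \<union> set (?H u)" for u y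
    proof (cases "u = p")
      case True
      then have y: "y \<in> set w" using y gp pt by auto
      have "y = x \<or> waiter ?c y" using wt wa(3)[OF y] by auto
      then show ?thesis using True y wa(1)[OF y] mo(3)[of y] P pt by (auto simp: ow'_def exempt_def mo)
    next
      case False
      then have ut: "u \<noteq> t" and xo: "y \<in> set (G u) \<union> set (H u)" using y by (auto split: if_splits)
      have ay: "alive ?m y" "ow y = u" using D(4)[OF xo(1)] by auto
      then have "y \<notin> set w" using wa(2)[of y] ut by auto
      then show ?thesis using D(5)[OF xo(1)] ay mo(3)[of y] wt[of y] ex ut xw by (auto simp: ow'_def)
    qed
    show "status_of (mem ?c) y = FINISHED \<or> status_of (mem ?c) y = INIT \<and> y \<in> set (?G (ow' y)) \<union> set (?H (ow' y))"
      if A: "waiting (mem ?c) z (ctl ?c z) (lcl ?c z)" "vMOp (lcl ?c z) = Some y" "ow' y \<noteq> z" for z y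
    proof -
      have zt: "z \<noteq> t" using A nw by auto
      then have W: "waiting ?m z (ctl c z) (lcl c z)" "vMOp (lcl c z) = Some y" using A wu by auto
      have z: "id_of ?m y = z" using waiting_base[OF D(2) W(1)] W(2) by (simp add: base_def)
      show ?thesis
      proof (cases "y \<in> set w")
        case True
        then have "y \<noteq> x" using A(3) z p_def by (auto simp: ow'_def)
        then show ?thesis using True wa(3)[OF True] by (simp add: ow'_def st waiter_def)
      next
        case False
        then have "ow y \<noteq> z" "y \<noteq> x" using A(3) xw by (auto simp: ow'_def)
        with D(6)[OF W] have "status_of ?m y = FINISHED \<or> status_of ?m y = INIT \<and> y \<in> set (G (ow y)) \<union> set (H (ow y))" by simp
        moreover have "ow' y = ow y" "status_of m' y = status_of ?m y" using False \<open>y \<noteq> x\<close> by (simp_all add: ow'_def st)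
        moreover have "y \<notin> set (G t)" "y \<notin> set (H t)" using False unfolding w(2) by auto
        ultimately show ?thesis using gp by (cases "ow y = t"; cases "ow y = p") auto
      qed
    qed
  qed
  moreover have "progress c G H t ?c ?G ?H"
    using q s waiting_not_settled[OF P(2)] pt unfolding progress_def by auto
  ultimately show ?thesis unfolding preserved_def by blast
qed


text \<open>A remainder of the own side has the own operation but lacks the own record; a remainder
  of the partner's side has the opposite operation but lacks \<open>vPInf\<close>. So neither
  contains an exempt record.\<close>

lemma retry_preserves:
  fixes c :: "'d config"
  assumes I: "Inv c ow G H" and q: "ctl c t = MultiEliminate p" and p: "p = Eli5e \<or> p = Eli6e"
    and E: "((q', l'), m') \<in> elim_code p (lcl c t) (mem c)"
  shows "preserved c ow G H t (thread_upd c t q' l' m')"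
proof -
  let ?m = "mem c" and ?l = "lcl c t"
  have L: "base ?m t (vMOp ?l) (invoked ?l)" "location ?m t = None" "elim_inv ?m t p ?l ow (G t) (H t)"
    using InvD(2)[OF I, of t] q by auto
  have di: "distinct (G t)" "distinct (H t)" using InvD(3)[OF I, of t] by auto
  obtain v w where w: "path ?m v w" "w \<noteq> []" "set w = set (G t) \<union> set (H t)" "last_of ?m (hd w) = Some (last w)"
      "same_op ?m (Some (hd w)) w" "distinct w" "\<And>y. y \<in> set w \<Longrightarrow> \<not> exempt ?m ?l y"
    and E': "((q', l'), m') \<in> write_mop ?l v (\<lambda>r. r\<lparr>m_cStatus := RETRY\<rparr>) (collide_return True ?l) ?m"
    and hc: "has_cell ?m (vMOp ?l)"
  proof -
    have vm: "vMOp ?l \<noteq> None" using L(1) by (simp add: base_def)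
    \<comment> \<open>Moves the reference for the common operation from the served leader to the
      first record of the remainder, which leads from now on.\<close>
    have so: "same_op ?m (Some (hd w)) w" if "same_op ?m u w" "w \<noteq> []" for u w
      using that unfolding same_op_def by (metis hd_in_set option.sel)
    from p show thesis
    proof
      assume p: "p = Eli5e"
      have A: "retry_act ?m t ?l ow (G t) (H t)" "last_of ?m (hd (G t)) = Some (last (G t))" using L(3) p by auto
      have ne: "\<not> exempt ?m ?l y" if "y \<in> set (G t)" for y
        using A(1) that vm unfolding retry_act_def matched_def elim0_def exempt_def same_op_def by auto
      show thesis
        using A E so[of "vMOp ?l" "G t"] di ne unfolding p
        by (intro that[of "vACurr ?l" "G t"]) (auto simp: retry_act_def matched_def elim0_def)
    next
      assume p: "p = Eli6e"
      have A: "retry_pas ?m t ?l ow (G t) (H t)" "last_of ?m (hd (H t)) = Some (last (H t))" using L(3) p by auto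
      have ne: "\<not> exempt ?m ?l y" if "y \<in> set (H t)" for y
        using A(1) that vm unfolding retry_pas_def matched_def elim0_def exempt_def same_op_def by auto
      show thesis
        using A E so[of "vPInf ?l" "H t"] di ne unfolding p
        by (intro that[of "vPCurr ?l" "H t"]) (auto simp: retry_pas_def matched_def elim0_def)
    qed
  qed
  have v: "v = Some (hd w)" using path_hd[OF w(1,2)] by simp
  have "hd w \<in> set (G t) \<union> set (H t)" using w(2,3) hd_in_set by auto
  then have k: "known ?m v" using InvD(4)[OF I, of "hd w" t] v by (simp add: known_def)
  have e: "(q', l') = op_return ?l" "m' = set_mop (hd w) (m_cStatus_update (\<lambda>_. RETRY)) ?m"
    using E' k v by (simp_all add: write_mop_known collide_return_def)
  have f: "(q' = Ret \<or> q' = PopResult1 \<and> l' = ?l) \<and> vMOp l' = vMOp ?l"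
    using e(1) by (auto simp: op_return_def split: operation.splits)
  have L': "local_inv m' t q' l' ow0 [] []" for ow0
    using f L(1,2) hc unfolding e(2) by auto
  show ?thesis
    by (rule handover_preserves[OF I q w(2,3) w(1)[unfolded v] w(4-7) e(2) L'])
       (use f q p in auto)
qed

lemma code_preserves:
  fixes c :: "'d config"
  assumes I: "Inv c ow G H" and E: "((q', l'), m') \<in> code_of N t (ctl c t) (lcl c t) (mem c)"
  shows "preserved c ow G H t (thread_upd c t q' l' m')"
proof (cases "ctl c t")
  case Init
  then show ?thesis using init_preserves[OF I] E by simp
next
  case (CMultiPop p)
  then show ?thesis using pop_preserves[OF I] E by simp
next
  case (CMultiPush p)
  then show ?thesis using push_preserves[OF I] E by simp
next
  case (Collide p)
  then show ?thesis using collide_preserves[OF I] E by simp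
next
  case (ActiveCollide p)
  then have E': "((q', l'), m') \<in> active_code p (lcl c t) (mem c)" using E by simp
  show ?thesis
  proof (cases "p = Act1b \<and> location (mem c) (tId (lcl c t)) = vPInf (lcl c t)")
    case True
    then have p: "p = Act1b" and l: "location (mem c) (tId (lcl c t)) = vPInf (lcl c t)" by auto
    show ?thesis by (rule capture_preserves[OF I ActiveCollide[unfolded p] E'[unfolded p] l])
  next
    case False
    show ?thesis by (rule active_preserves[OF I ActiveCollide E' False])
  qed
next
  case (PassiveCollide p)
  then show ?thesis using passive_preserves[OF I] E by simp
next
  case (Combine p)
  then show ?thesis using combine_preserves[OF I] E by simp
next
  case (MultiEliminate p)
  then show ?thesis using elim_preserves[OF I] retry_preserves[OF I] E by (cases "p = Eli5e \<or> p = Eli6e") auto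
next
  case PopResult1
  have L: "base (mem c) t (vMOp (lcl c t)) (invoked (lcl c t))" "has_cell (mem c) (vMOp (lcl c t))"
    "G t = []" "H t = []" "location (mem c) t = None"
    using InvD(2)[OF I, of t] PopResult1 by auto
  note k = base_known[OF L(1)]
  have "cell_present (mem c) (cell_of (mem c) (the (vMOp (lcl c t))))"
    using heap_okD(3)[OF InvD(1)[OF I] k] L(2) by (simp add: cell_present_iff has_cell_def)
  then show ?thesis using E L(3-) PopResult1 k
    by (auto simp: read_mop_known intro!: own_read[OF I])
next
  case PopResult2
  then show ?thesis using E InvD(2)[OF I, of t]
    by (auto simp: read_cell_present intro!: own_read[OF I])
qed (use E InvD(2)[OF I, of t] in auto)

lemma step_ghost:
  assumes "Inv c ow G H" "step N t a c c'"
  shows "\<exists>ow' G' H'. Inv c' ow' G' H' \<and> ((\<forall>r. a \<noteq> Return r) \<longrightarrow> progress c G H t c' G' H')"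
  using assms(2)
proof cases
  case (invoke x)
  then show ?thesis using invoke_preserves[OF assms(1), of t x] unfolding preserved_def by blast
next
  case (internal q l m)
  then show ?thesis using code_preserves[OF assms(1), of q l m N t] unfolding preserved_def thread_upd_def by blast
next
  case return
  then show ?thesis using return_inv[OF assms(1), of t] by blast
qed

lemma Inv_initial: "initial c \<Longrightarrow> Inv c (\<lambda>_. 0) (\<lambda>_. []) (\<lambda>_. [])"
  by (auto simp: initial_def Inv_def init_mem_def heap_ok_def cell_ok_def)

section \<open>Liveness\<close>

lemma eventually_const:
  fixes f :: "nat \<Rightarrow> nat"
  assumes "\<And>j. j \<ge> k \<Longrightarrow> f (Suc j) \<le> f j"
  shows "\<exists>k'\<ge>k. \<forall>j\<ge>k'. f j = f k'"
proof -
  define v where "v = (LEAST v. \<exists>j\<ge>k. f j = v)"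
  obtain k' where k': "k' \<ge> k" "f k' = v"
    using LeastI[of "\<lambda>v. \<exists>j\<ge>k. f j = v" "f k"] unfolding v_def by blast
  have "f j = v" if "j \<ge> k'" for j
    using that
  proof (induction j rule: dec_induct)
    case base
    then show ?case using k' by simp
  next
    case (step j)
    then have "f (Suc j) \<le> v" using assms[of j] k'(1) by simp
    moreover have "v \<le> f (Suc j)" unfolding v_def by (rule Least_le) (use step k'(1) in \<open>auto intro: exI[of _ "Suc j"]\<close>)
    ultimately show ?case by simp
  qed
  then show ?thesis using k' by auto
qed

text \<open>\<open>s\<close> tells whether \<open>vTop\<close> is stale, i.e. differs from the central stack. Along the code the stage
  increases only at a CAS with a current \<open>vTop\<close>, and that CAS succeeds.\<close>
fun stage :: "pc \<Rightarrow> bool \<Rightarrow> nat" where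
  "stage Idle s = 7"
| "stage Init s = 6"
| "stage (CMultiPop q) s = (if q = CPop1 then 1 else if s then 5 else 0)"
| "stage (CMultiPush q) s = (if q = CPush1 then 1 else if s then 5 else 0)"
| "stage (Collide q) s = (if q \<in> {Col1a, Col1b, Col2a, Col2b} then 4 else if q \<in> {Col4b, Col4c} then 2 else 3)"
| "stage _ s = 2"

abbreviation len :: "'d mem \<Rightarrow> 'd locals \<Rightarrow> int" where
  "len m l \<equiv> m_length (the (mops m (the (vMOp l))))"

text \<open>Decreases within a stage, where \<open>s\<close> is the collision array and \<open>n\<close> the length of the own multiOp.\<close>
fun rank :: "pc \<Rightarrow> 'd locals \<Rightarrow> (nat \<Rightarrow> nat option) \<Rightarrow> int \<Rightarrow> nat" where
  "rank (CMultiPop q) l s n = (case q of CPop3a \<Rightarrow> 2 * nat n + 2 | CPop3b \<Rightarrow> 2 * nat (n - vM l + 1) + 1 |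
     CPop3c \<Rightarrow> 2 * nat (n - vM l) + 2 | _ \<Rightarrow> 0)"
| "rank (CMultiPush q) l s n = (case q of CPush2a \<Rightarrow> 4 | CPush2b \<Rightarrow> 3 | CPush2c \<Rightarrow> 2 | CPush3a \<Rightarrow> 1 | _ \<Rightarrow> 0)"
| "rank (Collide q) l s n = (case q of Col1a \<Rightarrow> 8 | Col1b \<Rightarrow> 7 | Col2a \<Rightarrow> 5 |
     Col2b \<Rightarrow> if s (vIndex l) = vHim l then 4 else 6 |
     Col3a \<Rightarrow> 5 | Col3b \<Rightarrow> 4 | Col3c \<Rightarrow> 3 | Col3d \<Rightarrow> 2 | Col4a \<Rightarrow> 1 | Col4b \<Rightarrow> 100 + vDelay l | Col4c \<Rightarrow> 99)"
| "rank (ActiveCollide q) l s n = (case q of Act1a \<Rightarrow> 60 | Act1b \<Rightarrow> 59 | Act2a \<Rightarrow> 58 | Act2b \<Rightarrow> 57)"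
| "rank (Combine q) l s n = (case q of Com1a \<Rightarrow> 41 | Com1b \<Rightarrow> 40 | Com1c \<Rightarrow> 39 | Com1d \<Rightarrow> 38 | Com1e \<Rightarrow> 37 |
     Com2a \<Rightarrow> 36 | Com2b \<Rightarrow> 35 | Com3a \<Rightarrow> 34 | Com3b \<Rightarrow> 33 | Com4a \<Rightarrow> 32 | Com4b \<Rightarrow> 31 | Com4c \<Rightarrow> 30)"
| "rank (PassiveCollide q) l s n = (case q of Pas1a \<Rightarrow> 19 | Pas1b \<Rightarrow> 18 | Pas2a \<Rightarrow> 17 | Pas2b \<Rightarrow> 16 | Pas3a \<Rightarrow> 15 |
     Pas3b \<Rightarrow> 14 | Pas4a \<Rightarrow> 13 | Pas4b \<Rightarrow> 12 | Pas4c \<Rightarrow> 11 | Pas5 \<Rightarrow> 10 | Pas6a \<Rightarrow> 9 | Pas6b \<Rightarrow> 8)"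
| "rank _ l s n = 0"

section \<open>Effect of single steps on stage and rank\<close>

lemma loop_body_simps:
  "loop_body l = (q, l') \<Longrightarrow> (q = CMultiPop CPop1 \<or> q = CMultiPush CPush1) \<and> vTop l' = vTop l"
  "(q, l') = loop_body l \<Longrightarrow> (q = CMultiPop CPop1 \<or> q = CMultiPush CPush1) \<and> vTop l' = vTop l"
  by (auto simp: loop_body_def split: operation.splits)

lemma op_return_settled: "op_return l = (q, l') \<Longrightarrow> settled q" "(q, l') = op_return l \<Longrightarrow> settled q"
  by (auto simp: op_return_def split: operation.splits)

lemmas action_defs = load_def store_def cas_def read_cell_def write_cell_def read_mop_def write_mop_def pick_def
  put_central_def put_collision_def put_location_def collide_return_def call_active_def call_passive_def

lemma bind_record: "Option.bind p f = Some r \<Longrightarrow> r = the (f (the p))"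
  by (cases p) auto

text \<open>A successful CAS on the central stack enters the settled points, so excluding these
  freezes the stack. A failing CAS was made with a stale \<open>vTop\<close>, whose stage 5 lies
  above all of \<open>collide\<close>. A current \<open>vTop\<close> gives stage 0, which is left
  only by a successful CAS or a fault.\<close>

lemma code_calm:
  assumes E: "((q', l'), m') \<in> code_of N t q l m" and S: "\<not> settled q" "\<not> settled q'" "q' \<noteq> Fault"
  shows "q' \<noteq> Idle \<and> centralStack m' = centralStack m \<and>
     stage q' (vTop l' \<noteq> centralStack m) \<le> stage q (vTop l \<noteq> centralStack m)"
proof (cases q)
  case (CMultiPop r)
  then show ?thesis using E S
    by (cases r) (auto simp: action_defs split: option.splits if_splits)
next
  case (CMultiPush r)
  then show ?thesis using E S
    by (cases r) (auto simp: action_defs split: option.splits if_splits)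
next
  case (Collide r)
  then show ?thesis using E S
    by (cases r) (auto simp: action_defs split: option.splits if_splits dest!: loop_body_simps op_return_settled)
next
  case (ActiveCollide r)
  then show ?thesis using E S
    by (cases r) (auto simp: action_defs split: option.splits if_splits dest!: loop_body_simps op_return_settled)
next
  case (PassiveCollide r)
  then show ?thesis using E S
    by (cases r) (auto simp: action_defs split: option.splits if_splits dest!: loop_body_simps op_return_settled)
next
  case (Combine r)
  then show ?thesis using E S
    by (cases r) (auto simp: action_defs split: option.splits if_splits dest!: loop_body_simps op_return_settled)
next
  case Init
  then show ?thesis using E S
    by (auto simp: init_multiop_def split: operation.splits dest!: loop_body_simps)
qed (use E S in \<open>auto simp: pick_def\<close>)

text \<open>A successful CAS on the collision array lowers the stage from 4, so without a drop of
  the stage the array stays as it is. This is why \<open>rank\<close> may look at it: a failed CAS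
  was made with an outdated \<open>vHim\<close> and leads to a fresh read, after which the CAS
  succeeds. The arbitrary delay chosen at \<open>Col4a\<close> is paid for by the drop of the stage
  to 2. What remains are the walk over the cells, bounded by the length, and the await.\<close>

lemma code_rank:
  assumes E: "((q', l'), m') \<in> code_of N t q l m" and S: "\<not> settled q" "\<not> settled q'" "q' \<noteq> Fault"
    and P: "\<And>r. q = CMultiPop r \<Longrightarrow> vPOp l = vMOp l"
  shows "stage q' (vTop l' \<noteq> centralStack m) < stage q (vTop l \<noteq> centralStack m) \<or>
     collision m' = collision m \<and> 
     (rank q' l' (collision m) (len m' l') < rank q l (collision m) (len m l) \<or>
      q = PassiveCollide Pas5 \<and> q' = q \<and> vMOp l' = vMOp l \<and> m' = m \<and> status_of m (the (vPInf l)) = INIT)"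
proof (cases q)
  case (CMultiPop r)
  then show ?thesis using E S P
    by (cases r) (auto simp: action_defs split: option.splits if_splits dest: bind_record)
next
  case (CMultiPush r)
  then show ?thesis using E S
    by (cases r) (auto simp: action_defs split: option.splits if_splits)
next
  case (Collide r)
  then show ?thesis using E S
    by (cases r) (auto simp: action_defs split: option.splits if_splits dest!: loop_body_simps op_return_settled)
next
  case (ActiveCollide r)
  then show ?thesis using E S
    by (cases r) (auto simp: action_defs split: option.splits if_splits dest!: loop_body_simps op_return_settled)
next
  case (PassiveCollide r)
  then show ?thesis using E S
    by (cases r) (auto simp: action_defs split: option.splits if_splits dest: bind_record dest!: loop_body_simps op_return_settled)
next
  case (Combine r)
  then show ?thesis using E S
    by (cases r) (auto simp: action_defs split: option.splits if_splits dest!: loop_body_simps op_return_settled)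
next
  case Init
  then show ?thesis using E S
    by (auto simp: init_multiop_def split: operation.splits dest!: loop_body_simps)
qed (use E S in \<open>auto simp: pick_def\<close>)

text \<open>Only elimination and \<open>combine\<close> write the length of an existing record.
  Elimination is settled, and \<open>combine\<close> writes that of the own record, so the bound for
  another thread's walk over the cells stays fixed.\<close>

lemma code_length:
  assumes E: "((q', l'), m') \<in> code_of N t q l m" and S: "\<not> settled q"
    and P: "\<And>r. q = Combine r \<Longrightarrow> vAInf l = vMOp l \<and> the (vMOp l) \<noteq> x" and x: "alive m x"
  shows "m_length (the (mops m' x)) = m_length (the (mops m x))"
proof (cases q)
  case (CMultiPop r)
  then show ?thesis using E S
    by (cases r) (auto simp: action_defs split: option.splits if_splits)
next
  case (CMultiPush r)
  then show ?thesis using E S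
    by (cases r) (auto simp: action_defs split: option.splits if_splits)
next
  case (Collide r)
  then show ?thesis using E S
    by (cases r) (auto simp: action_defs split: option.splits if_splits)
next
  case (ActiveCollide r)
  then show ?thesis using E S
    by (cases r) (auto simp: action_defs split: option.splits if_splits)
next
  case (PassiveCollide r)
  then show ?thesis using E S
    by (cases r) (auto simp: action_defs split: option.splits if_splits dest: bind_record)
next
  case (Combine r)
  then show ?thesis using E S P x
    by (cases r) (auto simp: action_defs split: option.splits if_splits dest: bind_record)
next
  case Init
  then show ?thesis using E S x
    by (auto simp: init_multiop_def split: operation.splits)
qed (use E S in \<open>auto simp: pick_def\<close>)

lemma rank_len: "(\<And>r. q = CMultiPop r \<Longrightarrow> n = n') \<Longrightarrow> rank q l s n = rank q l s n'"
  by (cases q) auto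

text \<open>Summing reduces the family to one sequence; while the sum is constant, no summand can
  decrease.\<close>

lemma eventually_const_family:
  fixes f :: "nat \<Rightarrow> 'a \<Rightarrow> nat"
  assumes A: "finite A" and f: "\<And>j u. j \<ge> k \<Longrightarrow> f (Suc j) u \<le> f j u"
  obtains k' where "k' \<ge> k" "\<And>j u. j \<ge> k' \<Longrightarrow> u \<in> A \<Longrightarrow> f (Suc j) u = f j u"
proof -
  have "\<exists>k'\<ge>k. \<forall>j\<ge>k'. (\<Sum>u\<in>A. f j u) = (\<Sum>u\<in>A. f k' u)"
    by (rule eventually_const) (rule sum_mono[OF f])
  then obtain k' where k': "k' \<ge> k" "\<And>j. j \<ge> k' \<Longrightarrow> (\<Sum>u\<in>A. f j u) = (\<Sum>u\<in>A. f k' u)" by blast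
  have "f (Suc j) u = f j u" if j: "j \<ge> k'" and u: "u \<in> A" for j u
  proof (rule sum_mono_inv[of "f (Suc j)" A "f j"])
    show "(\<Sum>u\<in>A. f (Suc j) u) = (\<Sum>u\<in>A. f j u)" using k'(2)[of "Suc j"] k'(2)[of j] j by simp
    show "f (Suc j) v \<le> f j v" for v using f k'(1) j by simp
  qed (use A u in auto)
  then show thesis using that k'(1) by blast
qed

text \<open>The situation to be refuted: an execution with its ghost states and without a return
  from index \<open>i\<close> on. The alternative in \<open>keeps_scheduling\<close> that the
  operation completes is then void, which leaves \<open>fair\<close>.\<close>

locale stalled =
  fixes N :: nat and c :: "nat \<Rightarrow> 'd config" and e :: "nat \<Rightarrow> (nat \<times> 'd event) option" and i :: nat
    and ow :: "nat \<Rightarrow> mref \<Rightarrow> nat" and G H :: "nat \<Rightarrow> nat \<Rightarrow> mref list"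
  assumes exec: "execution N c e"
    and inv: "Inv (c j) (ow j) (G j) (H j)"
    and advance: "e j = Some (t, a) \<Longrightarrow> \<forall>r. a \<noteq> Return r \<Longrightarrow>
      progress (c j) (G j) (H j) t (c (Suc j)) (G (Suc j)) (H (Suc j))"
    and still: "e j = None \<Longrightarrow> G (Suc j) = G j \<and> H (Suc j) = H j"
    and stuck: "j \<ge> i \<Longrightarrow> e j \<noteq> Some (t, Return r)"
    and fair: "j \<ge> i \<Longrightarrow> pending (c j) t \<Longrightarrow> \<exists>k\<ge>j. \<exists>a. e k = Some (t, a)"
begin

lemma nonstep: "e j = None \<Longrightarrow> c (Suc j) = c j"
  using exec unfolding execution_def by (auto dest: spec[of _ j])

lemma step_at:
  assumes "j \<ge> i" "e j = Some (t, a)"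
  obtains q l m where "t \<in> {1..N}" "c (Suc j) = thread_upd (c j) t q l m"
    "ctl (c j) t = Idle \<and> q = Init \<and> m = mem (c j) \<or>
     ctl (c j) t \<noteq> Idle \<and> ((q, l), m) \<in> code_of N t (ctl (c j) t) (lcl (c j) t) (mem (c j))"
proof -
  have t: "t \<in> {1..N}" and st: "step N t a (c j) (c (Suc j))"
    using exec assms(2) unfolding execution_def by (auto dest: spec[of _ j])
  from st show thesis
  proof cases
    case (invoke x)
    then show thesis
      by (intro that[of Init "(lcl (c j) t)\<lparr>invoked := x\<rparr>" "mem (c j)"]) (use t in \<open>auto simp: thread_upd_def\<close>)
  next
    case (internal q l m)
    have "ctl (c j) t \<noteq> Idle" using internal(3) by auto
    then show thesis using internal t by (intro that[of q l m]) (auto simp: thread_upd_def)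
  next
    case return
    then show thesis using stuck assms by blast
  qed
qed

text \<open>Own steps lower \<open>settled_rank\<close>, steps of others do not touch it, and
  fairness supplies another own step after every index; so the rank would decrease forever.\<close>

lemma not_settled:
  assumes "j \<ge> i"
  shows "\<not> settled (ctl (c j) t)"
proof
  assume S: "settled (ctl (c j) t)"
  define f where "f k = settled_rank (ctl (c k) t) (length (G k t)) (length (H k t))" for k
  have one: "settled (ctl (c (Suc k)) t) \<and> f (Suc k) \<le> f k \<and> ((\<exists>a. e k = Some (t, a)) \<longrightarrow> f (Suc k) < f k)"
    if k: "k \<ge> j" "settled (ctl (c k) t)" for k
  proof (cases "e k")
    case None
    then show ?thesis using k nonstep still by (simp add: f_def)
  next
    case (Some p)
    obtain u a where p: "e k = Some (u, a)" using Some by (cases p) auto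
    have i: "i \<le> k" using k assms by simp
    have P: "progress (c k) (G k) (H k) u (c (Suc k)) (G (Suc k)) (H (Suc k))"
      using advance[OF p] stuck[OF i] p by blast
    show ?thesis
    proof (cases "u = t")
      case True
      then show ?thesis using P k unfolding progress_def f_def by auto
    next
      case False
      obtain q l m where "c (Suc k) = thread_upd (c k) u q l m" using step_at[OF i p] by metis
      then have "ctl (c (Suc k)) t = ctl (c k) t" using False by simp
      then show ?thesis using P k False p unfolding progress_def f_def by auto
    qed
  qed
  have all: "settled (ctl (c k) t)" if "k \<ge> j" for k
    using that by (induction k rule: dec_induct) (use S one in auto)
  obtain k where k: "k \<ge> j" "\<forall>k'\<ge>k. f k' = f k"
    using eventually_const[of j f] one all by blast
  have "pending (c k) t" using all[OF k(1)] by (auto simp: pending_def)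
  then obtain k' a where k': "k' \<ge> k" "e k' = Some (t, a)" using fair[of k t] k(1) assms le_trans by blast
  have "j \<le> k'" using k(1) k'(1) by simp
  then have "f (Suc k') < f k'" using one[of k'] all[of k'] k'(2) by blast
  moreover have "f (Suc k') = f k" "f k' = f k" using k(2) k'(1) le_SucI by blast+
  ultimately show False by simp
qed

lemma not_Fault: "ctl (c j) t \<noteq> Fault"
  using InvD(2)[OF inv, of j t] by auto

definition stage_at where
  "stage_at j u = stage (ctl (c j) u) (vTop (lcl (c j) u) \<noteq> centralStack (mem (c j)))"

lemma calm:
  assumes j: "j \<ge> i"
  shows "centralStack (mem (c (Suc j))) = centralStack (mem (c j))" "stage_at (Suc j) u \<le> stage_at j u"
    "ctl (c j) u \<noteq> Idle \<Longrightarrow> ctl (c (Suc j)) u \<noteq> Idle"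
proof -
  have "centralStack (mem (c (Suc j))) = centralStack (mem (c j)) \<and> stage_at (Suc j) u \<le> stage_at j u \<and>
    (ctl (c j) u \<noteq> Idle \<longrightarrow> ctl (c (Suc j)) u \<noteq> Idle)"
  proof (cases "e j")
    case None
    then show ?thesis using nonstep by (simp add: stage_at_def)
  next
    case (Some p)
    obtain t a where p: "e j = Some (t, a)" using Some by (cases p) auto
    obtain q l m where s: "c (Suc j) = thread_upd (c j) t q l m"
      "ctl (c j) t = Idle \<and> q = Init \<and> m = mem (c j) \<or>
       ctl (c j) t \<noteq> Idle \<and> ((q, l), m) \<in> code_of N t (ctl (c j) t) (lcl (c j) t) (mem (c j))"
      using step_at[OF j p] by metis
    from s(2) show ?thesis
    proof
      assume "ctl (c j) t = Idle \<and> q = Init \<and> m = mem (c j)"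
      then show ?thesis using s(1) by (auto simp: stage_at_def)
    next
      assume A: "ctl (c j) t \<noteq> Idle \<and> ((q, l), m) \<in> code_of N t (ctl (c j) t) (lcl (c j) t) (mem (c j))"
      have "\<not> settled q" "q \<noteq> Fault" using not_settled[of "Suc j" t] not_Fault[of "Suc j" t] j s(1) by auto
      from code_calm[OF A[THEN conjunct2] not_settled[OF j] this] show ?thesis
        using s(1) by (auto simp: stage_at_def)
    qed
  qed
  then show "centralStack (mem (c (Suc j))) = centralStack (mem (c j))" "stage_at (Suc j) u \<le> stage_at j u"
    "ctl (c j) u \<noteq> Idle \<Longrightarrow> ctl (c (Suc j)) u \<noteq> Idle" by auto
qed

definition rank_at where
  "rank_at j u = rank (ctl (c j) u) (lcl (c j) u) (collision (mem (c j))) (len (mem (c j)) (lcl (c j) u))"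

text \<open>The rank of a thread depends on the shared collision array and, during a walk over the
  cells, on the length of its record. While all stages are constant, steps of other threads change
  neither, so the ranks of all threads decrease together.\<close>

lemma spinning:
  assumes j: "j \<ge> i" and st: "\<And>u. u \<in> {1..N} \<Longrightarrow> stage_at (Suc j) u = stage_at j u"
  shows "rank_at (Suc j) u \<le> rank_at j u"
    and "e j = Some (t, a) \<Longrightarrow> rank_at (Suc j) t = rank_at j t \<Longrightarrow>
      ctl (c j) t = PassiveCollide Pas5 \<and> ctl (c (Suc j)) = ctl (c j) \<and> mem (c (Suc j)) = mem (c j) \<and>
      (\<forall>u. vMOp (lcl (c (Suc j)) u) = vMOp (lcl (c j) u)) \<and>
      status_of (mem (c j)) (the (vMOp (lcl (c j) t))) = INIT"
proof -
  have *: "rank_at (Suc j) u \<le> rank_at j u \<and> (rank_at (Suc j) t = rank_at j t \<longrightarrow>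
      ctl (c j) t = PassiveCollide Pas5 \<and> ctl (c (Suc j)) = ctl (c j) \<and> mem (c (Suc j)) = mem (c j) \<and>
      (\<forall>u. vMOp (lcl (c (Suc j)) u) = vMOp (lcl (c j) u)) \<and>
      status_of (mem (c j)) (the (vMOp (lcl (c j) t))) = INIT)" if p: "e j = Some (t, a)" for t a u
  proof -
    let ?m = "mem (c j)" and ?l = "lcl (c j) t" and ?q = "ctl (c j) t"
    obtain q l m where t: "t \<in> {1..N}" and s: "c (Suc j) = thread_upd (c j) t q l m"
      and A: "?q = Idle \<and> q = Init \<and> m = ?m \<or> ?q \<noteq> Idle \<and> ((q, l), m) \<in> code_of N t ?q ?l ?m"
      using step_at[OF j p] by metis
    have stt: "stage q (vTop l \<noteq> centralStack m) = stage ?q (vTop ?l \<noteq> centralStack ?m)"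
      using st[OF t] s by (simp add: stage_at_def)
    then have E: "((q, l), m) \<in> code_of N t ?q ?l ?m" using A by auto
    have S: "\<not> settled q" "q \<noteq> Fault" using not_settled[of "Suc j" t] not_Fault[of "Suc j" t] j s by auto
    have cs: "centralStack m = centralStack ?m" using calm(1)[OF j] s by simp
    \<comment> \<open>The loop reads the length through \<open>vPOp\<close>, whereas the rank reads
      it through \<open>vMOp\<close>.\<close>
    have P: "vPOp ?l = vMOp ?l" if "?q = CMultiPop r" for r
      using InvD(2)[OF inv, of j t] not_settled[OF j, of t] that by (cases r) auto
    have R: "collision m = collision ?m"
      "rank q l (collision ?m) (len m l) < rank ?q ?l (collision ?m) (len ?m ?l) \<or>
       ?q = PassiveCollide Pas5 \<and> q = ?q \<and> vMOp l = vMOp ?l \<and> m = ?m \<and> status_of ?m (the (vPInf ?l)) = INIT"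
      using code_rank[OF E not_settled[OF j] S P] stt cs by auto
    have oth: "rank_at (Suc j) u = rank_at j u" if u: "u \<noteq> t" for u
    proof -
      have "len m (lcl (c j) u) = len ?m (lcl (c j) u)" if r: "ctl (c j) u = CMultiPop r" for r
      proof (rule code_length[OF E not_settled[OF j]])
        have b: "base ?m u (vMOp (lcl (c j) u)) (invoked (lcl (c j) u))"
          using InvD(2)[OF inv, of j u] r by auto
        then show "alive ?m (the (vMOp (lcl (c j) u)))" by (simp add: base_def)
        show "vAInf ?l = vMOp ?l \<and> the (vMOp ?l) \<noteq> the (vMOp (lcl (c j) u))" if "?q = Combine r'" for r'
          using InvD(2)[OF inv, of j t] that b u by (auto simp: base_def)
      qed
      then show ?thesis unfolding rank_at_def using s u R(1) by (auto intro!: rank_len)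
    qed
    have own: "rank_at (Suc j) t = rank q l (collision ?m) (len m l)" "rank_at j t = rank ?q ?l (collision ?m) (len ?m ?l)"
      using s R(1) by (auto simp: rank_at_def)
    have pas: "vPInf ?l = vMOp ?l" if "?q = PassiveCollide Pas5"
      using InvD(2)[OF inv, of j t] that by auto
    from R(2) show ?thesis
    proof
      assume "rank q l (collision ?m) (len m l) < rank ?q ?l (collision ?m) (len ?m ?l)"
      then show ?thesis using oth own by (cases "u = t") auto
    next
      assume B: "?q = PassiveCollide Pas5 \<and> q = ?q \<and> vMOp l = vMOp ?l \<and> m = ?m \<and> status_of ?m (the (vPInf ?l)) = INIT"
      then have "rank_at (Suc j) t = rank_at j t" using own by simp
      then have "rank_at (Suc j) u \<le> rank_at j u" using oth by (cases "u = t") auto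
      moreover have "ctl (c (Suc j)) = ctl (c j)" using s B by auto
      ultimately show ?thesis using s B pas by auto
    qed
  qed
  show "rank_at (Suc j) u \<le> rank_at j u"
  proof (cases "e j")
    case None
    then show ?thesis using nonstep by (simp add: rank_at_def)
  next
    case (Some p)
    then show ?thesis using * by (cases p) blast
  qed
  show "e j = Some (t, a) \<Longrightarrow> rank_at (Suc j) t = rank_at j t \<Longrightarrow>
      ctl (c j) t = PassiveCollide Pas5 \<and> ctl (c (Suc j)) = ctl (c j) \<and> mem (c (Suc j)) = mem (c j) \<and>
      (\<forall>u. vMOp (lcl (c (Suc j)) u) = vMOp (lcl (c j) u)) \<and>
      status_of (mem (c j)) (the (vMOp (lcl (c j) t))) = INIT"
    using * by blast
qed

text \<open>Ranks are monotone only once the stages are constant, hence the two successive limits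
  \<open>k2\<close> and \<open>k\<close>. After \<open>k\<close> the program points, the memory and
  all \<open>vMOp\<close> stay the same, so the contradiction can be found at the single index
  \<open>k\<close>.\<close>

lemma idle: "ctl (c i) t = Idle"
proof (rule ccontr)
  assume np: "ctl (c i) t \<noteq> Idle"
  obtain k2 where k2: "k2 \<ge> i" "\<And>j u. j \<ge> k2 \<Longrightarrow> u \<in> {1..N} \<Longrightarrow> stage_at (Suc j) u = stage_at j u"
    using eventually_const_family[of "{1..N}" i stage_at] calm(2) by blast
  have sp: "rank_at (Suc j) u \<le> rank_at j u" if "j \<ge> k2" for j u
    using spinning(1)[of j u] k2 that by simp
  obtain k where k: "k \<ge> k2" "\<And>j u. j \<ge> k \<Longrightarrow> u \<in> {1..N} \<Longrightarrow> rank_at (Suc j) u = rank_at j u"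
    using eventually_const_family[of "{1..N}" k2 rank_at] sp by blast
  have ki: "k \<ge> i" using k k2 by simp
  have spin: "ctl (c j) t = PassiveCollide Pas5 \<and> ctl (c (Suc j)) = ctl (c j) \<and> mem (c (Suc j)) = mem (c j) \<and>
      (\<forall>u. vMOp (lcl (c (Suc j)) u) = vMOp (lcl (c j) u)) \<and>
      status_of (mem (c j)) (the (vMOp (lcl (c j) t))) = INIT" if j: "j \<ge> k" "e j = Some (t, a)" for j t a
  proof -
    have ij: "i \<le> j" using j(1) ki by simp
    have "t \<in> {1..N}" using step_at[OF ij j(2)] by metis
    then show ?thesis using spinning(2)[OF ij _ j(2)] k2(2)[of j] k(2)[of j t] j(1) k(1) by simp
  qed
  have same: "ctl (c j) = ctl (c k) \<and> mem (c j) = mem (c k) \<and> (\<forall>u. vMOp (lcl (c j) u) = vMOp (lcl (c k) u))"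
    if "j \<ge> k" for j
    using that
  proof (induction j rule: dec_induct)
    case (step j)
    show ?case
    proof (cases "e j")
      case None
      then show ?thesis using step nonstep by simp
    next
      case (Some p)
      then show ?thesis using step spin[of j] by (cases p) auto
    qed
  qed simp
  have P5: "ctl (c k) u = PassiveCollide Pas5 \<and> status_of (mem (c k)) (the (vMOp (lcl (c k) u))) = INIT"
    if u: "ctl (c k) u \<noteq> Idle" for u
  proof -
    \<comment> \<open>Fairness yields a step at some later index; by \<open>same\<close> it
      describes the thread at \<open>k\<close> as well.\<close>
    obtain j a where "j \<ge> k" "e j = Some (u, a)" using fair[OF ki, of u] u unfolding pending_def by blast
    then show ?thesis using spin same by metis
  qed
  \<comment> \<open>A thread in the await that owns its record has status RETRY, in contradiction to
    INIT, so \<open>wait_list\<close> leaves only the empty list. The lists of idle threads are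
    empty anyway.\<close>
  have empty: "G k u = [] \<and> H k u = [] \<and> \<not> (ctl (c k) u \<noteq> Idle \<and> owned (ow k) u (the (vMOp (lcl (c k) u))))" for u
    using InvD(2)[OF inv, of k u] P5[of u] by (cases "ctl (c k) u = Idle") (auto simp: wait_list_def split: if_splits)
  have nk: "ctl (c j) t \<noteq> Idle" if "j \<ge> i" for j
    using that by (induction j rule: dec_induct) (use np calm(3) in auto)
  note q5 = P5[OF nk[OF ki]]
  have "base (mem (c k)) t (vMOp (lcl (c k) t)) (invoked (lcl (c k) t))"
    using InvD(2)[OF inv, of k t] q5 by auto
  then obtain x where x: "vMOp (lcl (c k) t) = Some x" by (auto simp: base_def)
  have "waiting (mem (c k)) t (ctl (c k) t) (lcl (c k) t)" using q5 by simp
  moreover have "ow k x \<noteq> t" using empty[of t] x nk[OF ki] by (simp add: owned_def)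
  ultimately have "status_of (mem (c k)) x = FINISHED \<or> x \<in> set (G k (ow k x)) \<union> set (H k (ow k x))"
    using InvD(6)[OF inv _ x] by blast
  then show False using empty[of "ow k x"] q5 x by simp
qed

end

text \<open>\<open>keeps_scheduling\<close> speaks of the threads from 1 to \<open>N\<close> only;
  no other thread ever leaves \<open>Idle\<close>.\<close>

lemma pending_thread: "execution N c e \<Longrightarrow> pending (c j) t \<Longrightarrow> t \<in> {1..N}"
proof (induction j)
  case 0
  then show ?case by (auto simp: execution_def initial_def pending_def)
next
  case (Suc j)
  show ?case
  proof (cases "e j")
    case None
    then have "c (Suc j) = c j" using Suc.prems(1) unfolding execution_def by (auto dest: spec[of _ j])
    then show ?thesis using Suc by simp
  next
    case (Some p)
    obtain u a where p: "e j = Some (u, a)" using Some by (cases p) auto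
    have u: "u \<in> {1..N}" "step N u a (c j) (c (Suc j))"
      using Suc.prems(1) p unfolding execution_def by (auto dest: spec[of _ j])
    show ?thesis
    proof (cases "u = t")
      case False
      from u(2) have "ctl (c (Suc j)) t = ctl (c j) t" by cases (use False in auto)
      then show ?thesis using Suc by (simp add: pending_def)
    qed (use u in simp)
  qed
qed

text \<open>The ghost state is not part of an execution, and a single step yields only the existence
  of a new one; dependent choice strings these together. At an index without a step the ghost state
  is kept.\<close>

lemma ghosts:
  assumes "execution N c e"
  obtains ow G H where "\<And>j. Inv (c j) (ow j) (G j) (H j)"
    "\<And>j t a. e j = Some (t, a) \<Longrightarrow> \<forall>r. a \<noteq> Return r \<Longrightarrow>
      progress (c j) (G j) (H j) t (c (Suc j)) (G (Suc j)) (H (Suc j))"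
    "\<And>j. e j = None \<Longrightarrow> G (Suc j) = G j \<and> H (Suc j) = H j"
proof -
  define P where "P j g = (case g of (ow, G, H) \<Rightarrow> Inv (c j) ow G H)" for j g
  define Q where "Q j g g' = (case (g, g') of ((ow, G, H), (ow', G', H')) \<Rightarrow>
    (\<forall>t a. e j = Some (t, a) \<longrightarrow> (\<forall>r. a \<noteq> Return r) \<longrightarrow> progress (c j) G H t (c (Suc j)) G' H') \<and>
    (e j = None \<longrightarrow> G' = G \<and> H' = H))" for j and g g' :: "(mref \<Rightarrow> nat) \<times> (nat \<Rightarrow> mref list) \<times> (nat \<Rightarrow> mref list)"
  have "\<exists>f. \<forall>j. P j (f j) \<and> Q j (f j) (f (Suc j))"
  proof (rule dependent_nat_choice)
    have "initial (c 0)" using assms by (simp add: execution_def)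
    then show "\<exists>g. P 0 g" unfolding P_def using Inv_initial by fast
    fix g j assume "P j g"
    then obtain ow G H where g: "g = (ow, G, H)" "Inv (c j) ow G H" by (auto simp: P_def split: prod.splits)
    show "\<exists>g'. P (Suc j) g' \<and> Q j g g'"
    proof (cases "e j")
      case None
      then have "c (Suc j) = c j" using assms unfolding execution_def by (auto dest: spec[of _ j])
      then show ?thesis using None g by (intro exI[of _ g]) (simp add: P_def Q_def)
    next
      case (Some p)
      obtain t a where p: "e j = Some (t, a)" using Some by (cases p) auto
      then have "step N t a (c j) (c (Suc j))" using assms unfolding execution_def by (auto dest: spec[of _ j])
      from step_ghost[OF g(2) this] obtain ow' G' H' where "Inv (c (Suc j)) ow' G' H'"
        "(\<forall>r. a \<noteq> Return r) \<longrightarrow> progress (c j) G H t (c (Suc j)) G' H'" by blast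
      then show ?thesis using p g(1) by (intro exI[of _ "(ow', G', H')"]) (simp add: P_def Q_def)
    qed
  qed
  then obtain f where f: "\<And>j. P j (f j)" "\<And>j. Q j (f j) (f (Suc j))" by blast
  show thesis
    by (rule that[of "\<lambda>j. fst (f j)" "\<lambda>j. fst (snd (f j))" "\<lambda>j. snd (snd (f j))"])
       (use f in \<open>simp_all add: P_def Q_def case_prod_beta\<close>)
qed

theorem theorem3:
  fixes N :: nat
    and c :: "nat \<Rightarrow> 'd config"
    and e :: "nat \<Rightarrow> (nat \<times> 'd event) option"
  assumes "N \<ge> 1"
    and "execution N c e"
    and "keeps_scheduling N c e"
  shows "\<forall>i. (\<exists>t \<in> {1..N}. pending (c i) t) \<longrightarrow> (\<exists>j\<ge>i. \<exists>t \<in> {1..N}. completes e j t)"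
proof (intro allI impI, rule ccontr)
  fix i
  assume pend: "\<exists>t \<in> {1..N}. pending (c i) t" and none: "\<not> (\<exists>j\<ge>i. \<exists>t \<in> {1..N}. completes e j t)"
  obtain ow G H where g: "\<And>j. Inv (c j) (ow j) (G j) (H j)"
    "\<And>j t a. e j = Some (t, a) \<Longrightarrow> \<forall>r. a \<noteq> Return r \<Longrightarrow>
      progress (c j) (G j) (H j) t (c (Suc j)) (G (Suc j)) (H (Suc j))"
    "\<And>j. e j = None \<Longrightarrow> G (Suc j) = G j \<and> H (Suc j) = H j"
    using ghosts[OF assms(2)] by blast
  have "stalled N c e i ow G H"
  proof
    fix j t r assume "i \<le> j"
    show "e j \<noteq> Some (t, Return r)"
    proof
      assume A: "e j = Some (t, Return r)"
      then have "t \<in> {1..N}" using assms(2) unfolding execution_def by (auto dest: spec[of _ j])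
      then show False using A none \<open>i \<le> j\<close> unfolding completes_def by blast
    qed
  next
    fix j t assume j: "i \<le> j" and p: "pending (c j) t"
    have t: "t \<in> {1..N}" by (rule pending_thread[OF assms(2) p])
    then have "\<not> (\<exists>k\<ge>j. completes e k t)" using none j by (meson le_trans)
    then have "infinite {k. \<exists>a. e k = Some (t, a)}"
      using assms(3) t p unfolding keeps_scheduling_def by blast
    then have "\<not> {k. \<exists>a. e k = Some (t, a)} \<subseteq> {..<j}"
      using finite_subset by blast
    then show "\<exists>k\<ge>j. \<exists>a. e k = Some (t, a)"
      by (auto simp: not_less)
  qed (use g assms(2) in auto)
  then show False using pend stalled.idle unfolding pending_def by blast
qed

end
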